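(* For each $N\ge1$ let $A$ be an $N\times N$ complex Ginibre matrix, with scaled spectral radius $R_N=\frac{r_{max}^{(N)}(A)}{\sqrt N}$ and scaled minimum modulus $r_N=\frac{r_{min}^{(N)}(A)}{\sqrt N}$. Then $R_N$ and $r_N$ are independent random variables in the limit as $N\to\infty$; that is, for all real $r>0$ and $R>0$, $$\lim_{N\to+\infty}P\left(r_N\ge r\ \text{and}\ R_N\le R\right)=\lim_{N\to+\infty}P\left(r_N\ge r\right)\,\lim_{N\to+\infty}P\left(R_N\le R\right).$$
   Context: The complex Ginibre ensemble is the set of $N\times N$ complex matrices whose entries are i.i.d. standard complex Gaussians with density $\frac1\pi e^{-|w|^2}$ on $\mathbb C$. The joint density of the eigenvalues $z_1,\dots,z_N$ (with respect to Lebesgue measure on $\mathbb C^N$) is $\frac{1}{N!\,\pi^N\prod_{k=0}^{N-1}k!}\exp\left(-\sum_{k}|z_k|^2\right)\prod_{i<j}|z_i-z_j|^2$. Here $r_{min}^{(N)}(A)=\min_k|z_k|$ and $r_{max}^{(N)}(A)=\max_k|z_k|$. *)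

theory Defs
  imports "HOL-Probability.Probability" "Jordan_Normal_Form.Spectral_Radius"
begin

locale complex_ginibre = prob_space M
  for M :: "'a measure" +
  fixes N :: nat and A :: "'a \<Rightarrow> complex mat"
  assumes dim: "\<And>\<omega>. \<omega> \<in> space M \<Longrightarrow> A \<omega> \<in> carrier_mat N N"
    and entry_distributed: "\<And>i j. i < N \<Longrightarrow> j < N \<Longrightarrow>
      distributed M lborel (\<lambda>\<omega>. A \<omega> $$ (i, j)) (\<lambda>w :: complex. ennreal (1 / pi * exp (- (cmod w)\<^sup>2)))"
    and entries_indep:
      "indep_vars (\<lambda>_. borel) (\<lambda>ij \<omega>. A \<omega> $$ ij) ({..<N} \<times> {..<N})"

text \<open>
  Both quantities depend only on the set of eigenvalues, so multiplicities need not be tracked.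
  For dimension \<open>0\<close> the spectrum is empty and the values are unspecified.
\<close>

definition minimum_modulus :: "complex mat \<Rightarrow> real" where
  "minimum_modulus B = Min (norm ` spectrum B)"

definition scaled_spectral_radius :: "complex mat \<Rightarrow> real" where
  "scaled_spectral_radius B = spectral_radius B / sqrt (real (dim_row B))"

definition scaled_minimum_modulus :: "complex mat \<Rightarrow> real" where
  "scaled_minimum_modulus B = minimum_modulus B / sqrt (real (dim_row B))"

end

theory Submission
  imports Defs "HOL-Complex_Analysis.Complex_Analysis"
begin

text \<open>
  For a closed rotation-invariant set \<open>U\<close> the probability that all eigenvalues lie in \<open>U\<close> is the
  product over \<open>k < N\<close> of the ratios \<open>m\<^sub>k(U) / m\<^sub>k(\<complex>)\<close>, where \<open>m\<^sub>k(U)\<close> is the integral of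
  \<open>|z|\<^sup>2\<^sup>k exp(-|z|\<^sup>2)\<close> over \<open>U\<close>.
  Given this law, the minimum modulus on the scale \<open>sqrt N\<close> tends to \<open>0\<close> in probability, because already
  the factor for \<open>k = 0\<close> is at most \<open>1 / (r\<^sup>2 N)\<close>; so the joint and the first marginal probability both
  tend to \<open>0\<close>, and it only remains to see that the law of the spectral radius converges. The factors there are
  Erlang distribution functions at \<open>R\<^sup>2 N\<close>; for \<open>R > 1\<close> their defects are exponentially small, and for
  \<open>R = 1\<close> arbitrarily many of them stay away from \<open>1\<close>.

  The law is derived without the joint density of the matrix eigenvalues as a hypothesis, by splitting off one
  eigenvalue \<open>z\<close> at a time. Write the matrix in blocks \<open>D\<close>, \<open>c\<close>, \<open>w\<close>, \<open>a\<close> with \<open>a\<close> the last diagonal entry.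
  For fixed \<open>D\<close>, \<open>c\<close>, \<open>w\<close> the eigenvalues are the \<open>n + 1\<close> preimages of \<open>a\<close> under a rational map, so
  integration over \<open>a\<close> becomes integration over \<open>z\<close>; for fixed \<open>z\<close> the substitution \<open>c = (z - D) u\<close> is linear, and
  \<open>(u, 1)\<close> is the eigenvector. The two Jacobians multiply to \<open>|det (z - B)|\<^sup>2\<close> where \<open>B = D - u w\<close> is the
  compression, and a linear change of variables depending only on \<open>u\<close> turns \<open>B\<close> into a Ginibre matrix.
  Iterating produces the squared Vandermonde determinant, whose rotational averages are diagonal.
\<close>

section \<open>Area formula for holomorphic maps\<close>

text \<open>The obstacle is to make the induction close. Once an eigenvalue \<open>z\<close> is
  split off, the Jacobian \<open>|det (z - B)|^2\<close> stays inside the integral over the smaller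
  matrix. The quantity followed is therefore not a probability but
  \<open>spec_integral U n ws\<close>, which carries such a factor for every eigenvalue in the list
  \<open>ws\<close> of those removed before. The same list enters \<open>eigen_density\<close>, and
  the two recursions match. No normalising constant is computed on the way. Each step yields a
  factor independent of \<open>U\<close> and \<open>ws\<close>; the case \<open>U = UNIV\<close>,
  where both sides are explicit, fixes the product of all of them at the end. Working in
  \<open>ennreal\<close> lets these factors be carried along before they are known to be finite. The
  rational map has its full number of preimages only if numerator and denominator have no common
  zero. This fails for special matrices, whence the resultant argument for almost every
  \<open>D\<close>, \<open>c\<close>, \<open>w\<close>. Rotation invariance of \<open>U\<close>
  enters only when the squared Vandermonde determinant is integrated.\<close>

definition complex_of_vec :: "real ^ 2 \<Rightarrow> complex"
  where "complex_of_vec v = Complex (vec_nth v 1) (vec_nth v 2)"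

definition vec_of_complex :: "complex \<Rightarrow> real ^ 2"
  where "vec_of_complex z = vector [Re z, Im z]"

lemma complex_of_vec_inverse [simp]: "vec_of_complex (complex_of_vec v) = v"
  by (simp add: vec_of_complex_def complex_of_vec_def Finite_Cartesian_Product.vec_eq_iff forall_2 vector_2)

lemma vec_of_complex_inverse [simp]: "complex_of_vec (vec_of_complex z) = z"
  by (simp add: vec_of_complex_def complex_of_vec_def vector_2)

lemma bounded_linear_complex_of_vec: "bounded_linear complex_of_vec"
  by (rule linear_conv_bounded_linear[THEN iffD1], rule linearI)
     (auto simp: complex_of_vec_def complex_eq_iff)

lemma bounded_linear_vec_of_complex: "bounded_linear vec_of_complex"
  by (rule linear_conv_bounded_linear[THEN iffD1], rule linearI)
     (auto simp: vec_of_complex_def Finite_Cartesian_Product.vec_eq_iff forall_2 vector_2)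

lemma measurable_complex_of_vec [measurable]: "complex_of_vec \<in> borel_measurable borel"
  by (intro borel_measurable_continuous_onI linear_continuous_on bounded_linear_complex_of_vec)

text \<open>Cartesian coordinates serve because \<open>has_measure_differentiable_image\<close>
  speaks of \<open>real ^ 'n\<close> and matrix determinants. Lebesgue measure is determined by its
  values on boxes, and a complex box is a box in these coordinates.\<close>

lemma distr_complex_of_vec: "distr lborel borel complex_of_vec = lborel"
proof (rule lborel_eqI[symmetric])
  fix l u :: complex assume lu: "\<And>b. b \<in> Basis \<Longrightarrow> l \<bullet> b \<le> u \<bullet> b"
  have vim: "complex_of_vec -` box l u = box (vec_of_complex l) (vec_of_complex u)"
    by (auto simp: complex_of_vec_def vec_of_complex_def mem_box_cart in_box_complex_iff forall_2 vector_2)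
  have le: "Re l \<le> Re u" "Im l \<le> Im u"
    using lu[of 1] lu[of \<i>] by (simp_all add: Basis_complex_def)
  have ne: "axis 1 1 \<noteq> (axis 2 1 :: real ^ 2)"
    by (simp add: axis_eq_axis)
  have B: "(Basis :: (real^2) set) = {axis 1 1, axis 2 1}"
    by (auto simp: Basis_vec_def UNIV_2)
  have "emeasure (distr lborel borel complex_of_vec) (box l u)
      = emeasure lborel (box (vec_of_complex l) (vec_of_complex u))"
    by (subst emeasure_distr) (auto simp: vim)
  also have "\<dots> = ennreal (\<Prod>b\<in>Basis. (vec_of_complex u - vec_of_complex l) \<bullet> b)"
    by (rule emeasure_lborel_box) (use le in \<open>auto simp: B inner_axis vec_of_complex_def vector_2\<close>)
  also have "(\<Prod>b\<in>Basis. (vec_of_complex u - vec_of_complex l) \<bullet> b) = (\<Prod>b\<in>Basis. (u - l) \<bullet> b)"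
    using ne by (simp add: B Basis_complex_def inner_axis vec_of_complex_def vector_2 inner_complex_def)
  finally show "emeasure (distr lborel borel complex_of_vec) (box l u) = ennreal (\<Prod>b\<in>Basis. (u - l) \<bullet> b)" .
qed simp

text \<open>By the Cauchy-Riemann equations, multiplication by \<open>d\<close> has the real
  Jacobian determinant \<open>|d|^2\<close>.\<close>

lemma emeasure_holomorphic_image:
  fixes f :: "complex \<Rightarrow> complex"
  assumes V: "open V" and hol: "f holomorphic_on V" and inj: "inj_on f S"
    and S: "S \<in> sets borel" "S \<subseteq> V" and fS: "f ` S \<in> sets borel"
  shows "emeasure lborel (f ` S) = (\<integral>\<^sup>+z\<in>S. ennreal ((cmod (deriv f z))\<^sup>2) \<partial>lborel)"
proof -
  define S' where "S' = complex_of_vec -` S"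
  define g where "g = (\<lambda>v. vec_of_complex (f (complex_of_vec v)))"
  define g' where "g' = (\<lambda>v h. vec_of_complex (deriv f (complex_of_vec v) * complex_of_vec h))"
  have S'[measurable]: "S' \<in> sets borel"
    unfolding S'_def using S(1) measurable_sets[OF measurable_complex_of_vec, of S] by simp
  have der: "(g has_derivative g' v) (at v within S')" if "v \<in> S'" for v
  proof -
    have "complex_of_vec v \<in> V" using that S by (auto simp: S'_def)
    hence "(f has_field_derivative deriv f (complex_of_vec v)) (at (complex_of_vec v))"
      using hol V holomorphic_derivI by blast
    hence d: "(f has_derivative (\<lambda>h. deriv f (complex_of_vec v) * h)) (at (complex_of_vec v) within complex_of_vec ` S')"
      using has_field_derivative_def has_derivative_at_withinI by metis
    show ?thesis unfolding g_def g'_def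
      by (rule bounded_linear.has_derivative[OF bounded_linear_vec_of_complex])
        (rule has_derivative_in_compose[OF bounded_linear_imp_has_derivative[OF bounded_linear_complex_of_vec] d])
  qed
  have inj': "inj_on g S'"
    unfolding g_def S'_def
    by (rule inj_onI) (metis complex_of_vec_inverse vec_of_complex_inverse inj inj_onD vimageE)
  have im: "g ` S' = complex_of_vec -` (f ` S)"
  proof safe
    fix v assume "v \<in> S'" thus "g v \<in> complex_of_vec -` (f ` S)" by (auto simp: g_def S'_def)
  next
    fix v x assume "complex_of_vec v = f x" "x \<in> S"
    hence "v = g (vec_of_complex x)" "vec_of_complex x \<in> S'"
      by (auto simp: g_def S'_def) (metis complex_of_vec_inverse)
    thus "v \<in> g ` S'" by blast
  qed
  have det: "\<bar>Determinants.det (matrix (g' v))\<bar> = (cmod (deriv f (complex_of_vec v)))\<^sup>2" for v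
    by (simp add: det_2 matrix_def g'_def complex_of_vec_def vec_of_complex_def vector_2 axis_def cmod_power2)
       (simp add: power2_eq_square)
  have cont: "continuous_on V (deriv f)"
    by (simp add: V hol holomorphic_deriv holomorphic_on_imp_continuous_on)
  have meas0: "(\<lambda>z. indicator S z *\<^sub>R deriv f z) \<in> borel_measurable borel"
    using borel_measurable_continuous_on_indicator[OF S(1) continuous_on_subset[OF cont S(2)]] by simp
  define J where "J = (\<lambda>v. (cmod (indicator S (complex_of_vec v) *\<^sub>R deriv f (complex_of_vec v)))\<^sup>2)"
  have J[measurable]: "J \<in> borel_measurable borel"
    unfolding J_def using measurable_compose[OF measurable_complex_of_vec meas0] by measurable
  have J_eq: "J v = (if v \<in> S' then \<bar>Determinants.det (matrix (g' v))\<bar> else 0)" for v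
    by (auto simp: J_def det S'_def)
  have "emeasure lborel (f ` S) = emeasure lborel (g ` S')"
    by (subst (1) distr_complex_of_vec[symmetric]) (simp add: emeasure_distr fS im)
  moreover have gS: "g ` S' \<in> sets borel"
    unfolding im using measurable_sets[OF measurable_complex_of_vec fS] by simp
  hence "emeasure lborel (g ` S') = emeasure lebesgue (g ` S')" by simp
  moreover have "(\<integral>\<^sup>+z\<in>S. ennreal ((cmod (deriv f z))\<^sup>2) \<partial>lborel) = (\<integral>\<^sup>+v. ennreal (J v) \<partial>lborel)"
  proof -
    have "(\<integral>\<^sup>+z\<in>S. ennreal ((cmod (deriv f z))\<^sup>2) \<partial>lborel)
        = (\<integral>\<^sup>+z. ennreal ((cmod (indicator S z *\<^sub>R deriv f z))\<^sup>2) \<partial>lborel)"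
      by (intro nn_integral_cong) (auto simp: indicator_def)
    also have "\<dots> = (\<integral>\<^sup>+z. ennreal ((cmod (indicator S z *\<^sub>R deriv f z))\<^sup>2) \<partial>(distr lborel borel complex_of_vec))"
      by (simp add: distr_complex_of_vec)
    also have "\<dots> = (\<integral>\<^sup>+v. ennreal (J v) \<partial>lborel)"
      unfolding J_def by (rule nn_integral_distr) (use meas0 in measurable)
    finally show ?thesis .
  qed
  moreover have "emeasure lebesgue (g ` S') = (\<integral>\<^sup>+v. ennreal (J v) \<partial>lborel)"
  proof -
    \<comment> \<open>This equivalence speaks of finite values \<open>m\<close> only, so finite and
      infinite integrals are treated apart; in the infinite case it shows that the image cannot have
      finite measure.\<close>
    have hmi: "g ` S' \<in> lmeasurable \<and> measure lebesgue (g ` S') = m \<longleftrightarrow> (J has_integral m) UNIV" for m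
      using has_measure_differentiable_image[OF _ der inj', of m] S' unfolding J_eq[abs_def]
      by (simp add: has_integral_restrict_UNIV)
    show ?thesis
    proof (cases "(\<integral>\<^sup>+v. ennreal (J v) \<partial>lborel) = \<infinity>")
      case False
      then obtain r where r: "(\<integral>\<^sup>+v. ennreal (J v) \<partial>lborel) = ennreal r" "r \<ge> 0"
        by (metis ennreal_cases infinity_ennreal_def)
      hence "(J has_integral r) UNIV" by (intro nn_integral_has_integral[OF J]) (auto simp: J_def)
      hence "g ` S' \<in> lmeasurable" "measure lebesgue (g ` S') = r" using hmi by auto
      thus ?thesis using r by (simp add: emeasure_eq_measure2 fmeasurableD2)
    next
      case True
      have "g ` S' \<notin> lmeasurable"
      proof
        assume "g ` S' \<in> lmeasurable"
        hence "(J has_integral measure lebesgue (g ` S')) UNIV" using hmi by auto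
        hence "(\<integral>\<^sup>+v. ennreal (J v) \<partial>lborel) = ennreal (measure lebesgue (g ` S'))"
          using nn_integral_has_integral_lborel[OF J, of "measure lebesgue (g ` S')"] by (auto simp: J_def)
        thus False using True by simp
      qed
      hence "\<not> emeasure lebesgue (g ` S') < \<infinity>" using gS by (auto simp: fmeasurable_def)
      hence "emeasure lebesgue (g ` S') = \<infinity>" by (simp only: not_less top_unique infinity_ennreal_def)
      thus ?thesis using True by simp
    qed
  qed
  ultimately show ?thesis by simp
qed

text \<open>The inverse is holomorphic on the open image of \<open>V\<close>, so the image of
  \<open>S\<close> is a preimage of \<open>S\<close> under a continuous function.\<close>

lemma borel_image_injective_holomorphic:
  fixes f :: "complex \<Rightarrow> complex"
  assumes V: "open V" and hol: "f holomorphic_on V" and inj: "inj_on f V"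
    and S: "S \<in> sets borel" "S \<subseteq> V"
  shows "f ` S \<in> sets borel"
proof -
  obtain h where h: "h holomorphic_on (f ` V)" "\<And>z. z \<in> V \<Longrightarrow> h (f z) = z"
    using holomorphic_has_inverse[OF hol V inj] by metis
  have fV: "open (f ` V)" using open_mapping_thm3[OF hol V inj] .
  have "h \<in> borel_measurable (restrict_space borel (f ` V))"
    by (intro borel_measurable_continuous_on_restrict holomorphic_on_imp_continuous_on h)
  from measurable_sets[OF this S(1)] have "h -` S \<inter> f ` V \<in> sets borel"
    using fV by (simp add: sets_restrict_space_iff space_restrict_space)
  also have "h -` S \<inter> f ` V = f ` S" using h(2) S(2) by (auto simp: image_iff subset_iff)
  finally show ?thesis .
qed

text \<open>Outside finitely many values \<open>a\<close> the equation \<open>g = a d\<close> has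
  \<open>n + 1\<close> distinct solutions, and \<open>J\<close> is the squared modulus of the
  derivative of \<open>g / d\<close>. The domain is cut into countably many pieces on which the map
  is injective; adding up the area formula over them counts the preimages.\<close>

lemma nn_integral_rational_substitution:
  fixes g d :: "complex poly" and k :: "complex \<Rightarrow> ennreal"
  assumes deg: "degree g = Suc n" "degree d = n" and monic: "lead_coeff g = 1" "lead_coeff d = 1"
    and cop: "\<And>z. poly d z = 0 \<Longrightarrow> poly g z \<noteq> 0"
    and k: "k \<in> borel_measurable borel"
  defines "J \<equiv> \<lambda>z. ennreal ((cmod (poly (pderiv g * d - g * pderiv d) z / (poly d z)\<^sup>2))\<^sup>2)"
  shows "(\<integral>\<^sup>+z. J z * k (poly g z / poly d z) \<partial>lborel) = ennreal (Suc n) * (\<integral>\<^sup>+a. k a \<partial>lborel)"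
proof -
  define W where "W = pderiv g * d - g * pderiv d"
  define \<psi> where "\<psi> = (\<lambda>z. poly g z / poly d z)"
  define \<Omega> where "\<Omega> = {z. poly d z \<noteq> 0 \<and> poly W z \<noteq> 0}"
  have d0: "d \<noteq> 0" and g0: "g \<noteq> 0" using monic by auto
  \<comment> \<open>The top coefficient of the numerator of the derivative is
    \<open>(n + 1) - n\<close>, so there are only finitely many critical points.\<close>
  have "coeff W (n + n) = 1"
  proof -
    have c1: "coeff (pderiv g * d) (n + n) = of_nat (Suc n)"
      using coeff_mult_degree_sum[of "pderiv g" d] deg monic by (simp add: degree_pderiv coeff_pderiv)
    have c2: "coeff (g * pderiv d) (n + n) = of_nat n"
    proof (cases n)
      case 0
      hence "pderiv d = 0" using deg by (simp add: pderiv_eq_0_iff)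
      thus ?thesis using 0 by simp
    next
      case (Suc m)
      hence "degree g + degree (pderiv d) = n + n" using deg by (simp add: degree_pderiv)
      thus ?thesis
        using coeff_mult_degree_sum[of g "pderiv d"] deg monic Suc by (simp add: degree_pderiv coeff_pderiv)
    qed
    show ?thesis unfolding W_def coeff_diff c1 c2 by simp
  qed
  hence W0: "W \<noteq> 0" by auto
  have [measurable]: "(\<lambda>z. poly p z) \<in> borel_measurable borel" for p :: "complex poly"
    by (intro borel_measurable_continuous_onI continuous_intros)
  have \<psi>[measurable]: "\<psi> \<in> borel_measurable borel" unfolding \<psi>_def by measurable
  have J[measurable]: "J \<in> borel_measurable borel" unfolding J_def by measurable
  have fin: "finite (- \<Omega>)"
  proof -
    have "- \<Omega> = {z. poly d z = 0} \<union> {z. poly W z = 0}" by (auto simp: \<Omega>_def)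
    thus ?thesis using d0 W0 by (simp add: poly_roots_finite)
  qed
  have open\<Omega>: "open \<Omega>" using fin by (metis finite_imp_closed open_closed)
  have der: "(\<psi> has_field_derivative poly W z / (poly d z)\<^sup>2) (at z)" if "poly d z \<noteq> 0" for z
    unfolding \<psi>_def W_def
    by (rule derivative_eq_intros poly_DERIV refl that)+ (use that in \<open>simp add: field_simps power2_eq_square\<close>)
  have dW: "deriv \<psi> z = poly W z / (poly d z)\<^sup>2" if "z \<in> \<Omega>" for z
    using der that by (auto simp: \<Omega>_def intro: DERIV_imp_deriv)
  have hol: "\<psi> holomorphic_on \<Omega>"
    by (rule holomorphic_onI, rule field_differentiable_at_within)
       (use der in \<open>auto simp: \<Omega>_def field_differentiable_def\<close>)
  \<comment> \<open>The derivative does not vanish on \<open>\<Omega>\<close>, so injectivity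
    domains cover it; Lindelof makes the cover countable and \<open>disjointed\<close> turns it into
    a partition.\<close>
  define F where "F = {B. open B \<and> B \<subseteq> \<Omega> \<and> inj_on \<psi> B}"
  obtain F' where F': "F' \<subseteq> F" "countable F'" "\<Union>F' = \<Union>F"
    using Lindelof[of F] by (auto simp: F_def)
  have UF: "\<Union>F = \<Omega>"
  proof
    show "\<Omega> \<subseteq> \<Union>F"
    proof
      fix z assume z: "z \<in> \<Omega>"
      have "deriv \<psi> z \<noteq> 0" using dW[OF z] z by (auto simp: \<Omega>_def)
      then obtain r where "r > 0" "ball z r \<subseteq> \<Omega>" "inj_on \<psi> (ball z r)"
        using has_complex_derivative_locally_injective[OF hol z open\<Omega>] by metis
      thus "z \<in> \<Union>F" unfolding F_def by (auto intro!: exI[of _ "ball z r"])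
    qed
  qed (auto simp: F_def)
  have "\<Omega> \<noteq> {}" using fin infinite_UNIV_char_0 by (metis Compl_empty_eq)
  hence F'ne: "F' \<noteq> {}" using F' UF by auto
  define V where "V = from_nat_into F'"
  have V: "open (V i)" "V i \<subseteq> \<Omega>" "inj_on \<psi> (V i)" for i
    using from_nat_into[OF F'ne, of i] F'(1) by (auto simp: V_def F_def)
  have UV: "(\<Union>i. V i) = \<Omega>"
    using F' UF F'ne by (simp add: V_def range_from_nat_into)
  define B where "B = disjointed V"
  have BV: "B i \<subseteq> V i" for i by (simp add: B_def disjointed_subset)
  have UB: "(\<Union>i. B i) = \<Omega>" by (simp add: B_def UN_disjointed_eq UV)
  have disj: "disjoint_family B" unfolding B_def by (rule disjoint_family_disjointed)
  have Bm[measurable]: "B i \<in> sets borel" for i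
  proof -
    have "V j \<in> sets borel" for j using V(1) by simp
    thus ?thesis unfolding B_def disjointed_def by auto
  qed
  have hV: "\<psi> holomorphic_on V i" for i using hol V(2) holomorphic_on_subset by blast
  have J0: "J z = 0" if "z \<notin> \<Omega>" for z
    using that by (auto simp: J_def \<Omega>_def W_def)
  \<comment> \<open>The critical values. A zero of \<open>W\<close> that is also a zero of
    \<open>d\<close> adds at most the value 0, since division by zero yields 0.\<close>
  define X where "X = \<psi> ` {z. poly W z = 0}"
  have finX: "finite X" unfolding X_def by (simp add: W0 poly_roots_finite)
  have count: "(\<Sum>i. indicator (\<psi> ` B i) a) = ennreal (Suc n)" if a: "a \<notin> X" for a
  proof -
    define p where "p = g - Polynomial.smult a d"
    define R where "R = {z. poly p z = 0}"
    have degp: "degree p = Suc n"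
    proof -
      have "degree (Polynomial.smult a d) < degree g" using deg by (auto simp: degree_smult_le le_imp_less_Suc intro: le_less_trans[OF degree_smult_le])
      thus ?thesis unfolding p_def using degree_add_eq_left[of "- Polynomial.smult a d" g] deg by simp
    qed
    have Rprop: "poly d z \<noteq> 0 \<and> poly (pderiv p) z \<noteq> 0 \<and> \<psi> z = a" if "z \<in> R" for z
    proof -
      from that have gz: "poly g z = a * poly d z" by (simp add: R_def p_def)
      hence dz: "poly d z \<noteq> 0" using cop by auto
      hence pz: "\<psi> z = a" using gz by (simp add: \<psi>_def)
      have "poly W z \<noteq> 0" using a pz by (auto simp: X_def)
      \<comment> \<open>At a root of \<open>p\<close> one has \<open>g = a d\<close>, and
        \<open>W\<close> collapses to \<open>p' d\<close>. A value that is not critical has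
        therefore only simple preimages.\<close>
      moreover have "poly W z = poly (pderiv p) z * poly d z"
        by (simp add: W_def p_def gz pderiv_diff pderiv_smult algebra_simps)
      ultimately show ?thesis using dz pz by auto
    qed
    have "rsquarefree p"
      unfolding rsquarefree_roots using Rprop by (auto simp: R_def)
    moreover have "p \<noteq> 0" using degp by auto
    ultimately have cR: "card R = Suc n"
      using rsquarefree_card_degree[of p] degp by (auto simp: R_def)
    have finR: "finite R" using cR card.infinite by force
    have R\<Omega>: "R \<subseteq> \<Omega>"
    proof
      fix z assume z: "z \<in> R"
      have "poly W z \<noteq> 0" using Rprop[OF z] a by (auto simp: X_def)
      thus "z \<in> \<Omega>" using Rprop[OF z] by (auto simp: \<Omega>_def)
    qed
    have mem: "z \<in> R" if "z \<in> \<Omega>" "\<psi> z = a" for z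
      using that by (auto simp: R_def p_def \<psi>_def \<Omega>_def)
    \<comment> \<open>A piece contains at most one preimage, so the indicator of its image counts
      the roots in it, and the sum over all pieces is \<open>card R\<close>.\<close>
    have ind: "indicator (\<psi> ` B i) a = emeasure (count_space UNIV) (R \<inter> B i)" for i
    proof (cases "a \<in> \<psi> ` B i")
      case True
      then obtain z where z: "z \<in> B i" "\<psi> z = a" by auto
      have "R \<inter> B i = {z}"
      proof
        show "R \<inter> B i \<subseteq> {z}"
        proof
          fix y assume y: "y \<in> R \<inter> B i"
          hence "\<psi> y = \<psi> z" using Rprop z by auto
          thus "y \<in> {z}" using inj_onD[OF V(3)[of i], of y z] y z BV by auto
        qed
        show "{z} \<subseteq> R \<inter> B i" using z mem UB by auto
      qed
      thus ?thesis using True by simp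
    next
      case False
      hence "R \<inter> B i = {}" using Rprop by auto
      thus ?thesis using False by simp
    qed
    have "(\<Sum>i. emeasure (count_space UNIV) (R \<inter> B i)) = emeasure (count_space UNIV) (\<Union>i. R \<inter> B i)"
      by (rule suminf_emeasure) (use disj in \<open>auto simp: disjoint_family_on_def\<close>)
    also have "(\<Union>i. R \<inter> B i) = R" using R\<Omega> UB by auto
    also have "emeasure (count_space UNIV) R = ennreal (Suc n)"
      using finR cR by (simp add: ennreal_of_nat_eq_real_of_nat)
    finally show ?thesis by (simp add: ind)
  qed
  have key: "(\<integral>\<^sup>+z. J z * indicator E (\<psi> z) \<partial>lborel) = ennreal (Suc n) * emeasure lborel E"
    if E[measurable]: "E \<in> sets borel" for E
  proof -
    define C where "C = (\<lambda>i. B i \<inter> \<psi> -` E)"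
    have "\<psi> -` E \<in> sets borel" using measurable_sets[OF \<psi> E] by simp
    hence Cm[measurable]: "C i \<in> sets borel" for i unfolding C_def by auto
    have CV: "C i \<subseteq> V i" for i using BV by (auto simp: C_def)
    have imC[measurable]: "\<psi> ` C i \<in> sets borel" for i
      by (rule borel_image_injective_holomorphic[OF V(1) hV V(3) Cm CV])
    have sumind: "J z * indicator E (\<psi> z) = (\<Sum>i. J z * indicator (C i) z)" for z
    proof -
      have dC: "disjoint_family C" using disj by (auto simp: C_def disjoint_family_on_def)
      have "(\<Sum>i. J z * indicator (C i) z) = J z * indicator (\<Union>i. C i) z"
        using suminf_indicator[OF dC, of z] by (simp add: ennreal_suminf_cmult)
      also have "\<dots> = J z * indicator E (\<psi> z)"
        using J0[of z] UB by (auto simp: indicator_def C_def)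
      finally show ?thesis by simp
    qed
    have each: "(\<integral>\<^sup>+z. J z * indicator (C i) z \<partial>lborel) = emeasure lborel (\<psi> ` C i)" for i
    proof -
      have "emeasure lborel (\<psi> ` C i) = (\<integral>\<^sup>+z\<in>C i. ennreal ((cmod (deriv \<psi> z))\<^sup>2) \<partial>lborel)"
        by (rule emeasure_holomorphic_image[OF V(1) hV inj_on_subset[OF V(3) CV] Cm CV imC])
      also have "\<dots> = (\<integral>\<^sup>+z. J z * indicator (C i) z \<partial>lborel)"
        by (intro nn_integral_cong) (use CV V(2) dW in \<open>fastforce simp: indicator_def J_def W_def\<close>)
      finally show ?thesis by simp
    qed
    have "(\<integral>\<^sup>+z. J z * indicator E (\<psi> z) \<partial>lborel) = (\<Sum>i. \<integral>\<^sup>+z. J z * indicator (C i) z \<partial>lborel)"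
      unfolding sumind by (rule nn_integral_suminf) measurable
    also have "\<dots> = (\<Sum>i. \<integral>\<^sup>+a. indicator (\<psi> ` C i) a \<partial>lborel)"
      by (simp add: each)
    also have "\<dots> = (\<integral>\<^sup>+a. (\<Sum>i. indicator (\<psi> ` C i) a) \<partial>lborel)"
      by (rule nn_integral_suminf[symmetric]) measurable
    also have "\<dots> = (\<integral>\<^sup>+a. ennreal (Suc n) * indicator E a \<partial>lborel)"
    proof (rule nn_integral_cong_AE)
      have "AE a in lborel. a \<notin> X"
        by (rule AE_not_in) (simp add: finX finite_imp_null_set_lborel)
      thus "AE a in lborel. (\<Sum>i. indicator (\<psi> ` C i) a) = ennreal (Suc n) * indicator E a"
      proof eventually_elim
        case (elim a)
        have "indicator (\<psi> ` C i) a = indicator E a * (indicator (\<psi> ` B i) a :: ennreal)" for i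
          by (auto simp: indicator_def C_def)
        thus ?case using count[OF elim] by (simp add: ennreal_suminf_cmult mult.commute)
      qed
    qed
    also have "\<dots> = ennreal (Suc n) * emeasure lborel E"
      by (simp add: nn_integral_cmult)
    finally show ?thesis .
  qed
  \<comment> \<open>Indicators determine the image measure; as an equality of measures the formula
    extends to every measurable \<open>k\<close>.\<close>
  have "distr (density lborel J) borel \<psi> = density lborel (\<lambda>_. ennreal (Suc n))"
  proof (rule measure_eqI)
    fix E assume "E \<in> sets (distr (density lborel J) borel \<psi>)"
    hence E[measurable]: "E \<in> sets borel" by simp
    have "emeasure (distr (density lborel J) borel \<psi>) E = (\<integral>\<^sup>+z. J z * indicator E (\<psi> z) \<partial>lborel)"
    proof -
      have "\<psi> -` E \<in> sets borel" using measurable_sets[OF \<psi> E] by simp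
      thus ?thesis
        by (subst emeasure_distr) (simp_all add: emeasure_density indicator_def)
    qed
    thus "emeasure (distr (density lborel J) borel \<psi>) E = emeasure (density lborel (\<lambda>_. ennreal (Suc n))) E"
      using key[OF E] by (simp add: emeasure_density nn_integral_cmult)
  qed simp
  hence "(\<integral>\<^sup>+a. k a \<partial>(distr (density lborel J) borel \<psi>)) = (\<integral>\<^sup>+a. k a \<partial>(density lborel (\<lambda>_. ennreal (Suc n))))"
    by simp
  moreover have "(\<integral>\<^sup>+a. k a \<partial>(distr (density lborel J) borel \<psi>)) = (\<integral>\<^sup>+z. J z * k (\<psi> z) \<partial>lborel)"
    using k by (simp add: nn_integral_distr nn_integral_density)
  moreover have "(\<integral>\<^sup>+a. k a \<partial>(density lborel (\<lambda>_. ennreal (Suc n)))) = ennreal (Suc n) * (\<integral>\<^sup>+a. k a \<partial>lborel)"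
    using k by (simp add: nn_integral_density nn_integral_cmult)
  ultimately show ?thesis by (simp add: \<psi>_def)
qed

section \<open>Linear changes of variables in complex coordinate space\<close>

lemma nn_integral_complex_affine:
  fixes k :: "complex \<Rightarrow> ennreal"
  assumes s: "s \<noteq> 0" and k: "k \<in> borel_measurable borel"
  shows "ennreal ((cmod s)\<^sup>2) * (\<integral>\<^sup>+z. k (t + s * z) \<partial>lborel) = (\<integral>\<^sup>+z. k z \<partial>lborel)"
proof -
  define f where "f = (\<lambda>z. (z - t) / s)"
  have m[measurable]: "(\<lambda>z. t + s * z) \<in> borel_measurable borel"
    by (intro borel_measurable_continuous_onI continuous_intros)
  have "density (distr lborel borel (\<lambda>z. t + s * z)) (\<lambda>_. ennreal ((cmod s)\<^sup>2)) = lborel"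
  proof (rule measure_eqI)
    fix E assume "E \<in> sets (density (distr lborel borel (\<lambda>z. t + s * z)) (\<lambda>_. ennreal ((cmod s)\<^sup>2)))"
    hence E[measurable]: "E \<in> sets borel" by simp
    \<comment> \<open>The preimage of \<open>E\<close> is its image under the inverse affine map
      \<open>f\<close>, to which the area formula applies with derivative
      \<open>1 / s\<close>.\<close>
    have pre: "(\<lambda>z. t + s * z) -` E = f ` E"
    proof safe
      fix z assume "t + s * z \<in> E"
      moreover have "z = f (t + s * z)" using s by (simp add: f_def)
      ultimately show "z \<in> f ` E" by blast
    qed (use s in \<open>simp add: f_def\<close>)
    have fE: "f ` E \<in> sets borel" using measurable_sets[OF m E] by (simp add: pre)
    have hol: "f holomorphic_on UNIV" unfolding f_def by (intro holomorphic_intros) (use s in auto)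
    have "(f has_field_derivative 1 / s) (at z)" for z
      unfolding f_def by (rule derivative_eq_intros refl | use s in simp)+
    hence df: "deriv f z = 1 / s" for z by (rule DERIV_imp_deriv)
    have "emeasure lborel (f ` E) = (\<integral>\<^sup>+z\<in>E. ennreal ((cmod (deriv f z))\<^sup>2) \<partial>lborel)"
      by (rule emeasure_holomorphic_image[OF open_UNIV hol]) (use s E fE in \<open>auto simp: f_def inj_on_def\<close>)
    also have "\<dots> = ennreal (1 / (cmod s)\<^sup>2) * emeasure lborel E"
      by (simp add: df nn_integral_cmult norm_divide power_divide)
    finally have "emeasure lborel (f ` E) = ennreal (1 / (cmod s)\<^sup>2) * emeasure lborel E" .
    hence "ennreal ((cmod s)\<^sup>2) * emeasure lborel (f ` E) = ennreal ((cmod s)\<^sup>2 * (1 / (cmod s)\<^sup>2)) * emeasure lborel E"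
      by (simp only: mult.assoc ennreal_mult' zero_le_power2)
    also have "\<dots> = emeasure lborel E" using s by simp
    finally show "emeasure (density (distr lborel borel (\<lambda>z. t + s * z)) (\<lambda>_. ennreal ((cmod s)\<^sup>2))) E = emeasure lborel E"
      by (simp add: emeasure_density nn_integral_cmult emeasure_distr pre)
  qed simp
  hence "(\<integral>\<^sup>+z. k z \<partial>lborel) = (\<integral>\<^sup>+z. k z \<partial>(density (distr lborel borel (\<lambda>z. t + s * z)) (\<lambda>_. ennreal ((cmod s)\<^sup>2))))"
    by simp
  also have "\<dots> = ennreal ((cmod s)\<^sup>2) * (\<integral>\<^sup>+z. k (t + s * z) \<partial>lborel)"
    using k by (simp add: nn_integral_density nn_integral_cmult nn_integral_distr)
  finally show ?thesis by simp
qed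

abbreviation lebC :: "'i set \<Rightarrow> ('i \<Rightarrow> complex) measure"
  where "lebC I \<equiv> PiM I (\<lambda>_. lborel)"

interpretation lebC: product_sigma_finite "\<lambda>_::'i. lborel :: complex measure"
  by standard

lemma measurable_affine_map [measurable]:
  fixes S :: "'i \<Rightarrow> 'j \<Rightarrow> complex"
  shows "(\<lambda>x. \<lambda>i\<in>I. t i + (\<Sum>j\<in>J. S i j * x j)) \<in> measurable (lebC J) (lebC I)"
  by (rule measurable_restrict) (auto intro!: borel_measurable_add borel_measurable_sum borel_measurable_times)

lemma measurable_fun_upd_lebC:
  assumes "i \<notin> I"
  shows "(\<lambda>(x, y). x(i := y)) \<in> measurable (lebC I \<Otimes>\<^sub>M lborel) (lebC (insert i I))"
  using measurable_add_dim[of i I "\<lambda>_. lborel :: complex measure"] by simp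

lemma
  fixes k :: "('i \<Rightarrow> complex) \<Rightarrow> ennreal"
  assumes i: "i \<notin> I" and k: "k \<in> borel_measurable (lebC (insert i I))"
  shows measurable_fun_upd_pair: "(\<lambda>(x, y). k (x(i := y))) \<in> borel_measurable (lebC I \<Otimes>\<^sub>M lborel)"
    and measurable_fun_upd_left: "(\<lambda>x. k (x(i := y))) \<in> borel_measurable (lebC I)"
    and measurable_fun_upd_right: "x \<in> space (lebC I) \<Longrightarrow> (\<lambda>y. k (x(i := y))) \<in> borel_measurable borel"
proof -
  show m: "(\<lambda>(x, y). k (x(i := y))) \<in> borel_measurable (lebC I \<Otimes>\<^sub>M lborel)"
    using measurable_compose[OF measurable_fun_upd_lebC[OF i] k] by (simp add: case_prod_unfold)
  show "(\<lambda>x. k (x(i := y))) \<in> borel_measurable (lebC I)"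
    using measurable_compose[OF measurable_Pair2'[of y lborel "lebC I"] m] by simp
  show "x \<in> space (lebC I) \<Longrightarrow> (\<lambda>y. k (x(i := y))) \<in> borel_measurable borel"
    using measurable_compose[OF measurable_Pair1'[of x "lebC I" lborel] m] by simp
qed

text \<open>Only the existence of the Jacobian factor is recorded here; where its value matters it is
  identified through a Schur decomposition.\<close>

lemma nn_integral_linear_change:
  fixes S :: "'i \<Rightarrow> 'i \<Rightarrow> complex"
  assumes "finite I"
    and "\<forall>x. (\<forall>i\<in>I. (\<Sum>j\<in>I. S i j * x j) = 0) \<longrightarrow> (\<forall>i\<in>I. x i = 0)"
  shows "\<exists>J::real. J > 0 \<and> (\<forall>t. \<forall>k\<in>borel_measurable (lebC I).
      ennreal J * (\<integral>\<^sup>+x. k (\<lambda>i\<in>I. t i + (\<Sum>j\<in>I. S i j * x j)) \<partial>lebC I) = (\<integral>\<^sup>+x. k x \<partial>lebC I))"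
  using assms
proof (induction I arbitrary: S rule: finite_induct)
  case empty
  show ?case
    by (rule exI[of _ 1]) (auto simp: restrict_def space_PiM PiE_empty_domain lebC.nn_integral_empty)
next
  case (insert i I)
  note [simp] = insert.hyps
  note inj = insert.prems
  have pivot: "\<exists>J::real. J > 0 \<and> (\<forall>t. \<forall>k\<in>borel_measurable (lebC (insert i I)).
      ennreal J * (\<integral>\<^sup>+x. k (\<lambda>a\<in>insert i I. t a + (\<Sum>b\<in>insert i I. S a b * x b)) \<partial>lebC (insert i I))
      = (\<integral>\<^sup>+x. k x \<partial>lebC (insert i I)))"
    if sii: "S i i \<noteq> 0"
      and inj: "\<forall>x. (\<forall>a\<in>insert i I. (\<Sum>b\<in>insert i I. S a b * x b) = 0) \<longrightarrow> (\<forall>a\<in>insert i I. x a = 0)"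
    for S
  proof -
    \<comment> \<open>Gaussian elimination: coordinate \<open>i\<close> is replaced by the value
      \<open>y\<close> of row \<open>i\<close>, and the Schur complement \<open>T\<close> of the
      pivot acts on the other coordinates.\<close>
    define T where "T = (\<lambda>a b. S a b - S a i * S i b / S i i)"
    have Tinj: "x a = 0" if x: "\<And>a. a \<in> I \<Longrightarrow> (\<Sum>b\<in>I. T a b * x b) = 0" and a: "a \<in> I" for x a
    proof -
      \<comment> \<open>Solving row \<open>i\<close> for the \<open>i\<close>-th coordinate extends
        a kernel vector of \<open>T\<close> to a kernel vector of \<open>S\<close>.\<close>
      define x' where "x' = x(i := - (\<Sum>b\<in>I. S i b * x b) / S i i)"
      have xI: "(\<Sum>b\<in>I. S a b * x' b) = (\<Sum>b\<in>I. S a b * x b)" for a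
        by (intro sum.cong) (auto simp: x'_def)
      have "(\<Sum>b\<in>insert i I. S a b * x' b) = 0" if "a \<in> insert i I" for a
      proof (cases "a = i")
        case True
        thus ?thesis using sii by (simp add: xI) (simp add: x'_def)
      next
        case False
        have "(\<Sum>b\<in>I. T a b * x b) = (\<Sum>b\<in>I. S a b * x b) - S a i * (\<Sum>b\<in>I. S i b * x b) / S i i"
          by (simp add: T_def algebra_simps sum_subtractf sum_distrib_left sum_divide_distrib)
        with x[of a] False that have "(\<Sum>b\<in>I. S a b * x b) = S a i * (\<Sum>b\<in>I. S i b * x b) / S i i" by auto
        thus ?thesis by (simp add: xI) (simp add: x'_def)
      qed
      with inj a have "x' a = 0" by blast
      thus ?thesis using a by (auto simp: x'_def split: if_splits)
    qed
    obtain J' :: real where J': "J' > 0" and IH: "\<And>t k. k \<in> borel_measurable (lebC I) \<Longrightarrow>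
       ennreal J' * (\<integral>\<^sup>+x. k (\<lambda>a\<in>I. t a + (\<Sum>b\<in>I. T a b * x b)) \<partial>lebC I) = (\<integral>\<^sup>+x. k x \<partial>lebC I)"
      using insert.IH[of T] Tinj by blast
    define J where "J = (cmod (S i i))\<^sup>2 * J'"
    have "ennreal J * (\<integral>\<^sup>+x. k (\<lambda>a\<in>insert i I. t a + (\<Sum>b\<in>insert i I. S a b * x b)) \<partial>lebC (insert i I))
      = (\<integral>\<^sup>+x. k x \<partial>lebC (insert i I))"
      if k[measurable]: "k \<in> borel_measurable (lebC (insert i I))" for t k
    proof -
      \<comment> \<open>The translation left after elimination depends on \<open>y\<close>; this is
        why the factor in the statement has to be uniform in \<open>t\<close>.\<close>
      define t' where "t' = (\<lambda>y a. t a + S a i * (y - t i) / S i i)"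
      define F where "F = (\<lambda>x y. k ((\<lambda>a\<in>I. t' y a + (\<Sum>b\<in>I. T a b * x b))(i := y)))"
      have mF: "(\<lambda>(x, y). F x y) \<in> borel_measurable (lebC I \<Otimes>\<^sub>M lborel)"
      proof -
        have "(\<lambda>(x, y). ((\<lambda>a\<in>I. t' y a + (\<Sum>b\<in>I. T a b * x b)), y)) \<in> measurable (lebC I \<Otimes>\<^sub>M lborel) (lebC I \<Otimes>\<^sub>M lborel)"
          unfolding t'_def by measurable
        from measurable_compose[OF this measurable_compose[OF measurable_fun_upd_lebC k]]
        show ?thesis by (simp add: F_def case_prod_unfold)
      qed
      have mF1: "F x \<in> borel_measurable borel" if "x \<in> space (lebC I)" for x
        using measurable_Pair_compose_split[OF mF, of "\<lambda>_. x" borel "\<lambda>y. y"] that by (simp add: measurable_const)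
      have "(\<integral>\<^sup>+x. k (\<lambda>a\<in>insert i I. t a + (\<Sum>b\<in>insert i I. S a b * x b)) \<partial>lebC (insert i I))
          = (\<integral>\<^sup>+x. \<integral>\<^sup>+y. k (\<lambda>a\<in>insert i I. t a + (\<Sum>b\<in>insert i I. S a b * (x(i := y)) b)) \<partial>lborel \<partial>lebC I)"
        by (subst lebC.product_nn_integral_insert) auto
      also have "\<dots> = (\<integral>\<^sup>+x. \<integral>\<^sup>+y. F x ((t i + (\<Sum>b\<in>I. S i b * x b)) + S i i * y) \<partial>lborel \<partial>lebC I)"
      proof (intro nn_integral_cong)
        fix x :: "'i \<Rightarrow> complex" and y :: complex
        have e: "(\<Sum>b\<in>I. S a b * (if b = i then y else x b)) = (\<Sum>b\<in>I. S a b * x b)" for a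
          by (intro sum.cong) auto
        have T: "(\<Sum>b\<in>I. T a b * x b) = (\<Sum>b\<in>I. S a b * x b) - S a i * (\<Sum>b\<in>I. S i b * x b) / S i i" for a
          by (simp add: T_def algebra_simps sum_subtractf sum_distrib_left sum_divide_distrib)
        have q: "t' (t i + (\<Sum>b\<in>I. S i b * x b) + S i i * y) a + (\<Sum>b\<in>I. T a b * x b)
            = t a + (S a i * y + (\<Sum>b\<in>I. S a b * x b))" for a
          using sii unfolding T t'_def by (simp add: field_simps)
        have "(\<lambda>a\<in>insert i I. t a + (\<Sum>b\<in>insert i I. S a b * (x(i := y)) b)) =
             (\<lambda>a\<in>I. t' (t i + (\<Sum>b\<in>I. S i b * x b) + S i i * y) a + (\<Sum>b\<in>I. T a b * x b))
               (i := t i + (\<Sum>b\<in>I. S i b * x b) + S i i * y)"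
          unfolding q by (rule ext) (auto simp: restrict_def e)
        thus "k (\<lambda>a\<in>insert i I. t a + (\<Sum>b\<in>insert i I. S a b * (x(i := y)) b)) = F x ((t i + (\<Sum>b\<in>I. S i b * x b)) + S i i * y)"
          by (simp add: F_def)
      qed
      finally have e1: "(\<integral>\<^sup>+x. k (\<lambda>a\<in>insert i I. t a + (\<Sum>b\<in>insert i I. S a b * x b)) \<partial>lebC (insert i I)) =
         (\<integral>\<^sup>+x. \<integral>\<^sup>+y. F x ((t i + (\<Sum>b\<in>I. S i b * x b)) + S i i * y) \<partial>lborel \<partial>lebC I)" .
      have "ennreal ((cmod (S i i))\<^sup>2) * (\<integral>\<^sup>+x. \<integral>\<^sup>+y. F x ((t i + (\<Sum>b\<in>I. S i b * x b)) + S i i * y) \<partial>lborel \<partial>lebC I)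
          = (\<integral>\<^sup>+x. ennreal ((cmod (S i i))\<^sup>2) * (\<integral>\<^sup>+y. F x ((t i + (\<Sum>b\<in>I. S i b * x b)) + S i i * y) \<partial>lborel) \<partial>lebC I)"
      proof (rule nn_integral_cmult[symmetric])
        have "(\<lambda>p. F (fst p) ((t i + (\<Sum>b\<in>I. S i b * fst p b)) + S i i * snd p)) \<in> borel_measurable (lebC I \<Otimes>\<^sub>M lborel)"
          by (rule measurable_Pair_compose_split[OF mF]) measurable
        hence "(\<lambda>(x, y). F x ((t i + (\<Sum>b\<in>I. S i b * x b)) + S i i * y)) \<in> borel_measurable (lebC I \<Otimes>\<^sub>M lborel)"
          by (simp add: case_prod_unfold)
        thus "(\<lambda>x. \<integral>\<^sup>+y. F x ((t i + (\<Sum>b\<in>I. S i b * x b)) + S i i * y) \<partial>lborel) \<in> borel_measurable (lebC I)"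
          by (rule lborel.borel_measurable_nn_integral)
      qed
      also have "\<dots> = (\<integral>\<^sup>+x. \<integral>\<^sup>+y. F x y \<partial>lborel \<partial>lebC I)"
        by (intro nn_integral_cong nn_integral_complex_affine sii mF1)
      also have "\<dots> = (\<integral>\<^sup>+y. \<integral>\<^sup>+x. F x y \<partial>lebC I \<partial>lborel)"
      proof -
        interpret I: finite_product_sigma_finite "\<lambda>_::'i. lborel :: complex measure" I by standard simp
        interpret P: pair_sigma_finite "lebC I" "lborel :: complex measure" ..
        show ?thesis using P.Fubini'[OF mF] by simp
      qed
      finally have e2: "ennreal ((cmod (S i i))\<^sup>2) * (\<integral>\<^sup>+x. k (\<lambda>a\<in>insert i I. t a + (\<Sum>b\<in>insert i I. S a b * x b)) \<partial>lebC (insert i I))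
        = (\<integral>\<^sup>+y. \<integral>\<^sup>+x. F x y \<partial>lebC I \<partial>lborel)" unfolding e1 .
      have "ennreal J' * (\<integral>\<^sup>+y. \<integral>\<^sup>+x. F x y \<partial>lebC I \<partial>lborel) = (\<integral>\<^sup>+y. ennreal J' * (\<integral>\<^sup>+x. F x y \<partial>lebC I) \<partial>lborel)"
      proof (rule nn_integral_cmult[symmetric])
        interpret I: finite_product_sigma_finite "\<lambda>_::'i. lborel :: complex measure" I by standard simp
        have "(\<lambda>(y, x). F x y) \<in> borel_measurable (lborel \<Otimes>\<^sub>M lebC I)"
          using measurable_pair_swap[OF mF] by (simp add: case_prod_unfold)
        thus "(\<lambda>y. \<integral>\<^sup>+x. F x y \<partial>lebC I) \<in> borel_measurable lborel"
          by (rule I.borel_measurable_nn_integral)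
      qed
      also have "\<dots> = (\<integral>\<^sup>+y. \<integral>\<^sup>+x. k (x(i := y)) \<partial>lebC I \<partial>lborel)"
        unfolding F_def
      proof (intro nn_integral_cong IH[of "\<lambda>x. k (x(i := y))" "t' y" for y])
        fix y :: complex
        show "(\<lambda>x. k (x(i := y))) \<in> borel_measurable (lebC I)"
          by (rule measurable_fun_upd_left[OF insert.hyps(2) k])
      qed
      also have "\<dots> = (\<integral>\<^sup>+x. k x \<partial>lebC (insert i I))"
        by (subst lebC.product_nn_integral_insert_rev) auto
      finally show ?thesis
        unfolding e2[symmetric] J_def using J' by (simp add: ennreal_mult mult.assoc mult.left_commute)
    qed
    moreover have "J > 0" using J' sii by (simp add: J_def)
    ultimately show ?thesis by blast
  qed
  show ?case
  proof (cases "S i i = 0")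
    case False
    show ?thesis by (rule pivot[OF False inj])
  next
    case True
    have "\<exists>m\<in>I. S m i \<noteq> 0"
    proof (rule ccontr)
      assume "\<not> (\<exists>m\<in>I. S m i \<noteq> 0)"
      hence "S a i = 0" if "a \<in> insert i I" for a using True that by auto
      hence "(\<Sum>b\<in>insert i I. S a b * (if b = i then 1 else 0)) = 0" if "a \<in> insert i I" for a
        using that by (simp add: sum.delta')
      with inj[rule_format, of "\<lambda>b. if b = i then 1 else 0" i] show False by auto
    qed
    then obtain m where m: "m \<in> I" "S m i \<noteq> 0" by auto
    hence mi: "m \<noteq> i" using insert.hyps by auto
    \<comment> \<open>Adding row \<open>m\<close> to row \<open>i\<close> makes the pivot nonzero.
      Such an \<open>m\<close> exists, since otherwise the unit vector at \<open>i\<close> would lie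
      in the kernel.\<close>
    define S' where "S' = S(i := \<lambda>b. S i b + S m b)"
    have S'ii: "S' i i \<noteq> 0" using m True by (simp add: S'_def)
    have S'i: "(\<Sum>b\<in>A. S' i b * x b) = (\<Sum>b\<in>A. S i b * x b) + (\<Sum>b\<in>A. S m b * x b)" for A x
      by (simp add: S'_def algebra_simps sum.distrib)
    have S'a: "(\<Sum>b\<in>A. S' a b * x b) = (\<Sum>b\<in>A. S a b * x b)" if "a \<noteq> i" for A x a
      using that by (simp add: S'_def)
    have "x a = 0" if x: "\<And>a. a \<in> insert i I \<Longrightarrow> (\<Sum>b\<in>insert i I. S' a b * x b) = 0" and a: "a \<in> insert i I" for x a
    proof -
      have "(\<Sum>b\<in>insert i I. S a b * x b) = 0" if "a \<in> insert i I" for a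
        using x[of a] x[of m] x[of i] m mi that S'i[of x "insert i I"] S'a[of m x "insert i I"] S'a[of a x "insert i I"]
        by (cases "a = i") auto
      with inj a show ?thesis by blast
    qed
    hence "\<forall>x. (\<forall>a\<in>insert i I. (\<Sum>b\<in>insert i I. S' a b * x b) = 0) \<longrightarrow> (\<forall>a\<in>insert i I. x a = 0)"
      by blast
    from pivot[OF S'ii this] obtain J :: real where J: "J > 0" and ch: "\<And>t k. k \<in> borel_measurable (lebC (insert i I)) \<Longrightarrow>
      ennreal J * (\<integral>\<^sup>+x. k (\<lambda>a\<in>insert i I. t a + (\<Sum>b\<in>insert i I. S' a b * x b)) \<partial>lebC (insert i I))
      = (\<integral>\<^sup>+x. k x \<partial>lebC (insert i I))" by blast
    have "ennreal J * (\<integral>\<^sup>+x. k (\<lambda>a\<in>insert i I. t a + (\<Sum>b\<in>insert i I. S a b * x b)) \<partial>lebC (insert i I))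
      = (\<integral>\<^sup>+x. k x \<partial>lebC (insert i I))" if k[measurable]: "k \<in> borel_measurable (lebC (insert i I))" for t k
    proof -
      \<comment> \<open>\<open>k'\<close> undoes the row operation. With the other coordinates fixed
        this is a translation of the \<open>i\<close>-th one by \<open>- x m\<close>, so the
        integral does not change.\<close>
      define k' where "k' = (\<lambda>x. k (\<lambda>a\<in>insert i I. if a = i then x i - x m else x a))"
      have k'[measurable]: "k' \<in> borel_measurable (lebC (insert i I))"
        unfolding k'_def
        by (rule measurable_compose[OF measurable_restrict k]) (use m in auto)
      have "k (\<lambda>a\<in>insert i I. t a + (\<Sum>b\<in>insert i I. S a b * x b)) =
            k' (\<lambda>a\<in>insert i I. (if a = i then t i + t m else t a) + (\<Sum>b\<in>insert i I. S' a b * x b))" for x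
        unfolding k'_def using m mi
        by (intro arg_cong[of _ _ k] ext) (auto simp: S'_def algebra_simps sum.distrib)
      hence "ennreal J * (\<integral>\<^sup>+x. k (\<lambda>a\<in>insert i I. t a + (\<Sum>b\<in>insert i I. S a b * x b)) \<partial>lebC (insert i I))
         = (\<integral>\<^sup>+x. k' x \<partial>lebC (insert i I))"
        using ch[OF k'] by presburger
      also have "\<dots> = (\<integral>\<^sup>+x. \<integral>\<^sup>+y. k' (x(i := y)) \<partial>lborel \<partial>lebC I)"
        by (rule lebC.product_nn_integral_insert) auto
      also have "\<dots> = (\<integral>\<^sup>+x. \<integral>\<^sup>+y. k (x(i := y)) \<partial>lborel \<partial>lebC I)"
      proof (rule nn_integral_cong)
        fix x assume x: "x \<in> space (lebC I)"
        have "k' (x(i := y)) = k (x(i := - x m + 1 * y))" for y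
          unfolding k'_def using mi x
          by (intro arg_cong[of _ _ k] ext) (auto simp: restrict_def space_PiM PiE_def extensional_def)
        moreover have "(\<lambda>y. k (x(i := y))) \<in> borel_measurable borel"
          by (rule measurable_fun_upd_right[OF insert.hyps(2) k x])
        ultimately show "(\<integral>\<^sup>+y. k' (x(i := y)) \<partial>lborel) = (\<integral>\<^sup>+y. k (x(i := y)) \<partial>lborel)"
          using nn_integral_complex_affine[of 1 "\<lambda>y. k (x(i := y))" "- x m"] by simp
      qed
      also have "\<dots> = (\<integral>\<^sup>+x. k x \<partial>lebC (insert i I))"
        by (rule lebC.product_nn_integral_insert[symmetric]) auto
      finally show ?thesis .
    qed
    with J show ?thesis by blast
  qed
qed

text \<open>The last coordinate is only scaled and translated, because the entries left of the
  diagonal vanish. For a fixed value of it the others undergo a triangular map of size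
  \<open>n\<close> with a shifted translation, so Fubini multiplies the diagonal factors.\<close>

lemma nn_integral_triangular_change:
  fixes S :: "nat \<Rightarrow> nat \<Rightarrow> complex"
  assumes "\<And>i. i < n \<Longrightarrow> S i i \<noteq> 0" "\<And>i j. j < i \<Longrightarrow> i < n \<Longrightarrow> S i j = 0"
    and "k \<in> borel_measurable (lebC {..<n})"
  shows "ennreal (\<Prod>i<n. (cmod (S i i))\<^sup>2) * (\<integral>\<^sup>+x. k (\<lambda>i\<in>{..<n}. t i + (\<Sum>j<n. S i j * x j)) \<partial>lebC {..<n})
    = (\<integral>\<^sup>+x. k x \<partial>lebC {..<n})"
  using assms
proof (induction n arbitrary: t k)
  case 0
  show ?case by (simp add: PiM_empty restrict_def nn_integral_count_space_finite)
next
  case (Suc n)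
  note k = Suc.prems(3)
  have [simp]: "{..<Suc n} = insert n {..<n}" by auto
  have k[measurable]: "k \<in> borel_measurable (lebC (insert n {..<n}))" using Suc.prems(3) by simp
  have snn: "S n n \<noteq> 0" using Suc.prems(1) by simp
  have ky: "(\<lambda>x. k (x(n := y))) \<in> borel_measurable (lebC {..<n})" for y
    by (rule measurable_fun_upd_left[OF _ k]) simp
  have IH: "ennreal (\<Prod>i<n. (cmod (S i i))\<^sup>2) * (\<integral>\<^sup>+x. k' (\<lambda>i\<in>{..<n}. t' i + (\<Sum>j<n. S i j * x j)) \<partial>lebC {..<n})
    = (\<integral>\<^sup>+x. k' x \<partial>lebC {..<n})" if "k' \<in> borel_measurable (lebC {..<n})" for t' k'
    by (rule Suc.IH) (use Suc.prems that in auto)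
  define G where "G = (\<lambda>y. \<integral>\<^sup>+x. k (x(n := y)) \<partial>lebC {..<n})"
  have G: "G \<in> borel_measurable borel"
  proof -
    have "(\<lambda>(y, x). k (x(n := y))) \<in> borel_measurable (lborel \<Otimes>\<^sub>M lebC {..<n})"
      using measurable_pair_swap[OF measurable_fun_upd_pair[OF _ k]] by (simp add: case_prod_unfold)
    thus ?thesis unfolding G_def
    proof -
      interpret I: finite_product_sigma_finite "\<lambda>_::nat. lborel :: complex measure" "{..<n}" by standard simp
      from I.borel_measurable_nn_integral[OF \<open>(\<lambda>(y, x). k (x(n := y))) \<in> borel_measurable (lborel \<Otimes>\<^sub>M lebC {..<n})\<close>]
      show "(\<lambda>y. \<integral>\<^sup>+x. k (x(n := y)) \<partial>lebC {..<n}) \<in> borel_measurable borel" by simp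
    qed
  qed
  have snj: "(\<Sum>j<n. S n j * x j) = 0" for x using Suc.prems(2) by (intro sum.neutral) auto
  have "(\<integral>\<^sup>+x. k (\<lambda>i\<in>insert n {..<n}. t i + (\<Sum>j\<in>insert n {..<n}. S i j * x j)) \<partial>lebC (insert n {..<n}))
     = (\<integral>\<^sup>+y. \<integral>\<^sup>+x. k (\<lambda>i\<in>insert n {..<n}. t i + (\<Sum>j\<in>insert n {..<n}. S i j * (x(n := y)) j)) \<partial>lebC {..<n} \<partial>lborel)"
    by (rule lebC.product_nn_integral_insert_rev) auto
  also have "\<dots> = (\<integral>\<^sup>+y. \<integral>\<^sup>+x. k ((\<lambda>i\<in>{..<n}. (t i + S i n * y) + (\<Sum>j<n. S i j * x j))(n := t n + S n n * y)) \<partial>lebC {..<n} \<partial>lborel)"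
  proof (intro nn_integral_cong arg_cong[of _ _ k] ext)
    fix x :: "nat \<Rightarrow> complex" and y i
    have e: "(\<Sum>j<n. S i j * (x(n := y)) j) = (\<Sum>j<n. S i j * x j)"
      by (intro sum.cong) auto
    show "(\<lambda>i\<in>insert n {..<n}. t i + (\<Sum>j\<in>insert n {..<n}. S i j * (x(n := y)) j)) i =
      ((\<lambda>i\<in>{..<n}. (t i + S i n * y) + (\<Sum>j<n. S i j * x j))(n := t n + S n n * y)) i"
      using snj by (cases "i = n") (auto simp del: fun_upd_apply simp: e, simp_all add: restrict_def)
  qed
  finally have e1: "(\<integral>\<^sup>+x. k (\<lambda>i\<in>insert n {..<n}. t i + (\<Sum>j\<in>insert n {..<n}. S i j * x j)) \<partial>lebC (insert n {..<n}))
     = (\<integral>\<^sup>+y. \<integral>\<^sup>+x. k ((\<lambda>i\<in>{..<n}. (t i + S i n * y) + (\<Sum>j<n. S i j * x j))(n := t n + S n n * y)) \<partial>lebC {..<n} \<partial>lborel)" .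
  have "ennreal (\<Prod>i<n. (cmod (S i i))\<^sup>2) * (\<integral>\<^sup>+y. \<integral>\<^sup>+x. k ((\<lambda>i\<in>{..<n}. (t i + S i n * y) + (\<Sum>j<n. S i j * x j))(n := t n + S n n * y)) \<partial>lebC {..<n} \<partial>lborel)
     = (\<integral>\<^sup>+y. G (t n + S n n * y) \<partial>lborel)"
  proof -
    let ?P = "ennreal (\<Prod>i<n. (cmod (S i i))\<^sup>2)"
    have inner: "?P * (\<integral>\<^sup>+x. k ((\<lambda>i\<in>{..<n}. (t i + S i n * y) + (\<Sum>j<n. S i j * x j))(n := t n + S n n * y)) \<partial>lebC {..<n})
      = G (t n + S n n * y)" for y
      unfolding G_def by (rule IH[OF ky])
    have "(\<integral>\<^sup>+x. k ((\<lambda>i\<in>{..<n}. (t i + S i n * y) + (\<Sum>j<n. S i j * x j))(n := t n + S n n * y)) \<partial>lebC {..<n})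
       = ennreal (inverse (\<Prod>i<n. (cmod (S i i))\<^sup>2)) * G (t n + S n n * y)" for y
      unfolding inner[symmetric] mult.assoc[symmetric]
      using Suc.prems(1) by (subst ennreal_mult[symmetric]) (auto simp: prod_nonneg)
    hence "(\<integral>\<^sup>+y. \<integral>\<^sup>+x. k ((\<lambda>i\<in>{..<n}. (t i + S i n * y) + (\<Sum>j<n. S i j * x j))(n := t n + S n n * y)) \<partial>lebC {..<n} \<partial>lborel)
      = ennreal (inverse (\<Prod>i<n. (cmod (S i i))\<^sup>2)) * (\<integral>\<^sup>+y. G (t n + S n n * y) \<partial>lborel)"
      by (simp only:) (rule nn_integral_cmult, use G in measurable)
    thus ?thesis unfolding mult.assoc[symmetric]
      using Suc.prems(1) by (simp only: ) (subst mult.assoc[symmetric], subst ennreal_mult[symmetric], auto simp: prod_nonneg)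
  qed
  moreover have "ennreal ((cmod (S n n))\<^sup>2) * (\<integral>\<^sup>+y. G (t n + S n n * y) \<partial>lborel) = (\<integral>\<^sup>+y. G y \<partial>lborel)"
    by (rule nn_integral_complex_affine[OF snn G])
  moreover have "(\<integral>\<^sup>+y. G y \<partial>lborel) = (\<integral>\<^sup>+x. k x \<partial>lebC (insert n {..<n}))"
    unfolding G_def by (rule lebC.product_nn_integral_insert_rev[symmetric]) auto
  moreover have "ennreal (\<Prod>i<Suc n. (cmod (S i i))\<^sup>2)
      = ennreal ((cmod (S n n))\<^sup>2) * ennreal (\<Prod>i<n. (cmod (S i i))\<^sup>2)"
    by (simp add: ennreal_mult' mult.commute)
  moreover have "{..<Suc n} = insert n {..<n}" by auto
  ultimately show ?case by (simp only: e1 mult.assoc)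
qed

text \<open>The Jacobian of an invertible matrix is that of its Schur triangular form, since the
  factors of the two mutually inverse transformation matrices cancel.\<close>

lemma nn_integral_matrix_change:
  fixes A :: "complex mat"
  assumes A: "A \<in> carrier_mat n n" and det: "Determinant.det A \<noteq> 0"
    and k: "k \<in> borel_measurable (lebC {..<n})"
  shows "ennreal ((cmod (Determinant.det A))\<^sup>2) * (\<integral>\<^sup>+x. k (\<lambda>i\<in>{..<n}. (\<Sum>j<n. A $$ (i, j) * x j)) \<partial>lebC {..<n})
    = (\<integral>\<^sup>+x. k x \<partial>lebC {..<n})"
proof -
  obtain es where es: "char_poly A = (\<Prod>e\<leftarrow>es. [:- e, 1:])" using char_poly_factorized[OF A] by auto
  obtain B P Q where "schur_decomposition A es = (B, P, Q)" by (metis prod_cases3)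
  from schur_decomposition[OF A es this] have sim: "similar_mat_wit A B P Q" and tri: "upper_triangular B"
    by auto
  from similar_mat_witD2[OF A sim] have PQ: "P * Q = 1\<^sub>m n" and QP: "Q * P = 1\<^sub>m n" and A_eq: "A = P * B * Q"
    and c[simp]: "B \<in> carrier_mat n n" "P \<in> carrier_mat n n" "Q \<in> carrier_mat n n" by auto
  have detA: "Determinant.det A = Determinant.det B"
    using sim det_similar similar_mat_def by blast
  have detB: "Determinant.det B = (\<Prod>i<n. B $$ (i, i))"
    using det_upper_triangular[OF tri c(1)] by (simp add: diag_mat_def prod.distinct_set_conv_list[symmetric] atLeast0LessThan carrier_matD(1)[OF c(1)])
  define act where "act = (\<lambda>(A::complex mat) x. (\<lambda>i\<in>{..<n}. (\<Sum>j<n. A $$ (i, j) * x j)))"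
  have act_mult: "act (X * Y) x = act X (act Y x)" if "X \<in> carrier_mat n n" "Y \<in> carrier_mat n n" for X Y x
  proof -
    have "(\<Sum>j<n. (\<Sum>l<n. X $$ (i, l) * Y $$ (l, j)) * x j) = (\<Sum>l<n. X $$ (i, l) * (\<Sum>j<n. Y $$ (l, j) * x j))" for i
      unfolding sum_distrib_left sum_distrib_right by (subst sum.swap) (simp add: mult.assoc)
    thus ?thesis using that
      by (auto simp: act_def fun_eq_iff restrict_def scalar_prod_def atLeast0LessThan)
  qed
  have act_one: "act (1\<^sub>m n) x = x" if "x \<in> space (lebC {..<n})" for x
  proof -
    have "(\<Sum>j<n. (1\<^sub>m n :: complex mat) $$ (i, j) * x j) = x i" if "i < n" for i
    proof -
      have "(\<Sum>j<n. (1\<^sub>m n :: complex mat) $$ (i, j) * x j) = (\<Sum>j<n. if j = i then x j else 0)"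
        using that by (intro sum.cong) auto
      thus ?thesis using that by simp
    qed
    thus ?thesis using that
      by (auto simp: act_def fun_eq_iff restrict_def space_PiM PiE_def extensional_def)
  qed
  have act_m[measurable]: "act X \<in> measurable (lebC {..<n}) (lebC {..<n})" for X
    using measurable_affine_map[where I = "{..<n}" and J = "{..<n}" and t = "\<lambda>_. 0" and S = "\<lambda>i j. X $$ (i, j)"] by (simp add: act_def)
  have J_ex: "\<exists>J::real. J > 0 \<and> (\<forall>k\<in>borel_measurable (lebC {..<n}).
      ennreal J * (\<integral>\<^sup>+x. k (act X x) \<partial>lebC {..<n}) = (\<integral>\<^sup>+x. k x \<partial>lebC {..<n}))"
    if X: "X \<in> carrier_mat n n" and Y: "Y \<in> carrier_mat n n" and YX: "Y * X = 1\<^sub>m n" for X Y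
  proof -
    have "x i = 0" if z: "\<forall>i\<in>{..<n}. (\<Sum>j<n. X $$ (i, j) * x j) = 0" and i: "i < n" for x i
    proof -
      define x' where "x' = restrict x {..<n}"
      have "act X x' = (\<lambda>i\<in>{..<n}. 0)" using z by (auto simp: act_def x'_def fun_eq_iff restrict_def)
      moreover have "x' = act Y (act X x')"
        using act_mult[OF Y X] act_one[of x'] by (simp add: YX x'_def space_PiM)
      ultimately have "x' = act Y (\<lambda>i\<in>{..<n}. 0)" by simp
      hence "x' i = 0" using i by (simp add: act_def)
      thus ?thesis using i by (simp add: x'_def)
    qed
    hence "\<forall>x. (\<forall>i\<in>{..<n}. (\<Sum>j\<in>{..<n}. X $$ (i, j) * x j) = 0) \<longrightarrow> (\<forall>i\<in>{..<n}. x i = 0)" by blast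
    from nn_integral_linear_change[OF finite_lessThan this]
    obtain J :: real where J: "J > 0" "\<And>t k. k\<in>borel_measurable (lebC {..<n}) \<Longrightarrow>
      ennreal J * (\<integral>\<^sup>+x. k (\<lambda>i\<in>{..<n}. t i + (\<Sum>j<n. X $$ (i, j) * x j)) \<partial>lebC {..<n}) = (\<integral>\<^sup>+x. k x \<partial>lebC {..<n})"
      by blast
    show ?thesis using J(1) J(2)[of _ "\<lambda>_. 0"] by (intro exI[of _ J]) (simp add: act_def)
  qed
  obtain JP :: real where JP: "JP > 0" "\<And>k. k\<in>borel_measurable (lebC {..<n}) \<Longrightarrow>
      ennreal JP * (\<integral>\<^sup>+x. k (act P x) \<partial>lebC {..<n}) = (\<integral>\<^sup>+x. k x \<partial>lebC {..<n})"
    using J_ex[of P Q] QP by auto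
  obtain JQ :: real where JQ: "JQ > 0" "\<And>k. k\<in>borel_measurable (lebC {..<n}) \<Longrightarrow>
      ennreal JQ * (\<integral>\<^sup>+x. k (act Q x) \<partial>lebC {..<n}) = (\<integral>\<^sup>+x. k x \<partial>lebC {..<n})"
    using J_ex[of Q P] PQ by auto
  have tri_eq: "ennreal ((cmod (Determinant.det A))\<^sup>2) * (\<integral>\<^sup>+x. k (act B x) \<partial>lebC {..<n}) = (\<integral>\<^sup>+x. k x \<partial>lebC {..<n})"
    if "k \<in> borel_measurable (lebC {..<n})" for k
  proof -
    have "B $$ (i, i) \<noteq> 0" if "i < n" for i using det that unfolding detA detB by auto
    moreover have "B $$ (i, j) = 0" if "j < i" "i < n" for i j
      using tri that c(1) by (auto simp: upper_triangular_def)
    moreover have "(cmod (Determinant.det A))\<^sup>2 = (\<Prod>i<n. (cmod (B $$ (i, i)))\<^sup>2)"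
      by (simp add: detA detB prod_norm[symmetric] prod_power_distrib)
    ultimately show ?thesis
      using nn_integral_triangular_change[of n "\<lambda>i j. B $$ (i, j)" k "\<lambda>_. 0"] that by (simp add: act_def)
  qed
  \<comment> \<open>Neither factor is known, but the composition of the two maps is the identity. It
    is tested on the product \<open>D\<close> of unit squares, which has measure 1.\<close>
  have JPJQ: "JP * JQ = 1"
  proof -
    define D where "D = (\<Pi>\<^sub>E i\<in>{..<n}. (box 0 (Complex 1 1)))"
    have eD: "emeasure (lebC {..<n}) D = 1"
      unfolding D_def
      by (subst lebC.emeasure_PiM) (auto simp: Basis_complex_def inner_complex_def emeasure_lborel_box_eq)
    have D[measurable]: "D \<in> sets (lebC {..<n})" unfolding D_def by (rule sets_PiM_I_finite) auto
    have "ennreal JQ * (\<integral>\<^sup>+x. indicator D (act P (act Q x)) \<partial>lebC {..<n}) = (\<integral>\<^sup>+x. indicator D (act P x) \<partial>lebC {..<n})"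
      by (rule JQ(2)) measurable
    moreover have "(\<integral>\<^sup>+x. indicator D (act P (act Q x)) \<partial>lebC {..<n}) = (\<integral>\<^sup>+x. indicator D x \<partial>lebC {..<n})"
      by (intro nn_integral_cong) (simp add: act_mult[symmetric] PQ act_one)
    moreover have "ennreal JP * (\<integral>\<^sup>+x. indicator D (act P x) \<partial>lebC {..<n}) = (\<integral>\<^sup>+x. indicator D x \<partial>lebC {..<n})"
      by (rule JP(2)) measurable
    ultimately have "ennreal JP * ennreal JQ = 1" using eD by simp
    hence "ennreal (JP * JQ) = ennreal 1" using JP(1) JQ(1) by (simp add: ennreal_mult)
    thus ?thesis using JP(1) JQ(1) by (subst (asm) ennreal_inj) auto
  qed
  let ?d = "ennreal ((cmod (Determinant.det A))\<^sup>2)"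
  have "(\<integral>\<^sup>+x. k (act A x) \<partial>lebC {..<n}) = (\<integral>\<^sup>+x. k (act P (act B (act Q x))) \<partial>lebC {..<n})"
    using act_mult[of "P * B" Q] act_mult[of P B] mult_carrier_mat[of P n n B n] by (simp add: A_eq)
  moreover have "ennreal JQ * (\<integral>\<^sup>+x. k (act P (act B (act Q x))) \<partial>lebC {..<n}) = (\<integral>\<^sup>+x. k (act P (act B x)) \<partial>lebC {..<n})"
    by (rule JQ(2)) (use k in measurable)
  moreover have "?d * (\<integral>\<^sup>+x. k (act P (act B x)) \<partial>lebC {..<n}) = (\<integral>\<^sup>+x. k (act P x) \<partial>lebC {..<n})"
    by (rule tri_eq) (use k in measurable)
  moreover have "ennreal JP * (\<integral>\<^sup>+x. k (act P x) \<partial>lebC {..<n}) = (\<integral>\<^sup>+x. k x \<partial>lebC {..<n})"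
    by (rule JP(2)[OF k])
  ultimately have "(\<integral>\<^sup>+x. k x \<partial>lebC {..<n}) = ennreal JP * (?d * (ennreal JQ * (\<integral>\<^sup>+x. k (act A x) \<partial>lebC {..<n})))"
    by simp
  also have "\<dots> = ennreal (JP * JQ) * (?d * (\<integral>\<^sup>+x. k (act A x) \<partial>lebC {..<n}))"
    using JP(1) JQ(1) by (simp add: ennreal_mult ac_simps)
  finally show ?thesis by (simp add: JPJQ act_def)
qed

section \<open>Characteristic polynomials of bordered matrices\<close>

text \<open>Matrices are functions on index pairs, hence points of a product space with Lebesgue
  measure; values outside the square do not matter.\<close>

definition chi :: "nat \<Rightarrow> (nat \<times> nat \<Rightarrow> complex) \<Rightarrow> complex poly"
  where "chi n x = char_poly (Matrix.mat n n x)"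

lemma chi_cong: "(\<And>i j. i < n \<Longrightarrow> j < n \<Longrightarrow> x (i, j) = y (i, j)) \<Longrightarrow> chi n x = chi n y"
  unfolding chi_def by (intro arg_cong[of _ _ char_poly] eq_matI) auto

lemma degree_chi [simp]: "degree (chi n x) = n" and lead_coeff_chi: "coeff (chi n x) n = 1"
  unfolding chi_def using degree_monic_char_poly[of "Matrix.mat n n x" n] by auto

lemma chi_nonzero [simp]: "chi n x \<noteq> 0"
  using lead_coeff_chi[of n x] by auto

definition border :: "nat \<Rightarrow> (nat \<times> nat \<Rightarrow> complex) \<Rightarrow> (nat \<Rightarrow> complex) \<Rightarrow> (nat \<Rightarrow> complex) \<Rightarrow> complex \<Rightarrow> nat \<times> nat \<Rightarrow> complex"
  where "border n D c w a = (\<lambda>(i, j)\<in>{..<Suc n} \<times> {..<Suc n}.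
     if i < n then (if j < n then D (i, j) else c i) else (if j < n then w j else a))"

lemma border_eq_four_block:
  "Matrix.mat (Suc n) (Suc n) (border n D c w a) =
     four_block_mat (Matrix.mat n n D) (Matrix.mat n 1 (\<lambda>(i, j). c i)) (Matrix.mat 1 n (\<lambda>(i, j). w j)) (Matrix.mat 1 1 (\<lambda>_. a))"
  by (rule eq_matI) (auto simp: border_def four_block_mat_def Let_def)

text \<open>The corner entry occurs once, with cofactor \<open>chi n D\<close>. Hence, away from the
  zeros of \<open>chi n D\<close>, the eigenvalues are the solutions \<open>z\<close> of
  \<open>a = g(z) / d(z)\<close> with \<open>d = chi n D\<close> and \<open>g\<close> the polynomial
  for corner 0.\<close>

lemma chi_border_affine:
  "chi (Suc n) (border n D c w a) = chi (Suc n) (border n D c w 0) - Polynomial.smult a (chi n D)"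
proof -
  define X where "X = (\<lambda>a. char_poly_matrix (Matrix.mat (Suc n) (Suc n) (border n D c w a)))"
  have X: "X a \<in> carrier_mat (Suc n) (Suc n)" for a unfolding X_def by simp
  have del: "mat_delete (X a) n j = mat_delete (X 0) n j" for j
    by (rule eq_matI) (auto simp: mat_delete_def X_def char_poly_matrix_def border_def)
  have nn: "mat_delete (X 0) n n = char_poly_matrix (Matrix.mat n n D)"
    by (rule eq_matI) (auto simp: mat_delete_def X_def char_poly_matrix_def border_def)
  have exp: "Determinant.det (X a) = (\<Sum>j<n. X a $$ (n, j) * cofactor (X a) n j) + X a $$ (n, n) * cofactor (X a) n n" for a
    using laplace_expansion_row[OF X[of a], of n] by simp
  have cof: "cofactor (X a) n j = cofactor (X 0) n j" for j
    by (simp add: cofactor_def del)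
  have ent: "X a $$ (n, j) = X 0 $$ (n, j)" if "j < n" for j
    using that by (auto simp: X_def char_poly_matrix_def border_def)
  have entn: "X a $$ (n, n) = X 0 $$ (n, n) - [:a:]"
    by (auto simp: X_def char_poly_matrix_def border_def)
  have "cofactor (X 0) n n = chi n D"
    by (simp add: cofactor_def nn chi_def char_poly_def)
  moreover have "chi (Suc n) (border n D c w a) = Determinant.det (X a)" for a
    by (simp add: chi_def char_poly_def X_def)
  ultimately show ?thesis
    by (simp add: exp[of a] exp[of 0] cof ent entn left_diff_distrib)
qed

text \<open>The assumptions on \<open>c\<close> and \<open>a\<close> say that \<open>(u, 1)\<close>
  is an eigenvector for \<open>z\<close>. Conjugation by the unipotent matrix with last column
  \<open>(u, 1)\<close> makes the bordered matrix block triangular, with diagonal blocks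
  \<open>B = D - u w\<close> and \<open>z\<close>.\<close>

lemma chi_border_deflate:
  assumes c: "\<And>i. i < n \<Longrightarrow> c i = z * u i - (\<Sum>j<n. D (i, j) * u j)"
    and a: "a = z - (\<Sum>j<n. w j * u j)"
    and B: "\<And>i j. i < n \<Longrightarrow> j < n \<Longrightarrow> B (i, j) = D (i, j) - u i * w j"
  shows "chi (Suc n) (border n D c w a) = [:- z, 1:] * chi n B"
proof -
  define Bm Um Wm Zm where "Bm = Matrix.mat n n B" and "Um = Matrix.mat n 1 (\<lambda>(i, j). u i)"
    and "Wm = Matrix.mat 1 n (\<lambda>(i, j). w j)" and "Zm = Matrix.mat 1 1 (\<lambda>_. z)"
  note defs = Bm_def Um_def Wm_def Zm_def
  have car[simp]: "Bm \<in> carrier_mat n n" "Um \<in> carrier_mat n 1" "Wm \<in> carrier_mat 1 n" "Zm \<in> carrier_mat 1 1"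
    by (auto simp: defs)
  have car'[simp]: "Um \<in> carrier_mat n (Suc 0)" "Wm \<in> carrier_mat (Suc 0) n" "Zm \<in> carrier_mat (Suc 0) (Suc 0)"
    using car by simp_all
  define L where "L = four_block_mat (1\<^sub>m n) Um (0\<^sub>m 1 n) (1\<^sub>m 1)"
  define L' where "L' = four_block_mat (1\<^sub>m n) (- Um) (0\<^sub>m 1 n) (1\<^sub>m 1)"
  define Nm where "Nm = four_block_mat Bm (0\<^sub>m n 1) Wm Zm"
  define A where "A = Matrix.mat (Suc n) (Suc n) (border n D c w a)"
  have LL_inv: "four_block_mat (1\<^sub>m n) V (0\<^sub>m 1 n) (1\<^sub>m 1) * four_block_mat (1\<^sub>m n) (- V) (0\<^sub>m 1 n) (1\<^sub>m 1) = 1\<^sub>m (Suc n)"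
    if V: "V \<in> carrier_mat n 1" for V :: "complex mat"
  proof -
    have "four_block_mat (1\<^sub>m n) V (0\<^sub>m 1 n) (1\<^sub>m 1) * four_block_mat (1\<^sub>m n) (- V) (0\<^sub>m 1 n) (1\<^sub>m 1)
      = four_block_mat (1\<^sub>m n * 1\<^sub>m n + V * 0\<^sub>m 1 n) (1\<^sub>m n * (- V) + V * 1\<^sub>m 1)
         (0\<^sub>m 1 n * 1\<^sub>m n + 1\<^sub>m 1 * 0\<^sub>m 1 n) (0\<^sub>m 1 n * (- V) + 1\<^sub>m 1 * 1\<^sub>m 1)"
      by (rule mult_four_block_mat[of _ n n _ 1 _ 1]) (use V in auto)
    also have "1\<^sub>m n * 1\<^sub>m n + V * 0\<^sub>m 1 n = 1\<^sub>m n" using V by auto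
    also have "1\<^sub>m n * (- V) + V * 1\<^sub>m 1 = 0\<^sub>m n 1"
      using V left_mult_one_mat[of "- V" n 1] right_mult_one_mat[OF V] uminus_l_inv_mat[OF V] by simp
    also have "0\<^sub>m 1 n * 1\<^sub>m n + 1\<^sub>m 1 * 0\<^sub>m 1 n = (0\<^sub>m 1 n :: complex mat)" by auto
    also have "0\<^sub>m 1 n * (- V) + 1\<^sub>m 1 * 1\<^sub>m 1 = (1\<^sub>m 1 :: complex mat)"
      using left_mult_zero_mat[of "- V" n 1 1] V by simp
    also have "four_block_mat (1\<^sub>m n) (0\<^sub>m n 1) (0\<^sub>m 1 n) (1\<^sub>m 1 :: complex mat) = 1\<^sub>m (Suc n)"
      using four_block_one_mat[of n 1] by simp
    finally show ?thesis .
  qed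
  have LL': "L * L' = 1\<^sub>m (Suc n)"
    unfolding L_def L'_def by (rule LL_inv[OF car(2)])
  have L'L: "L' * L = 1\<^sub>m (Suc n)"
    using LL_inv[of "- Um"] by (simp add: L_def L'_def)
  have LN: "L * Nm = four_block_mat (Bm + Um * Wm) (Um * Zm) Wm Zm"
  proof -
    have "L * Nm = four_block_mat (1\<^sub>m n * Bm + Um * Wm) (1\<^sub>m n * 0\<^sub>m n 1 + Um * Zm)
      (0\<^sub>m 1 n * Bm + 1\<^sub>m 1 * Wm) (0\<^sub>m 1 n * 0\<^sub>m n 1 + 1\<^sub>m 1 * Zm)"
      unfolding L_def Nm_def by (rule mult_four_block_mat[of _ n n _ 1 _ 1 _ _ n _ 1]) auto
    also have "1\<^sub>m n * Bm = Bm" by (rule left_mult_one_mat[OF car(1)])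
    also have "1\<^sub>m n * 0\<^sub>m n 1 + Um * Zm = Um * Zm"
      using left_add_zero_mat[of "Um * Zm" n 1] mult_carrier_mat[OF car(2,4)] by simp
    also have "0\<^sub>m 1 n * Bm + 1\<^sub>m 1 * Wm = Wm"
      using left_mult_zero_mat[OF car(1), of 1] left_mult_one_mat[OF car(3)] left_add_zero_mat[OF car(3)] by simp
    also have "0\<^sub>m 1 n * 0\<^sub>m n 1 + 1\<^sub>m 1 * Zm = Zm"
      using left_mult_one_mat[OF car(4)] left_add_zero_mat[OF car(4)] by simp
    finally show ?thesis .
  qed
  have AL: "A * L = L * Nm"
  proof -
    have "A = four_block_mat (Matrix.mat n n D) (Matrix.mat n 1 (\<lambda>(i, j). c i)) Wm (Matrix.mat 1 1 (\<lambda>_. a))"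
      unfolding A_def border_eq_four_block defs ..
    hence "A * L = four_block_mat (Matrix.mat n n D * 1\<^sub>m n + Matrix.mat n 1 (\<lambda>(i, j). c i) * 0\<^sub>m 1 n)
       (Matrix.mat n n D * Um + Matrix.mat n 1 (\<lambda>(i, j). c i) * 1\<^sub>m 1)
       (Wm * 1\<^sub>m n + Matrix.mat 1 1 (\<lambda>_. a) * 0\<^sub>m 1 n) (Wm * Um + Matrix.mat 1 1 (\<lambda>_. a) * 1\<^sub>m 1)"
      unfolding L_def by (simp only:) (rule mult_four_block_mat[of _ n n _ 1 _ 1], auto)
    moreover have "Matrix.mat n n D * 1\<^sub>m n + Matrix.mat n 1 (\<lambda>(i, j). c i) * 0\<^sub>m 1 n = Bm + Um * Wm"
      by (rule eq_matI) (auto simp: defs B scalar_prod_def)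
    moreover have "Matrix.mat n n D * Um + Matrix.mat n 1 (\<lambda>(i, j). c i) * 1\<^sub>m 1 = Um * Zm"
      by (rule eq_matI) (auto simp: defs c scalar_prod_def atLeast0LessThan)
    moreover have "Wm * 1\<^sub>m n + Matrix.mat 1 1 (\<lambda>_. a) * 0\<^sub>m 1 n = Wm"
      using right_mult_one_mat[OF car(3)] right_add_zero_mat[OF car(3)] by simp
    moreover have "Wm * Um + Matrix.mat 1 1 (\<lambda>_. a) * 1\<^sub>m 1 = Zm"
      by (rule eq_matI) (auto simp: defs a scalar_prod_def atLeast0LessThan)
    ultimately show ?thesis unfolding LN by simp
  qed
  have c2[simp]: "A \<in> carrier_mat (Suc n) (Suc n)" "L \<in> carrier_mat (Suc n) (Suc n)"
    "L' \<in> carrier_mat (Suc n) (Suc n)" "Nm \<in> carrier_mat (Suc n) (Suc n)"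
    unfolding A_def L_def L'_def Nm_def carrier_mat_def by (auto simp: defs)
  have "A = A * (L * L')" using right_mult_one_mat[OF c2(1)] by (simp add: LL')
  also have "\<dots> = L * Nm * L'" using assoc_mult_mat[OF c2(1-3)] AL by simp
  finally have "A = L * Nm * L'" .
  hence "similar_mat_wit A Nm L L'"
    by (rule similar_mat_witI[OF LL' L'L _ c2(1,4,2,3)])
  hence "char_poly A = char_poly Nm" by (intro char_poly_similar) (auto simp: similar_mat_def)
  also have "\<dots> = char_poly Bm * char_poly Zm"
    using char_poly_factorized[OF car(1)] char_poly_factorized[OF car(4)]
    by (intro char_poly_0_block'[OF Nm_def]) (blast | rule car)+
  also have "char_poly Zm = [:- z, 1:]"
    using char_poly_upper_triangular[of Zm 1] by (simp add: Zm_def diag_mat_def upper_triangular_def)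
  finally show ?thesis by (simp add: chi_def A_def Bm_def mult.commute)
qed

text \<open>At the root \<open>z\<close> of \<open>g - a d\<close> the derivative of
  \<open>g / d\<close> is \<open>(g - a d)'(z) / d(z)\<close>, and the factorisation
  \<open>g - a d = (X - z) chi n B\<close> evaluates the numerator. The denominator is to cancel
  against the Jacobian of \<open>c = (z - D) u\<close>.\<close>

lemma chi_border_derivative:
  assumes c: "\<And>i. i < n \<Longrightarrow> c i = z * u i - (\<Sum>j<n. D (i, j) * u j)"
    and a: "a = z - (\<Sum>j<n. w j * u j)"
    and B: "\<And>i j. i < n \<Longrightarrow> j < n \<Longrightarrow> B (i, j) = D (i, j) - u i * w j"
    and nz: "poly (chi n D) z \<noteq> 0"
  defines "g \<equiv> chi (Suc n) (border n D c w 0)" and "d \<equiv> chi n D"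
  shows "poly g z / poly d z = a"
    and "poly (pderiv g * d - g * pderiv d) z / (poly d z)\<^sup>2 = poly (chi n B) z / poly d z"
proof -
  have f: "g - Polynomial.smult a d = [:- z, 1:] * chi n B"
    unfolding g_def d_def using chi_border_affine[of n D c w a] chi_border_deflate[OF c a B] by simp
  have "poly (g - Polynomial.smult a d) z = 0" unfolding f by simp
  hence gz: "poly g z = a * poly d z" by simp
  thus "poly g z / poly d z = a" using nz by (simp add: d_def)
  have "poly (pderiv (g - Polynomial.smult a d)) z = poly (chi n B) z"
    unfolding f pderiv_mult by (simp add: pderiv_pCons)
  hence "poly (pderiv g) z = poly (chi n B) z + a * poly (pderiv d) z"
    by (simp add: pderiv_diff pderiv_smult algebra_simps)
  thus "poly (pderiv g * d - g * pderiv d) z / (poly d z)\<^sup>2 = poly (chi n B) z / poly d z"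
    using nz by (simp add: gz d_def[symmetric] power2_eq_square field_simps)
qed

section \<open>The Gaussian weight of a deflated matrix\<close>

definition vnorm :: "nat \<Rightarrow> (nat \<Rightarrow> complex) \<Rightarrow> real"
  where "vnorm n v = (\<Sum>i<n. (cmod (v i))\<^sup>2)"

definition frob :: "nat \<Rightarrow> (nat \<times> nat \<Rightarrow> complex) \<Rightarrow> real"
  where "frob n x = (\<Sum>i<n. \<Sum>j<n. (cmod (x (i, j)))\<^sup>2)"

lemma frob_border:
  "frob (Suc n) (border n D c w a) = frob n D + vnorm n c + vnorm n w + (cmod a)\<^sup>2"
  by (simp add: frob_def vnorm_def border_def sum.distrib)

lemma frob_columns: "frob n x = (\<Sum>j<n. vnorm n (\<lambda>i. x (i, j)))"
  unfolding frob_def vnorm_def by (rule sum.swap)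

lemma frob_rows: "frob n x = (\<Sum>i<n. vnorm n (\<lambda>j. x (i, j)))"
  unfolding frob_def vnorm_def ..

lemma vnorm_nonneg [simp]: "vnorm n v \<ge> 0"
  by (simp add: vnorm_def sum_nonneg)

lemma vnorm_cnj [simp]: "vnorm n (\<lambda>i. cnj (v i)) = vnorm n v"
  by (simp add: vnorm_def)

lemma vnorm_add_mult:
  "vnorm n (\<lambda>i. r i + t * v i) = vnorm n r + 2 * Re (cnj t * (\<Sum>i<n. r i * cnj (v i))) + (cmod t)\<^sup>2 * vnorm n v"
proof -
  have "(cmod (r i + t * v i))\<^sup>2 = (cmod (r i))\<^sup>2 + 2 * Re (cnj t * (r i * cnj (v i))) + (cmod t)\<^sup>2 * (cmod (v i))\<^sup>2" for i
    unfolding cmod_power2 by (simp add: power2_eq_square algebra_simps)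
  thus ?thesis
    by (simp add: vnorm_def sum.distrib sum_distrib_left Re_sum)
qed

text \<open>Conjugation by \<open>S = (I + u u\<^sup>*)\<^bsup>1/2\<^esup> = I + tau u u\<^sup>*\<close>, whose inverse is
  \<open>I - tau / sqrt s u u\<^sup>*\<close> where \<open>s = 1 + |u|\<^sup>2\<close>.\<close>

definition shear :: "nat \<Rightarrow> (nat \<Rightarrow> complex) \<Rightarrow> nat \<Rightarrow> nat \<Rightarrow> complex"
  where "shear n u i j = (if i = j then 1 else 0) + of_real (1 / (sqrt (1 + vnorm n u) + 1)) * u i * cnj (u j)"

definition shear_inv :: "nat \<Rightarrow> (nat \<Rightarrow> complex) \<Rightarrow> nat \<Rightarrow> nat \<Rightarrow> complex"
  where "shear_inv n u i j = (if i = j then 1 else 0)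
     - of_real (1 / (sqrt (1 + vnorm n u) + 1) / sqrt (1 + vnorm n u)) * u i * cnj (u j)"

definition shear_conj :: "nat \<Rightarrow> (nat \<Rightarrow> complex) \<Rightarrow> (nat \<times> nat \<Rightarrow> complex) \<Rightarrow> nat \<times> nat \<Rightarrow> complex"
  where "shear_conj n u x = (\<lambda>(i, j)\<in>{..<n} \<times> {..<n}. \<Sum>k<n. \<Sum>l<n. shear_inv n u i k * x (k, l) * shear n u l j)"

lemma vnorm_complex: "(\<Sum>i<n. u i * cnj (u i)) = of_real (vnorm n u)"
  by (simp add: vnorm_def flip: complex_norm_square)

lemma sum_shear: "j < n \<Longrightarrow> (\<Sum>l<n. x l * shear n u l j) =
    x j + of_real (1 / (sqrt (1 + vnorm n u) + 1)) * (\<Sum>l<n. x l * u l) * cnj (u j)"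
proof -
  assume j: "j < n"
  have "(\<Sum>l<n. x l * shear n u l j) = (\<Sum>l<n. (if l = j then x l else 0) + of_real (1 / (sqrt (1 + vnorm n u) + 1)) * (x l * u l) * cnj (u j))"
    unfolding shear_def by (intro sum.cong refl) (auto simp: algebra_simps)
  thus ?thesis using j by (simp add: sum.distrib sum_distrib_left sum_distrib_right)
qed

lemma sum_shear_inv: "i < n \<Longrightarrow> (\<Sum>k<n. shear_inv n u i k * x k) =
    x i - of_real (1 / (sqrt (1 + vnorm n u) + 1) / sqrt (1 + vnorm n u)) * u i * (\<Sum>k<n. cnj (u k) * x k)"
proof -
  assume i: "i < n"
  have "(\<Sum>k<n. shear_inv n u i k * x k) = (\<Sum>k<n. (if k = i then x k else 0) - of_real (1 / (sqrt (1 + vnorm n u) + 1) / sqrt (1 + vnorm n u)) * u i * (cnj (u k) * x k))"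
    unfolding shear_inv_def by (intro sum.cong refl) (auto simp: algebra_simps)
  thus ?thesis using i by (simp add: sum_subtractf sum_distrib_left)
qed

text \<open>With \<rho> standing for \<open>|u|^2\<close>, \<open>S = I + \<tau> u u^H\<close> and
  \<open>\<sigma> = \<tau> / sqrt s\<close>, the identities express in turn
  \<open>S^2 = I + u u^H\<close>, \<open>(I - \<sigma> u u^H)^2 = I - u u^H / s\<close>, and that
  \<open>I - \<sigma> u u^H\<close> is the inverse of \<open>S\<close>.\<close>

lemma shear_coeff:
  fixes \<rho> :: real assumes "\<rho> \<ge> 0"
  defines "s \<equiv> 1 + \<rho>" and "\<tau> \<equiv> 1 / (sqrt (1 + \<rho>) + 1)"
  shows "2 * \<tau> + \<tau>\<^sup>2 * \<rho> = 1"
    and "2 * (\<tau> / sqrt s) - (\<tau> / sqrt s)\<^sup>2 * \<rho> = 1 / s"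
    and "\<tau> - \<tau> / sqrt s - \<tau> * (\<tau> / sqrt s) * \<rho> = 0"
proof -
  define q where "q = sqrt s"
  have q: "q \<ge> 1" "s = q\<^sup>2" "\<rho> = (q - 1) * (q + 1)"
    using assms(1) by (auto simp: q_def s_def algebra_simps simp flip: power2_eq_square)
  have \<tau>: "\<tau> = 1 / (q + 1)" by (simp add: \<tau>_def q_def s_def)
  have t\<rho>: "\<tau> * \<rho> = q - 1" using q by (simp add: \<tau>)
  have q1: "q + 1 \<noteq> 0" "q \<noteq> 0" using q by auto
  have \<tau>q: "\<tau> * (q + 1) = 1" using q1 by (simp add: \<tau>)
  show "2 * \<tau> + \<tau>\<^sup>2 * \<rho> = 1"
  proof -
    have "2 * \<tau> + \<tau>\<^sup>2 * \<rho> = 2 * \<tau> + \<tau> * (\<tau> * \<rho>)" by (simp add: power2_eq_square)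
    also have "\<dots> = \<tau> * (q + 1)" unfolding t\<rho> by (simp add: algebra_simps)
    finally show ?thesis by (simp add: \<tau>q)
  qed
  show "2 * (\<tau> / sqrt s) - (\<tau> / sqrt s)\<^sup>2 * \<rho> = 1 / s"
  proof -
    have "2 * (\<tau> / q) - (\<tau> / q)\<^sup>2 * \<rho> = (2 * \<tau> * q - \<tau> * (\<tau> * \<rho>)) / q\<^sup>2"
      using q1 by (simp add: field_simps power2_eq_square)
    also have "2 * \<tau> * q - \<tau> * (\<tau> * \<rho>) = \<tau> * (q + 1)" unfolding t\<rho> by (simp add: algebra_simps)
    finally show ?thesis unfolding \<tau>q q(2)[symmetric] q_def[symmetric] .
  qed
  show "\<tau> - \<tau> / sqrt s - \<tau> * (\<tau> / sqrt s) * \<rho> = 0"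
  proof -
    have "\<tau> - \<tau> / q - \<tau> * (\<tau> / q) * \<rho> = (\<tau> * q - \<tau> - \<tau> * (\<tau> * \<rho>)) / q" using q1 by (simp add: field_simps)
    also have "\<dots> = 0" unfolding t\<rho> by (simp add: algebra_simps)
    finally show ?thesis by (simp add: q_def)
  qed
qed

lemma shear_shear_inv:
  assumes "i < n" "j < n"
  shows "(\<Sum>k<n. shear n u i k * shear_inv n u k j) = (if i = j then 1 else 0)"
    and "(\<Sum>k<n. shear_inv n u i k * shear n u k j) = (if i = j then 1 else 0)"
proof -
  define \<tau> where "\<tau> = 1 / (sqrt (1 + vnorm n u) + 1)"
  define \<sigma> where "\<sigma> = \<tau> / sqrt (1 + vnorm n u)"
  have "\<tau> - \<sigma> - \<tau> * \<sigma> * vnorm n u = 0"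
    using shear_coeff(3)[of "vnorm n u"] by (simp add: \<tau>_def \<sigma>_def)
  hence co: "complex_of_real \<tau> - of_real \<sigma> - of_real \<tau> * of_real \<sigma> * of_real (vnorm n u) = 0"
    by (metis of_real_0 of_real_diff of_real_mult)
  have S: "shear n u i j = (if i = j then 1 else 0) + of_real \<tau> * u i * cnj (u j)" for i j
    by (simp add: shear_def \<tau>_def)
  have SI: "shear_inv n u i j = (if i = j then 1 else 0) - of_real \<sigma> * u i * cnj (u j)" for i j
    by (simp add: shear_inv_def \<tau>_def \<sigma>_def)
  have V: "(\<Sum>k<n. cnj (u k) * u k) = of_real (vnorm n u)"
    using vnorm_complex[of u n] by (simp add: mult.commute)
  show "(\<Sum>k<n. shear_inv n u i k * shear n u k j) = (if i = j then 1 else 0)"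
  proof -
    have "(\<Sum>k<n. shear_inv n u i k * shear n u k j) =
      shear n u i j - of_real \<sigma> * u i * (\<Sum>k<n. cnj (u k) * shear n u k j)"
      using sum_shear_inv[OF assms(1), of u "\<lambda>k. shear n u k j"] by (simp add: \<sigma>_def \<tau>_def)
    also have "(\<Sum>k<n. cnj (u k) * shear n u k j) = cnj (u j) + of_real \<tau> * of_real (vnorm n u) * cnj (u j)"
      using sum_shear[OF assms(2), of "\<lambda>k. cnj (u k)" u] by (simp add: \<tau>_def V)
    finally have "(\<Sum>k<n. shear_inv n u i k * shear n u k j) = (if i = j then 1 else 0) +
        (of_real \<tau> - of_real \<sigma> - of_real \<tau> * of_real \<sigma> * of_real (vnorm n u)) * u i * cnj (u j)"
      by (simp add: S algebra_simps)
    thus ?thesis unfolding co by simp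
  qed
  show "(\<Sum>k<n. shear n u i k * shear_inv n u k j) = (if i = j then 1 else 0)"
  proof -
    have "(\<Sum>k<n. shear n u i k * shear_inv n u k j) = (\<Sum>k<n. (if k = i then shear_inv n u k j else 0)
       + of_real \<tau> * u i * (cnj (u k) * (if k = j then 1 else 0)) - of_real \<tau> * of_real \<sigma> * u i * cnj (u j) * (cnj (u k) * u k))"
      by (intro sum.cong refl) (auto simp: S SI algebra_simps)
    also have "\<dots> = shear_inv n u i j + of_real \<tau> * u i * cnj (u j) - of_real \<tau> * of_real \<sigma> * u i * cnj (u j) * of_real (vnorm n u)"
      using assms by (simp add: sum.distrib sum_subtractf sum_distrib_left[symmetric] V if_distrib[of "\<lambda>x. _ * x"] cong: if_cong)
    also have "\<dots> = (if i = j then 1 else 0) + (of_real \<tau> - of_real \<sigma> - of_real \<tau> * of_real \<sigma> * of_real (vnorm n u)) * u i * cnj (u j)"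
      by (simp add: SI algebra_simps)
    finally show ?thesis unfolding co by simp
  qed
qed

lemma mat_shear_conj:
  "Matrix.mat n n (shear_conj n u x) =
     Matrix.mat n n (\<lambda>(i, j). shear_inv n u i j) * Matrix.mat n n x * Matrix.mat n n (\<lambda>(i, j). shear n u i j)"
proof (rule eq_matI)
  fix i j
  assume "i < dim_row (Matrix.mat n n (\<lambda>(i, j). shear_inv n u i j) * Matrix.mat n n x * Matrix.mat n n (\<lambda>(i, j). shear n u i j))"
    and "j < dim_col (Matrix.mat n n (\<lambda>(i, j). shear_inv n u i j) * Matrix.mat n n x * Matrix.mat n n (\<lambda>(i, j). shear n u i j))"
  hence ij: "i < n" "j < n" by auto
  have "(\<Sum>k<n. \<Sum>l<n. shear_inv n u i k * x (k, l) * shear n u l j) = (\<Sum>l<n. (\<Sum>k<n. shear_inv n u i k * x (k, l)) * shear n u l j)"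
    by (subst sum.swap) (simp add: sum_distrib_right)
  thus "Matrix.mat n n (shear_conj n u x) $$ (i, j) =
    (Matrix.mat n n (\<lambda>(i, j). shear_inv n u i j) * Matrix.mat n n x * Matrix.mat n n (\<lambda>(i, j). shear n u i j)) $$ (i, j)"
    using ij by (simp add: shear_conj_def scalar_prod_def atLeast0LessThan)
qed auto

lemma shear_mat_inverse:
  "Matrix.mat n n (\<lambda>(i, j). shear n u i j) * Matrix.mat n n (\<lambda>(i, j). shear_inv n u i j) = 1\<^sub>m n"
  "Matrix.mat n n (\<lambda>(i, j). shear_inv n u i j) * Matrix.mat n n (\<lambda>(i, j). shear n u i j) = 1\<^sub>m n"
  by (rule eq_matI; simp add: scalar_prod_def atLeast0LessThan shear_shear_inv)+

lemma chi_shear_conj: "chi n (shear_conj n u x) = chi n x"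
proof -
  have "similar_mat_wit (Matrix.mat n n (shear_conj n u x)) (Matrix.mat n n x)
     (Matrix.mat n n (\<lambda>(i, j). shear_inv n u i j)) (Matrix.mat n n (\<lambda>(i, j). shear n u i j))"
    unfolding similar_mat_wit_def Let_def by (auto simp: mat_shear_conj shear_mat_inverse)
  thus ?thesis unfolding chi_def by (intro char_poly_similar) (auto simp: similar_mat_def)
qed

lemma shear_conj_injective:
  assumes "\<And>i j. i < n \<Longrightarrow> j < n \<Longrightarrow> shear_conj n u x (i, j) = 0" "i < n" "j < n"
  shows "x (i, j) = 0"
proof -
  let ?S = "Matrix.mat n n (\<lambda>(i, j). shear n u i j)" and ?T = "Matrix.mat n n (\<lambda>(i, j). shear_inv n u i j)"
  let ?X = "Matrix.mat n n x"
  have car: "?S \<in> carrier_mat n n" "?T \<in> carrier_mat n n" "?X \<in> carrier_mat n n" by auto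
  have "?T * ?X * ?S = 0\<^sub>m n n"
    unfolding mat_shear_conj[symmetric] using assms(1) by (intro eq_matI) auto
  hence "(?T * ?X * ?S) * ?T = 0\<^sub>m n n" by (simp add: left_mult_zero_mat[OF car(2)])
  moreover have "(?T * ?X * ?S) * ?T = ?T * ?X"
    using car assoc_mult_mat[of "?T * ?X" n n ?S n ?T n] right_mult_one_mat[of "?T * ?X" n n]
    by (simp add: shear_mat_inverse)
  ultimately have "?S * (?T * ?X) = 0\<^sub>m n n" by (simp add: right_mult_zero_mat[OF car(1)])
  moreover have "?S * (?T * ?X) = ?X"
    using assoc_mult_mat[OF car(1,2,3)] left_mult_one_mat[OF car(3)] by (simp add: shear_mat_inverse)
  ultimately have "?X = 0\<^sub>m n n" by simp
  hence "?X $$ (i, j) = 0" using assms(2,3) by simp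
  thus ?thesis using assms(2,3) by simp
qed

text \<open>Since \<open>S^2 = I + u u^H\<close>, multiplication by \<open>S\<close> on the right
  adds \<open>|r u|^2\<close> to the squared norm of each row \<open>r\<close>; since the inverse
  squares to \<open>I - u u^H / s\<close>, multiplication by it on the left takes
  \<open>|u^H v|^2 / s\<close> from each column \<open>v\<close>.\<close>

lemma frob_shear_conj:
  fixes n u x
  defines "s \<equiv> 1 + vnorm n u" and "\<beta> \<equiv> \<lambda>j. \<Sum>i<n. x (i, j) * cnj (u i)" and "\<gamma> \<equiv> \<lambda>i. \<Sum>j<n. x (i, j) * u j"
  shows "frob n (shear_conj n u x) = frob n x + vnorm n \<gamma> - (vnorm n \<beta> + (cmod (\<Sum>j<n. \<beta> j * u j))\<^sup>2) / s"
proof -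
  define \<tau> where "\<tau> = 1 / (sqrt s + 1)"
  define \<sigma> where "\<sigma> = \<tau> / sqrt s"
  define \<rho> where "\<rho> = vnorm n u"
  have co1: "2 * \<tau> + \<tau>\<^sup>2 * \<rho> = 1" and co2: "2 * \<sigma> - \<sigma>\<^sup>2 * \<rho> = 1 / s"
    using shear_coeff(1,2)[of \<rho>] by (simp_all add: \<tau>_def \<sigma>_def s_def \<rho>_def)
  \<comment> \<open>The product \<open>x S\<close>, before the inverse acts on the columns.\<close>
  define y where "y = (\<lambda>(k, j). x (k, j) + (of_real \<tau> * \<gamma> k) * cnj (u j))"
  have rows: "vnorm n (\<lambda>j. r j + (of_real \<tau> * (\<Sum>l<n. r l * u l)) * cnj (u j)) = vnorm n r + (cmod (\<Sum>l<n. r l * u l))\<^sup>2" for r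
  proof -
    define g where "g = (\<Sum>l<n. r l * u l)"
    have "Re (cnj (of_real \<tau> * g) * (\<Sum>i<n. r i * cnj (cnj (u i)))) = \<tau> * (cmod g)\<^sup>2"
      unfolding cmod_power2 by (simp add: g_def[symmetric] power2_eq_square algebra_simps)
    moreover have "(cmod (of_real \<tau> * g))\<^sup>2 = \<tau>\<^sup>2 * (cmod g)\<^sup>2" by (simp add: norm_mult power_mult_distrib)
    ultimately have "vnorm n (\<lambda>j. r j + (of_real \<tau> * g) * cnj (u j)) = vnorm n r + (2 * \<tau> + \<tau>\<^sup>2 * \<rho>) * (cmod g)\<^sup>2"
      unfolding vnorm_add_mult by (simp add: \<rho>_def algebra_simps)
    thus ?thesis unfolding co1 g_def by simp
  qed
  have cols: "vnorm n (\<lambda>i. v i + (- (of_real \<sigma> * (\<Sum>k<n. v k * cnj (u k)))) * u i) = vnorm n v - (cmod (\<Sum>k<n. v k * cnj (u k)))\<^sup>2 / s" for v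
  proof -
    define g where "g = (\<Sum>k<n. v k * cnj (u k))"
    have "Re (cnj (- (of_real \<sigma> * g)) * (\<Sum>i<n. v i * cnj (u i))) = - \<sigma> * (cmod g)\<^sup>2"
      unfolding cmod_power2 by (simp add: g_def[symmetric] power2_eq_square algebra_simps)
    moreover have "(cmod (- (of_real \<sigma> * g)))\<^sup>2 = \<sigma>\<^sup>2 * (cmod g)\<^sup>2" by (simp add: norm_mult power_mult_distrib)
    ultimately have "vnorm n (\<lambda>i. v i + (- (of_real \<sigma> * g)) * u i) = vnorm n v - (2 * \<sigma> - \<sigma>\<^sup>2 * \<rho>) * (cmod g)\<^sup>2"
      unfolding vnorm_add_mult by (simp add: \<rho>_def algebra_simps)
    thus ?thesis unfolding co2 g_def by simp
  qed
  have entry: "shear_conj n u x (i, j) = y (i, j) + (- (of_real \<sigma> * (\<Sum>k<n. y (k, j) * cnj (u k)))) * u i"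
    if "i < n" "j < n" for i j
  proof -
    have "shear_conj n u x (i, j) = (\<Sum>k<n. shear_inv n u i k * (\<Sum>l<n. x (k, l) * shear n u l j))"
      using that by (simp add: shear_conj_def sum_distrib_left mult.assoc)
    also have "\<dots> = (\<Sum>k<n. shear_inv n u i k * y (k, j))"
      using that by (intro sum.cong refl) (simp add: sum_shear y_def \<gamma>_def \<tau>_def s_def)
    also have "\<dots> = y (i, j) + (- (of_real \<sigma> * (\<Sum>k<n. y (k, j) * cnj (u k)))) * u i"
      unfolding sum_shear_inv[OF that(1), of u "\<lambda>k. y (k, j)"] by (simp add: \<sigma>_def \<tau>_def s_def mult_ac)
    finally show ?thesis .
  qed
  have yb: "(\<Sum>k<n. y (k, j) * cnj (u k)) = \<beta> j + (of_real \<tau> * (\<Sum>l<n. \<beta> l * u l)) * cnj (u j)" for j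
  proof -
    have "(\<Sum>l<n. \<beta> l * u l) = (\<Sum>k<n. \<gamma> k * cnj (u k))"
      unfolding \<beta>_def \<gamma>_def sum_distrib_right by (subst sum.swap) (simp add: mult_ac)
    thus ?thesis
      by (simp add: y_def \<beta>_def algebra_simps sum.distrib sum_distrib_left)
  qed
  have "frob n (shear_conj n u x) = (\<Sum>j<n. vnorm n (\<lambda>i. y (i, j) + (- (of_real \<sigma> * (\<Sum>k<n. y (k, j) * cnj (u k)))) * u i))"
    unfolding frob_columns by (intro sum.cong refl) (simp add: vnorm_def entry)
  also have "\<dots> = frob n y - vnorm n (\<lambda>j. \<Sum>k<n. y (k, j) * cnj (u k)) / s"
    unfolding cols by (simp add: sum_subtractf frob_columns sum_divide_distrib[symmetric] vnorm_def)
  also have "frob n y = frob n x + vnorm n \<gamma>"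
  proof -
    have "frob n y = (\<Sum>i<n. vnorm n (\<lambda>j. x (i, j)) + (cmod (\<gamma> i))\<^sup>2)"
      unfolding frob_rows y_def by (intro sum.cong refl) (simp add: rows[of "\<lambda>j. x (_, j)", folded \<gamma>_def] \<gamma>_def rows)
    thus ?thesis by (simp add: sum.distrib frob_rows vnorm_def)
  qed
  also have "vnorm n (\<lambda>j. \<Sum>k<n. y (k, j) * cnj (u k)) = vnorm n \<beta> + (cmod (\<Sum>j<n. \<beta> j * u j))\<^sup>2"
    unfolding yb by (rule rows)
  finally show ?thesis .
qed

text \<open>This completes the square in \<open>w\<close>. For fixed \<open>z\<close>,
  \<open>u\<close>, \<open>x\<close> the squared norm is quadratic in \<open>w\<close> with leading
  part \<open>s (|w|^2 + |w u|^2)\<close>; \<open>y\<close> is the completed variable. What remains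
  free of \<open>w\<close> is \<open>|z|^2\<close> plus the squared norm of the sheared compression,
  which is the reason for the choice of \<open>S\<close>.\<close>

lemma frob_deflation:
  fixes n u w x z
  defines "s \<equiv> 1 + vnorm n u" and "D \<equiv> \<lambda>(i, j). x (i, j) + u i * w j"
  defines "y \<equiv> \<lambda>j. of_real s * w j + (\<Sum>i<n. x (i, j) * cnj (u i)) - z * cnj (u j)"
  shows "frob (Suc n) (border n D (\<lambda>i. z * u i - (\<Sum>j<n. D (i, j) * u j)) w (z - (\<Sum>j<n. w j * u j)))
    = (cmod z)\<^sup>2 + frob n (shear_conj n u x) + (vnorm n y + (cmod (\<Sum>j<n. y j * u j))\<^sup>2) / s"
proof -
  define \<rho> where "\<rho> = vnorm n u"
  define \<beta> where "\<beta> = (\<lambda>j. \<Sum>i<n. x (i, j) * cnj (u i))"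
  define \<gamma> where "\<gamma> = (\<lambda>i. \<Sum>j<n. x (i, j) * u j)"
  define \<delta> where "\<delta> = (\<Sum>j<n. \<beta> j * u j)"
  define \<omega> where "\<omega> = (\<Sum>j<n. w j * u j)"
  define P where "P = Re (\<Sum>j<n. \<beta> j * cnj (w j))"
  have s: "s = 1 + \<rho>" "s > 0" using vnorm_nonneg[of n u] by (simp_all add: s_def \<rho>_def add_pos_nonneg)
  have \<delta>2: "\<delta> = (\<Sum>i<n. \<gamma> i * cnj (u i))"
    unfolding \<delta>_def \<beta>_def \<gamma>_def sum_distrib_right by (subst sum.swap) (simp add: mult_ac)
  have f1: "frob n D = frob n x + 2 * P + \<rho> * vnorm n w"
  proof -
    have "vnorm n (\<lambda>i. D (i, j)) = vnorm n (\<lambda>i. x (i, j)) + 2 * Re (\<beta> j * cnj (w j)) + (cmod (w j))\<^sup>2 * \<rho>" for j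
      using vnorm_add_mult[of n "\<lambda>i. x (i, j)" "w j" u] by (simp add: D_def mult.commute \<beta>_def \<rho>_def)
    thus ?thesis
      by (simp add: frob_columns sum.distrib P_def vnorm_def Re_sum sum_distrib_left sum_distrib_right mult.commute)
  qed
  have f2: "vnorm n (\<lambda>i. z * u i - (\<Sum>j<n. D (i, j) * u j)) = vnorm n \<gamma> - 2 * Re (cnj (z - \<omega>) * \<delta>) + (cmod (z - \<omega>))\<^sup>2 * \<rho>"
  proof -
    have "z * u i - (\<Sum>j<n. D (i, j) * u j) = (- \<gamma> i) + (z - \<omega>) * u i" for i
      by (simp add: D_def \<gamma>_def \<omega>_def algebra_simps sum.distrib sum_distrib_left)
    moreover have "vnorm n (\<lambda>i. - \<gamma> i) = vnorm n \<gamma>" by (simp add: vnorm_def)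
    ultimately show ?thesis
      using vnorm_add_mult[of n "\<lambda>i. - \<gamma> i" "z - \<omega>" u] by (simp add: \<delta>2 sum_negf \<rho>_def)
  qed
  have f3: "vnorm n y = vnorm n \<beta> + 2 * s * P + s\<^sup>2 * vnorm n w - 2 * Re (cnj z * (of_real s * \<omega> + \<delta>)) + (cmod z)\<^sup>2 * \<rho>"
  proof -
    have "vnorm n y = vnorm n (\<lambda>j. (\<beta> j + of_real s * w j) + (- z) * cnj (u j))"
      unfolding y_def \<beta>_def by (intro arg_cong[of _ _ "vnorm n"] ext) (simp add: algebra_simps)
    also have "\<dots> = vnorm n (\<lambda>j. \<beta> j + of_real s * w j) - 2 * Re (cnj z * (of_real s * \<omega> + \<delta>)) + (cmod z)\<^sup>2 * \<rho>"
      unfolding vnorm_add_mult[of n "\<lambda>j. \<beta> j + of_real s * w j" "- z"]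
      by (simp add: \<rho>_def \<omega>_def \<delta>_def distrib_right sum.distrib sum_distrib_left add.commute mult.assoc)
    also have "vnorm n (\<lambda>j. \<beta> j + of_real s * w j) = vnorm n \<beta> + 2 * s * P + s\<^sup>2 * vnorm n w"
      unfolding vnorm_add_mult by (simp add: P_def)
    finally show ?thesis .
  qed
  have f4: "(\<Sum>j<n. y j * u j) = of_real s * \<omega> + \<delta> - z * of_real \<rho>"
  proof -
    have "(\<Sum>j<n. cnj (u j) * u j) = of_real \<rho>" using vnorm_complex[of u n] by (simp add: \<rho>_def mult.commute)
    moreover have "y j * u j = of_real s * (w j * u j) + \<beta> j * u j - z * (cnj (u j) * u j)" for j
      by (simp add: y_def \<beta>_def algebra_simps)
    ultimately show ?thesis
      by (simp add: sum.distrib sum_subtractf sum_distrib_left[symmetric] \<omega>_def \<delta>_def)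
  qed
  have f5: "frob n (shear_conj n u x) = frob n x + vnorm n \<gamma> - (vnorm n \<beta> + (cmod \<delta>)\<^sup>2) / s"
    using frob_shear_conj[of n u x] by (simp add: s_def \<beta>_def \<gamma>_def \<delta>_def)
  have lhs: "frob (Suc n) (border n D (\<lambda>i. z * u i - (\<Sum>j<n. D (i, j) * u j)) w (z - \<omega>)) =
     frob n x + 2 * P + \<rho> * vnorm n w + (vnorm n \<gamma> - 2 * Re (cnj (z - \<omega>) * \<delta>) + (cmod (z - \<omega>))\<^sup>2 * \<rho>) + vnorm n w + (cmod (z - \<omega>))\<^sup>2"
    unfolding frob_border f1 f2 by simp
  \<comment> \<open>Multiplied by \<open>s = 1 + \<rho>\<close>, the identity is polynomial in real
    and imaginary parts.\<close>
  have key: "s * (2 * P + \<rho> * vnorm n w - 2 * Re (cnj (z - \<omega>) * \<delta>) + (cmod (z - \<omega>))\<^sup>2 * \<rho> + vnorm n w + (cmod (z - \<omega>))\<^sup>2)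
    = s * (cmod z)\<^sup>2 - (vnorm n \<beta> + (cmod \<delta>)\<^sup>2) + (vnorm n y + (cmod (\<Sum>j<n. y j * u j))\<^sup>2)"
    unfolding f3 f4 cmod_power2 s(1) by (simp add: power2_eq_square algebra_simps)
  have "2 * P + \<rho> * vnorm n w - 2 * Re (cnj (z - \<omega>) * \<delta>) + (cmod (z - \<omega>))\<^sup>2 * \<rho> + vnorm n w + (cmod (z - \<omega>))\<^sup>2
    = (s * (cmod z)\<^sup>2 - (vnorm n \<beta> + (cmod \<delta>)\<^sup>2) + (vnorm n y + (cmod (\<Sum>j<n. y j * u j))\<^sup>2)) / s"
    using key s(2) by (simp add: eq_divide_eq mult.commute)
  also have "\<dots> = (cmod z)\<^sup>2 - (vnorm n \<beta> + (cmod \<delta>)\<^sup>2) / s + (vnorm n y + (cmod (\<Sum>j<n. y j * u j))\<^sup>2) / s"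
    using s(2) by (simp add: add_divide_distrib diff_divide_distrib)
  finally show ?thesis
    using lhs unfolding f5 \<omega>_def[symmetric] by simp
qed

section \<open>Integrating out the border of a deflated matrix\<close>

abbreviation sq :: "nat \<Rightarrow> (nat \<times> nat) set"
  where "sq n \<equiv> {..<n} \<times> {..<n}"

lemma pair_sigma_finite_lebC: "finite I \<Longrightarrow> finite J \<Longrightarrow> pair_sigma_finite (lebC I) (lebC J)"
  by (intro pair_sigma_finite.intro lebC.sigma_finite)

lemma sigma_finite_lebC: "finite I \<Longrightarrow> sigma_finite_measure (lebC I)"
  by (rule lebC.sigma_finite)

text \<open>The factor supplied by \<open>nn_integral_linear_change\<close> for the identity matrix
  is the same for all translations, so comparison with the zero translation cancels it.\<close>

lemma nn_integral_lebC_translate: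
  fixes k :: "('i \<Rightarrow> complex) \<Rightarrow> ennreal"
  assumes I: "finite I" and k: "k \<in> borel_measurable (lebC I)"
  shows "(\<integral>\<^sup>+x. k (\<lambda>i\<in>I. t i + x i) \<partial>lebC I) = (\<integral>\<^sup>+x. k x \<partial>lebC I)"
proof -
  define S :: "'i \<Rightarrow> 'i \<Rightarrow> complex" where "S = (\<lambda>i j. if j = i then 1 else 0)"
  have S: "(\<Sum>j\<in>I. S i j * x j) = x i" if "i \<in> I" for i and x :: "'i \<Rightarrow> complex"
  proof -
    have "(\<Sum>j\<in>I. S i j * x j) = (\<Sum>j\<in>I. if j = i then x j else 0)"
      by (intro sum.cong) (auto simp: S_def)
    thus ?thesis using that I by simp
  qed
  have "\<forall>x. (\<forall>i\<in>I. (\<Sum>j\<in>I. S i j * x j) = 0) \<longrightarrow> (\<forall>i\<in>I. x i = 0)" using S by auto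
  from nn_integral_linear_change[OF I this] obtain J :: real where J: "J > 0"
    "\<And>t. ennreal J * (\<integral>\<^sup>+x. k (\<lambda>i\<in>I. t i + (\<Sum>j\<in>I. S i j * x j)) \<partial>lebC I) = (\<integral>\<^sup>+x. k x \<partial>lebC I)"
    using k by blast
  have J2: "ennreal J * (\<integral>\<^sup>+x. k (\<lambda>i\<in>I. t i + x i) \<partial>lebC I) = (\<integral>\<^sup>+x. k x \<partial>lebC I)" for t
    using J(2)[of t] by (simp add: S cong: restrict_cong)
  have "(\<integral>\<^sup>+x. k (\<lambda>i\<in>I. 0 + x i) \<partial>lebC I) = (\<integral>\<^sup>+x. k x \<partial>lebC I)"
    by (intro nn_integral_cong arg_cong[of _ _ k])
       (auto simp: space_PiM PiE_def extensional_def fun_eq_iff restrict_def)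
  with J2[of "\<lambda>_. 0"] J2[of t]
  have "ennreal J * (\<integral>\<^sup>+x. k (\<lambda>i\<in>I. t i + x i) \<partial>lebC I) = ennreal J * (\<integral>\<^sup>+x. k x \<partial>lebC I)" by simp
  thus ?thesis using J(1) by (simp add: ennreal_mult_cancel_left)
qed

lemma measurable_frob [measurable]: "frob n \<in> borel_measurable (lebC (sq n))"
  unfolding frob_def by (intro borel_measurable_sum borel_measurable_power borel_measurable_norm) auto

lemma border_cong:
  assumes "\<And>i j. i < n \<Longrightarrow> j < n \<Longrightarrow> D (i, j) = D' (i, j)" "\<And>i. i < n \<Longrightarrow> c i = c' i"
    "\<And>j. j < n \<Longrightarrow> w j = w' j" "a = a'"
  shows "border n D c w a = border n D' c' w' a'"
  using assms by (auto simp: border_def fun_eq_iff restrict_def)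

lemma measurable_border:
  assumes "\<And>i j. i < n \<Longrightarrow> j < n \<Longrightarrow> (\<lambda>x. D x (i, j)) \<in> borel_measurable M"
    "\<And>i. i < n \<Longrightarrow> (\<lambda>x. c x i) \<in> borel_measurable M"
    "\<And>j. j < n \<Longrightarrow> (\<lambda>x. w x j) \<in> borel_measurable M"
    "a \<in> borel_measurable M"
  shows "(\<lambda>x. border n (D x) (c x) (w x) (a x)) \<in> measurable M (lebC (sq (Suc n)))"
  unfolding border_def
proof (rule measurable_restrict)
  fix p assume p: "p \<in> sq (Suc n)"
  obtain i j where ij: "p = (i, j)" by (cases p)
  show "(\<lambda>x. case p of (i, j) \<Rightarrow> if i < n then if j < n then D x (i, j) else c x i else if j < n then w x j else a x)
    \<in> measurable M lborel"
    unfolding ij using assms p ij by (cases "i < n"; cases "j < n") auto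
qed

text \<open>The Gaussian weight of the bordered matrix once column and corner are expressed through
  the eigenvector \<open>(u, 1)\<close> and the eigenvalue \<open>z\<close>.\<close>

definition deflation_weight :: "nat \<Rightarrow> complex \<Rightarrow> (nat \<Rightarrow> complex) \<Rightarrow> (nat \<Rightarrow> complex) \<Rightarrow> (nat \<times> nat \<Rightarrow> complex) \<Rightarrow> real"
  where "deflation_weight n z u w D =
    exp (- frob (Suc n) (border n D (\<lambda>i. z * u i - (\<Sum>j<n. D (i, j) * u j)) w (z - (\<Sum>j<n. w j * u j))))"

text \<open>For fixed \<open>w\<close>, translating \<open>D\<close> by \<open>u w\<close> makes the
  compression the variable, and \<open>frob_deflation\<close> splits the weight. The integral over
  \<open>w\<close> is then a constant by translation invariance, and undoing the shear leaves
  \<open>H\<close> unchanged because conjugate matrices have equal \<open>chi\<close>. The factor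
  depends on \<open>u\<close> alone, so it can later be integrated separately.\<close>

lemma deflated_integral:
  fixes u :: "nat \<Rightarrow> complex"
  shows "\<exists>\<kappa>::ennreal. \<forall>z H. H \<in> borel_measurable (lebC (sq n)) \<longrightarrow>
     (\<forall>x y. chi n x = chi n y \<longrightarrow> H x = H y) \<longrightarrow>
     (\<integral>\<^sup>+w. \<integral>\<^sup>+D. H (\<lambda>(i, j)\<in>sq n. D (i, j) - u i * w j) * ennreal (deflation_weight n z u w D) \<partial>lebC (sq n) \<partial>lebC {..<n})
     = ennreal (exp (- (cmod z)\<^sup>2)) * \<kappa> * (\<integral>\<^sup>+x. H x * ennreal (exp (- frob n x)) \<partial>lebC (sq n))"
proof -
  define s where "s = 1 + vnorm n u"
  have s: "s > 0" using vnorm_nonneg[of n u] by (simp add: s_def add_pos_nonneg)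
  define \<Psi> where "\<Psi> = (\<lambda>v. ennreal (exp (- ((vnorm n v + (cmod (\<Sum>j<n. v j * u j))\<^sup>2) / s))))"
  have \<Psi>m: "(\<lambda>x. \<Psi> (v x)) \<in> borel_measurable M" if "\<And>j. j < n \<Longrightarrow> (\<lambda>x. v x j) \<in> borel_measurable M"
    for v and M :: "'z measure"
    unfolding \<Psi>_def vnorm_def using that by measurable
  have \<Psi>_cong: "\<Psi> v = \<Psi> v'" if "\<And>j. j < n \<Longrightarrow> v j = v' j" for v v'
  proof -
    have "vnorm n v = vnorm n v'" unfolding vnorm_def by (intro sum.cong) (auto simp: that)
    moreover have "(\<Sum>j<n. v j * u j) = (\<Sum>j<n. v' j * u j)" by (intro sum.cong) (auto simp: that)
    ultimately show ?thesis by (simp add: \<Psi>_def)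
  qed
  define C where "C = (\<integral>\<^sup>+w. \<Psi> (\<lambda>j. of_real s * w j) \<partial>lebC {..<n})"
  \<comment> \<open>The completed variable is \<open>s w\<close> plus a shift depending on
    \<open>x\<close> and \<open>z\<close>; as \<open>s > 0\<close>, the shift is absorbed by
    translating \<open>w\<close> by \<open>t / s\<close>.\<close>
  have Cshift: "(\<integral>\<^sup>+w. \<Psi> (\<lambda>j. of_real s * w j + t j) \<partial>lebC {..<n}) = C" for t
  proof -
    have "(\<integral>\<^sup>+w. \<Psi> (\<lambda>j. of_real s * w j + t j) \<partial>lebC {..<n})
       = (\<integral>\<^sup>+w. (\<lambda>w. \<Psi> (\<lambda>j. of_real s * w j)) (\<lambda>j\<in>{..<n}. t j / of_real s + w j) \<partial>lebC {..<n})"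
    proof (rule nn_integral_cong)
      fix w :: "nat \<Rightarrow> complex"
      have e: "of_real s * w j + t j = of_real s * (\<lambda>j\<in>{..<n}. t j / of_real s + w j) j" if "j < n" for j
        using that s by (simp add: field_simps)
      show "\<Psi> (\<lambda>j. of_real s * w j + t j) = \<Psi> (\<lambda>j. of_real s * (\<lambda>j\<in>{..<n}. t j / of_real s + w j) j)"
        by (rule \<Psi>_cong[OF e])
    qed
    also have "\<dots> = C"
      unfolding C_def by (rule nn_integral_lebC_translate[OF finite_lessThan \<Psi>m]) auto
    finally show ?thesis .
  qed
  \<comment> \<open>Conjugation by the shear as a matrix on index pairs, so that
    \<open>nn_integral_linear_change\<close> supplies its Jacobian.\<close>
  define S where "S = (\<lambda>p q. shear_inv n u (fst p) (fst q) * shear n u (snd q) (snd p))"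
  have S: "(\<lambda>p\<in>sq n. 0 + (\<Sum>q\<in>sq n. S p q * x q)) = shear_conj n u x" for x
    by (auto simp: shear_conj_def S_def fun_eq_iff restrict_def sum.cartesian_product case_prod_unfold mult_ac intro!: sum.cong)
  have "\<forall>x. (\<forall>p\<in>sq n. (\<Sum>q\<in>sq n. S p q * x q) = 0) \<longrightarrow> (\<forall>p\<in>sq n. x p = 0)"
  proof safe
    fix x i j assume x: "\<forall>p\<in>sq n. (\<Sum>q\<in>sq n. S p q * x q) = 0" and ij: "i < n" "j < n"
    show "x (i, j) = 0"
      by (rule shear_conj_injective[of n u x, OF _ ij]) (use x in \<open>simp add: S[symmetric]\<close>)
  qed
  from nn_integral_linear_change[OF _ this] obtain J :: real where J: "J > 0"
    "\<And>t k. k \<in> borel_measurable (lebC (sq n)) \<Longrightarrow>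
      ennreal J * (\<integral>\<^sup>+x. k (\<lambda>p\<in>sq n. t p + (\<Sum>q\<in>sq n. S p q * x q)) \<partial>lebC (sq n)) = (\<integral>\<^sup>+x. k x \<partial>lebC (sq n))"
    by auto
  have conjm[measurable]: "shear_conj n u \<in> measurable (lebC (sq n)) (lebC (sq n))"
    using measurable_affine_map[where I = "sq n" and J = "sq n" and t = "\<lambda>_. 0" and S = S] by (simp only: S)
  have Jconj: "(\<integral>\<^sup>+x. k (shear_conj n u x) \<partial>lebC (sq n)) = ennreal (1 / J) * (\<integral>\<^sup>+x. k x \<partial>lebC (sq n))"
    if "k \<in> borel_measurable (lebC (sq n))" for k
  proof -
    have "ennreal (1 / J) * (\<integral>\<^sup>+x. k x \<partial>lebC (sq n)) = ennreal (1 / J) * (ennreal J * (\<integral>\<^sup>+x. k (shear_conj n u x) \<partial>lebC (sq n)))"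
      using J(2)[OF that, of "\<lambda>_. 0"] by (simp only: S)
    also have "\<dots> = ennreal (1 / J * J) * (\<integral>\<^sup>+x. k (shear_conj n u x) \<partial>lebC (sq n))"
      using J(1) by (simp only: mult.assoc[symmetric] ennreal_mult[symmetric] less_imp_le zero_le_divide_1_iff)
    finally show ?thesis using J(1) by simp
  qed
  have main: "(\<integral>\<^sup>+w. \<integral>\<^sup>+D. H (\<lambda>(i, j)\<in>sq n. D (i, j) - u i * w j) * ennreal (deflation_weight n z u w D) \<partial>lebC (sq n) \<partial>lebC {..<n})
     = ennreal (exp (- (cmod z)\<^sup>2)) * (C * ennreal (1 / J)) * (\<integral>\<^sup>+x. H x * ennreal (exp (- frob n x)) \<partial>lebC (sq n))"
    if H[measurable]: "H \<in> borel_measurable (lebC (sq n))" and inv: "\<forall>x y. chi n x = chi n y \<longrightarrow> H x = H y" for z H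
  proof -
    define T where "T = (\<lambda>x j. (\<Sum>i<n. x (i, j) * cnj (u i)) - z * cnj (u j))"
    have Tm: "(\<lambda>x. T x j) \<in> borel_measurable (lebC (sq n))" if "j < n" for j
      unfolding T_def using that by (intro borel_measurable_diff borel_measurable_sum borel_measurable_times) auto
    have step1: "(\<integral>\<^sup>+D. H (\<lambda>(i, j)\<in>sq n. D (i, j) - u i * w j) * ennreal (deflation_weight n z u w D) \<partial>lebC (sq n))
      = (\<integral>\<^sup>+x. H x * (ennreal (exp (- (cmod z)\<^sup>2)) * ennreal (exp (- frob n (shear_conj n u x)))) * \<Psi> (\<lambda>j. of_real s * w j + T x j) \<partial>lebC (sq n))"
      for w
    proof -
      define k where "k = (\<lambda>D. H (\<lambda>(i, j)\<in>sq n. D (i, j) - u i * w j) * ennreal (deflation_weight n z u w D))"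
      have "(\<lambda>D. \<lambda>(i, j)\<in>sq n. D (i, j) - u i * w j) \<in> measurable (lebC (sq n)) (lebC (sq n))"
        by (rule measurable_restrict) auto
      moreover have "(\<lambda>D. border n D (\<lambda>i. z * u i - (\<Sum>j<n. D (i, j) * u j)) w (z - (\<Sum>j<n. w j * u j)))
         \<in> measurable (lebC (sq n)) (lebC (sq (Suc n)))"
        by (rule measurable_border) (auto intro!: borel_measurable_diff borel_measurable_sum borel_measurable_times)
      ultimately have k[measurable]: "k \<in> borel_measurable (lebC (sq n))"
        unfolding k_def deflation_weight_def by measurable
      have "(\<integral>\<^sup>+D. k D \<partial>lebC (sq n)) = (\<integral>\<^sup>+x. k (\<lambda>p\<in>sq n. (u (fst p) * w (snd p)) + x p) \<partial>lebC (sq n))"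
        by (rule nn_integral_lebC_translate[symmetric, OF _ k]) auto
      also have "\<dots> = (\<integral>\<^sup>+x. H x * (ennreal (exp (- (cmod z)\<^sup>2)) * ennreal (exp (- frob n (shear_conj n u x)))) * \<Psi> (\<lambda>j. of_real s * w j + T x j) \<partial>lebC (sq n))"
      proof (rule nn_integral_cong)
        fix x assume x: "x \<in> space (lebC (sq n))"
        define D where "D = (\<lambda>p\<in>sq n. (u (fst p) * w (snd p)) + x p)"
        define D' where "D' = (\<lambda>(i, j). x (i, j) + u i * w j)"
        have DD': "D (i, j) = D' (i, j)" if "i < n" "j < n" for i j using that by (simp add: D_def D'_def)
        have "(\<lambda>(i, j)\<in>sq n. D (i, j) - u i * w j) = x"
          using x by (auto simp: D_def fun_eq_iff restrict_def space_PiM PiE_def extensional_def)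
        moreover have "deflation_weight n z u w D = exp (- (cmod z)\<^sup>2) * exp (- frob n (shear_conj n u x)) *
            exp (- ((vnorm n (\<lambda>j. of_real s * w j + T x j) + (cmod (\<Sum>j<n. (of_real s * w j + T x j) * u j))\<^sup>2) / s))"
        proof -
          have "border n D (\<lambda>i. z * u i - (\<Sum>j<n. D (i, j) * u j)) w (z - (\<Sum>j<n. w j * u j))
              = border n D' (\<lambda>i. z * u i - (\<Sum>j<n. D' (i, j) * u j)) w (z - (\<Sum>j<n. w j * u j))"
            by (rule border_cong) (auto simp: DD' intro!: sum.cong)
          moreover have "frob (Suc n) (border n D' (\<lambda>i. z * u i - (\<Sum>j<n. D' (i, j) * u j)) w (z - (\<Sum>j<n. w j * u j)))
              = (cmod z)\<^sup>2 + frob n (shear_conj n u x) +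
                (vnorm n (\<lambda>j. of_real s * w j + T x j) + (cmod (\<Sum>j<n. (of_real s * w j + T x j) * u j))\<^sup>2) / s"
            using frob_deflation[where n = n and u = u and w = w and x = x and z = z]
            unfolding D'_def T_def s_def by (simp only: add_diff_eq)
          ultimately show ?thesis
            unfolding deflation_weight_def by (simp add: exp_add[symmetric])
        qed
        ultimately show "k (\<lambda>p\<in>sq n. (u (fst p) * w (snd p)) + x p) =
           H x * (ennreal (exp (- (cmod z)\<^sup>2)) * ennreal (exp (- frob n (shear_conj n u x)))) * \<Psi> (\<lambda>j. of_real s * w j + T x j)"
          unfolding k_def D_def[symmetric] \<Psi>_def by (simp add: ennreal_mult mult.assoc)
      qed
      finally show ?thesis unfolding k_def .
    qed
    interpret P: pair_sigma_finite "lebC {..<n}" "lebC (sq n)" by (rule pair_sigma_finite_lebC) auto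
    have "(\<integral>\<^sup>+w. \<integral>\<^sup>+D. H (\<lambda>(i, j)\<in>sq n. D (i, j) - u i * w j) * ennreal (deflation_weight n z u w D) \<partial>lebC (sq n) \<partial>lebC {..<n})
      = (\<integral>\<^sup>+w. \<integral>\<^sup>+x. H x * (ennreal (exp (- (cmod z)\<^sup>2)) * ennreal (exp (- frob n (shear_conj n u x)))) * \<Psi> (\<lambda>j. of_real s * w j + T x j) \<partial>lebC (sq n) \<partial>lebC {..<n})"
      by (simp only: step1)
    also have "\<dots> = (\<integral>\<^sup>+x. \<integral>\<^sup>+w. H x * (ennreal (exp (- (cmod z)\<^sup>2)) * ennreal (exp (- frob n (shear_conj n u x)))) * \<Psi> (\<lambda>j. of_real s * w j + T x j) \<partial>lebC {..<n} \<partial>lebC (sq n))"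
    proof (rule P.Fubini'[symmetric])
      have "(\<lambda>p. \<Psi> (\<lambda>j. of_real s * fst p j + T (snd p) j)) \<in> borel_measurable (lebC {..<n} \<Otimes>\<^sub>M lebC (sq n))"
      proof (rule \<Psi>m)
        fix j assume j: "j < n"
        have [measurable]: "(\<lambda>p. T (snd p) j) \<in> borel_measurable (lebC {..<n} \<Otimes>\<^sub>M lebC (sq n))"
          by (rule measurable_compose[OF measurable_snd Tm[OF j]])
        have [measurable]: "(\<lambda>p. fst p j) \<in> borel_measurable (lebC {..<n} \<Otimes>\<^sub>M lebC (sq n))"
          by (rule measurable_compose[OF measurable_fst]) (use j in auto)
        show "(\<lambda>p. of_real s * fst p j + T (snd p) j) \<in> borel_measurable (lebC {..<n} \<Otimes>\<^sub>M lebC (sq n))"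
          by measurable
      qed
      thus "(\<lambda>(w, x). H x * (ennreal (exp (- (cmod z)\<^sup>2)) * ennreal (exp (- frob n (shear_conj n u x)))) * \<Psi> (\<lambda>j. of_real s * w j + T x j))
         \<in> borel_measurable (lebC {..<n} \<Otimes>\<^sub>M lebC (sq n))"
        unfolding case_prod_unfold by measurable
    qed
    also have "\<dots> = (\<integral>\<^sup>+x. H x * (ennreal (exp (- (cmod z)\<^sup>2)) * ennreal (exp (- frob n (shear_conj n u x)))) * C \<partial>lebC (sq n))"
    proof (rule nn_integral_cong)
      fix x
      have "(\<lambda>w. \<Psi> (\<lambda>j. of_real s * w j + T x j)) \<in> borel_measurable (lebC {..<n})"
        by (rule \<Psi>m) measurable
      thus "(\<integral>\<^sup>+w. H x * (ennreal (exp (- (cmod z)\<^sup>2)) * ennreal (exp (- frob n (shear_conj n u x)))) * \<Psi> (\<lambda>j. of_real s * w j + T x j) \<partial>lebC {..<n})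
        = H x * (ennreal (exp (- (cmod z)\<^sup>2)) * ennreal (exp (- frob n (shear_conj n u x)))) * C"
        by (subst nn_integral_cmult) (simp_all add: Cshift)
    qed
    also have "\<dots> = (\<integral>\<^sup>+x. ennreal (exp (- (cmod z)\<^sup>2)) * C * (\<lambda>x. H x * ennreal (exp (- frob n x))) (shear_conj n u x) \<partial>lebC (sq n))"
    proof (rule nn_integral_cong)
      fix x
      have "H (shear_conj n u x) = H x" using inv chi_shear_conj by blast
      thus "H x * (ennreal (exp (- (cmod z)\<^sup>2)) * ennreal (exp (- frob n (shear_conj n u x)))) * C
        = ennreal (exp (- (cmod z)\<^sup>2)) * C * (\<lambda>x. H x * ennreal (exp (- frob n x))) (shear_conj n u x)"
        by (simp add: ac_simps)
    qed
    also have "\<dots> = ennreal (exp (- (cmod z)\<^sup>2)) * C * (\<integral>\<^sup>+x. (\<lambda>x. H x * ennreal (exp (- frob n x))) (shear_conj n u x) \<partial>lebC (sq n))"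
      by (rule nn_integral_cmult) measurable
    also have "\<dots> = ennreal (exp (- (cmod z)\<^sup>2)) * C * (ennreal (1 / J) * (\<integral>\<^sup>+x. H x * ennreal (exp (- frob n x)) \<partial>lebC (sq n)))"
      by (subst Jconj) measurable
    finally show ?thesis by (simp add: mult.assoc)
  qed
  show ?thesis
    by (rule exI[of _ "C * ennreal (1 / J)"]) (use main in blast)
qed

section \<open>Generic coprimality\<close>

text \<open>Polynomial functions of the coordinates in \<open>I\<close>, generated inductively so
  that measurability, substitution and restriction to a coordinate line follow by induction.\<close>

inductive polyfn :: "'i set \<Rightarrow> (('i \<Rightarrow> complex) \<Rightarrow> complex) \<Rightarrow> bool" for I
  where const: "polyfn I (\<lambda>_. c)"
  | proj: "i \<in> I \<Longrightarrow> polyfn I (\<lambda>x. x i)"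
  | add: "polyfn I f \<Longrightarrow> polyfn I g \<Longrightarrow> polyfn I (\<lambda>x. f x + g x)"
  | mult: "polyfn I f \<Longrightarrow> polyfn I g \<Longrightarrow> polyfn I (\<lambda>x. f x * g x)"

lemma polyfn_uminus: "polyfn I f \<Longrightarrow> polyfn I (\<lambda>x. - f x)"
  using polyfn.mult[OF polyfn.const[of I "- 1"]] by fastforce

lemma polyfn_sum: "(\<And>a. a \<in> A \<Longrightarrow> polyfn I (f a)) \<Longrightarrow> polyfn I (\<lambda>x. \<Sum>a\<in>A. f a x)"
  by (induction A rule: infinite_finite_induct) (auto intro: polyfn.intros)

lemma polyfn_prod: "(\<And>a. a \<in> A \<Longrightarrow> polyfn I (f a)) \<Longrightarrow> polyfn I (\<lambda>x. \<Prod>a\<in>A. f a x)"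
  by (induction A rule: infinite_finite_induct) (auto intro: polyfn.intros)

lemma polyfn_if: "(c \<Longrightarrow> polyfn I f) \<Longrightarrow> (\<not> c \<Longrightarrow> polyfn I g) \<Longrightarrow> polyfn I (\<lambda>x. if c then f x else g x)"
  by (cases c) simp_all

lemma polyfn_cong: "polyfn I f \<Longrightarrow> (\<And>i. i \<in> I \<Longrightarrow> x i = y i) \<Longrightarrow> f x = f y"
  by (induction rule: polyfn.induct) auto

lemma polyfn_measurable:
  "polyfn I f \<Longrightarrow> (\<And>i. i \<in> I \<Longrightarrow> (\<lambda>x. v x i) \<in> borel_measurable M) \<Longrightarrow> (\<lambda>x. f (v x)) \<in> borel_measurable M"
  by (induction rule: polyfn.induct) auto

lemma polyfn_compose:
  "polyfn I f \<Longrightarrow> (\<And>i. i \<in> I \<Longrightarrow> polyfn J (\<lambda>x. v x i)) \<Longrightarrow> polyfn J (\<lambda>x. f (v x))"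
  by (induction rule: polyfn.induct) (auto intro: polyfn.intros)

lemma polyfn_univariate: "polyfn I f \<Longrightarrow> \<exists>p. \<forall>t. f (x(i := t)) = poly p t"
proof (induction rule: polyfn.induct)
  case (const c)
  show ?case by (rule exI[of _ "[:c:]"]) simp
next
  case (proj j)
  show ?case
  proof (cases "j = i")
    case True thus ?thesis by (intro exI[of _ "[:0, 1:]"]) simp
  next
    case False thus ?thesis by (intro exI[of _ "[:x j:]"]) simp
  qed
next
  case (add f g)
  from add.IH obtain p q where "\<forall>t. f (x(i := t)) = poly p t" "\<forall>t. g (x(i := t)) = poly q t" by blast
  thus ?case by (intro exI[of _ "p + q"]) (simp del: fun_upd_apply)
next
  case (mult f g)
  from mult.IH obtain p q where "\<forall>t. f (x(i := t)) = poly p t" "\<forall>t. g (x(i := t)) = poly q t" by blast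
  thus ?case by (intro exI[of _ "p * q"]) (simp del: fun_upd_apply)
qed

lemma AE_polyfn_nonzero:
  assumes I: "finite I" and f: "polyfn I f" and nz: "f x0 \<noteq> 0"
  shows "AE x in lebC I. f x \<noteq> 0"
proof -
  define ov where "ov = (\<lambda>J y i. if i \<in> J then y i else x0 i)"
  have claim: "AE y in lebC J. f (ov J y) \<noteq> 0" if "finite J" for J
    using that
  proof (induction J rule: finite_induct)
    case empty
    thus ?case using nz by (simp add: ov_def)
  next
    case (insert i J)
    have m: "(\<lambda>y. f (ov K y)) \<in> borel_measurable (lebC K)" for K
    proof (rule polyfn_measurable[OF f])
      show "(\<lambda>y. ov K y i) \<in> borel_measurable (lebC K)" for i
        by (cases "i \<in> K") (auto simp: ov_def)
    qed
    have m': "{y \<in> space (lebC K). f (ov K y) \<noteq> 0} \<in> sets (lebC K)" for K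
      using m[of K] by measurable
    have m0[measurable]: "{y \<in> space (lebC K). f (ov K y) = 0} \<in> sets (lebC K)" for K
      using m[of K] by measurable
    define Z where "Z = {y \<in> space (lebC (insert i J)). f (ov (insert i J) y) = 0}"
    have "(\<integral>\<^sup>+y. indicator Z y \<partial>lebC (insert i J)) = (\<integral>\<^sup>+x. \<integral>\<^sup>+t. indicator Z (x(i := t)) \<partial>lborel \<partial>lebC J)"
      by (rule lebC.product_nn_integral_insert) (use insert in \<open>auto simp: Z_def\<close>)
    also have "\<dots> = (\<integral>\<^sup>+x. 0 \<partial>lebC J)"
    proof (rule nn_integral_cong_AE)
      show "AE x in lebC J. (\<integral>\<^sup>+t. indicator Z (x(i := t)) \<partial>lborel) = 0"
        using insert.IH
      proof eventually_elim
        case (elim x)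
        have ov: "ov (insert i J) (x(i := t)) = (ov J x)(i := t)" for t by (auto simp: ov_def)
        obtain p where p: "\<forall>t. f ((ov J x)(i := t)) = poly p t" using polyfn_univariate[OF f] by blast
        have "(ov J x)(i := x0 i) = ov J x" using insert.hyps by (auto simp: ov_def)
        hence "poly p (x0 i) \<noteq> 0" using elim p by metis
        hence "p \<noteq> 0" by auto
        hence fin: "finite {t. poly p t = 0}" by (rule poly_roots_finite)
        have "AE t in lborel. t \<notin> {t. poly p t = 0}"
          by (rule AE_not_in) (simp add: fin finite_imp_null_set_lborel)
        hence "AE t in lborel. indicator Z (x(i := t)) = (0::ennreal)"
          by eventually_elim (auto simp: Z_def ov p indicator_def)
        thus ?case by (simp add: nn_integral_0_iff_AE cong: nn_integral_cong_AE)
      qed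
    qed
    finally have "(\<integral>\<^sup>+y. indicator Z y \<partial>lebC (insert i J)) = 0" by simp
    moreover have "Z \<in> sets (lebC (insert i J))" unfolding Z_def by measurable
    ultimately have "emeasure (lebC (insert i J)) Z = 0" by simp
    hence "Z \<in> null_sets (lebC (insert i J))" using \<open>Z \<in> sets _\<close> by auto
    thus ?case by (rule AE_I') (auto simp: Z_def)
  qed
  have "f (ov I y) = f y" for y by (rule polyfn_cong[OF f]) (auto simp: ov_def)
  thus ?thesis using claim[OF I] by simp
qed

lemma polyfn_det:
  assumes "\<And>x. A x \<in> carrier_mat m m" "\<And>i j. i < m \<Longrightarrow> j < m \<Longrightarrow> polyfn I (\<lambda>x. A x $$ (i, j))"
  shows "polyfn I (\<lambda>x. Determinant.det (A x))"
proof -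
  have "Determinant.det (A x) = (\<Sum>p\<in>{p. p permutes {0..<m}}. signof p * (\<Prod>i = 0..<m. A x $$ (i, p i)))" for x
    using det_def'[OF assms(1)] .
  moreover have "polyfn I (\<lambda>x. \<Sum>p\<in>{p. p permutes {0..<m}}. signof p * (\<Prod>i = 0..<m. A x $$ (i, p i)))"
  proof (intro polyfn_sum polyfn.mult polyfn.const polyfn_prod assms(2))
    fix p i assume "p \<in> {p. p permutes {0..<m}}" and i: "i \<in> {0..<m}"
    thus "p i < m" using permutes_in_image[of p "{0..<m}" i] by auto
  qed auto
  ultimately show ?thesis by simp
qed

lemma polyfn_coeff_mult:
  assumes "\<And>k. polyfn I (\<lambda>x. coeff (F x) k)" "\<And>k. polyfn I (\<lambda>x. coeff (G x) k)"
  shows "polyfn I (\<lambda>x. coeff (F x * G x) k)"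
  unfolding coeff_mult by (intro polyfn_sum polyfn.mult assms)

lemma polyfn_coeff_prod:
  assumes "\<And>a k. a \<in> A \<Longrightarrow> polyfn I (\<lambda>x. coeff (F a x) k)"
  shows "polyfn I (\<lambda>x. coeff (\<Prod>a\<in>A. F a x) k)"
  using assms
proof (induction A arbitrary: k rule: infinite_finite_induct)
  case (insert a A)
  have "polyfn I (\<lambda>x. coeff (F a x * (\<Prod>a\<in>A. F a x)) k)"
    by (rule polyfn_coeff_mult) (auto intro: insert)
  thus ?case using insert.hyps by simp
qed (auto intro: polyfn.const)

lemma polyfn_coeff_chi: "polyfn (sq n) (\<lambda>x. coeff (chi n x) k)"
proof -
  have "chi n x = (\<Sum>p\<in>{p. p permutes {0..<n}}. signof p * (\<Prod>i = 0..<n. char_poly_matrix (Matrix.mat n n x) $$ (i, p i)))" for x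
    unfolding chi_def char_poly_def by (rule det_def') simp
  moreover have "polyfn (sq n) (\<lambda>x. coeff (signof p * (\<Prod>i = 0..<n. char_poly_matrix (Matrix.mat n n x) $$ (i, p i))) k)"
    if p: "p permutes {0..<n}" for p k
  proof (rule polyfn_coeff_mult)
    show "polyfn (sq n) (\<lambda>x. coeff (signof p) k)" for k by (rule polyfn.const)
    show "polyfn (sq n) (\<lambda>x. coeff (\<Prod>i = 0..<n. char_poly_matrix (Matrix.mat n n x) $$ (i, p i)) k)" for k
    proof (rule polyfn_coeff_prod)
      fix i k assume i: "i \<in> {0..<n}"
      hence "p i < n" using permutes_in_image[OF p, of i] by auto
      have e: "char_poly_matrix (Matrix.mat n n x) $$ (i, p i) = [:- x (i, p i), if i = p i then 1 else 0:]" for x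
        using i \<open>p i < n\<close> by (auto simp: char_poly_matrix_def)
      have e': "coeff (char_poly_matrix (Matrix.mat n n x) $$ (i, p i)) k =
        (if k = 0 then - x (i, p i) else if k = 1 \<and> i = p i then 1 else 0)" for x
        unfolding e by (auto simp: coeff_pCons split: nat.split)
      show "polyfn (sq n) (\<lambda>x. coeff (char_poly_matrix (Matrix.mat n n x) $$ (i, p i)) k)"
        unfolding e' using i \<open>p i < n\<close>
        by (intro polyfn_if polyfn_uminus polyfn.const polyfn.proj) auto
    qed
  qed
  ultimately show ?thesis by (simp add: coeff_sum) (rule polyfn_sum, simp)
qed

lemma measurable_coeff_chi:
  assumes "\<And>i j. i < n \<Longrightarrow> j < n \<Longrightarrow> (\<lambda>x. v x (i, j)) \<in> borel_measurable M"
  shows "(\<lambda>x. coeff (chi n (v x)) k) \<in> borel_measurable M"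
  by (rule polyfn_measurable[OF polyfn_coeff_chi]) (use assms in auto)

lemma measurable_poly_chi:
  assumes "\<And>i j. i < n \<Longrightarrow> j < n \<Longrightarrow> (\<lambda>x. v x (i, j)) \<in> borel_measurable M" "z \<in> borel_measurable M"
  shows "(\<lambda>x. poly (chi n (v x)) (z x)) \<in> borel_measurable M"
    and "(\<lambda>x. poly (pderiv (chi n (v x))) (z x)) \<in> borel_measurable M"
proof -
  \<comment> \<open>The uniform bound \<open>n\<close> makes the range of summation independent of
    the matrix, so only coefficients and the argument vary.\<close>
  have p: "poly q w = (\<Sum>k\<le>n. coeff q k * w ^ k)" if "degree q \<le> n" for q :: "complex poly" and w
    unfolding poly_altdef using that by (intro sum.mono_neutral_left) (auto simp: coeff_eq_0)
  show "(\<lambda>x. poly (chi n (v x)) (z x)) \<in> borel_measurable M"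
    by (subst p, simp) (intro borel_measurable_sum borel_measurable_times borel_measurable_power measurable_coeff_chi assms)
  show "(\<lambda>x. poly (pderiv (chi n (v x))) (z x)) \<in> borel_measurable M"
    by (subst p, simp add: degree_pderiv)
       (unfold coeff_pderiv, intro borel_measurable_sum borel_measurable_times borel_measurable_power measurable_coeff_chi assms borel_measurable_const)
qed

text \<open>The Sylvester matrix of polynomials \<open>g\<close>, \<open>d\<close> of degrees \<open>n + 1\<close> and \<open>n\<close>.\<close>

definition sylv :: "nat \<Rightarrow> complex poly \<Rightarrow> complex poly \<Rightarrow> complex mat"
  where "sylv n g d = Matrix.mat (2 * n + 1) (2 * n + 1)
    (\<lambda>(i, j). coeff (if i < n then monom 1 i * g else monom 1 (i - n) * d) j)"

lemma sylv_carrier [simp]: "sylv n g d \<in> carrier_mat (2 * n + 1) (2 * n + 1)"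
  by (simp add: sylv_def)

lemma sylv_mult_vec:
  assumes "i < 2 * n + 1" "v \<in> carrier_vec (2 * n + 1)"
  shows "vec_index (sylv n g d *\<^sub>v v) i =
    (\<Sum>j<2 * n + 1. coeff (if i < n then monom 1 i * g else monom 1 (i - n) * d) j * vec_index v j)"
  using assms by (simp add: sylv_def scalar_prod_def atLeast0LessThan)

text \<open>The rows hold the coefficients of multiples \<open>X^i g\<close> and
  \<open>X^i d\<close>, so the vector of powers of \<open>z\<close> lies in the kernel; its entry at
  index 0 is 1, hence it is nonzero.\<close>

lemma det_sylv_common_root:
  assumes "degree g = Suc n" "degree d = n" "poly g z = 0" "poly d z = 0"
  shows "Determinant.det (sylv n g d) = 0"
proof -
  define v where "v = Matrix.vec (2 * n + 1) (\<lambda>j. z ^ j)"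
  have v: "v \<in> carrier_vec (2 * n + 1)" by (simp add: v_def)
  have "vec_index v 0 = 1" by (simp add: v_def)
  hence "v \<noteq> 0\<^sub>v (2 * n + 1)" by auto
  moreover have "sylv n g d *\<^sub>v v = 0\<^sub>v (2 * n + 1)"
  proof (rule eq_vecI)
    fix i assume "i < dim_vec (0\<^sub>v (2 * n + 1) :: complex vec)"
    hence i: "i < 2 * n + 1" by simp
    define h where "h = (if i < n then monom 1 i * g else monom 1 (i - n) * d)"
    have "degree h \<le> 2 * n"
    proof (cases "i < n")
      case True
      thus ?thesis using degree_mult_le[of "monom 1 i" g] degree_monom_le[of "1::complex" i] assms
        by (simp add: h_def)
    next
      case False
      thus ?thesis using degree_mult_le[of "monom 1 (i - n)" d] degree_monom_le[of "1::complex" "i - n"] assms i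
        by (simp add: h_def)
    qed
    hence "(\<Sum>j\<le>degree h. coeff h j * z ^ j) = (\<Sum>j<2 * n + 1. coeff h j * z ^ j)"
      by (intro sum.mono_neutral_left) (auto simp: coeff_eq_0)
    moreover have "poly h z = 0" using assms by (simp add: h_def)
    ultimately have "(\<Sum>j<2 * n + 1. coeff h j * z ^ j) = 0" by (simp add: poly_altdef)
    thus "vec_index (sylv n g d *\<^sub>v v) i = vec_index (0\<^sub>v (2 * n + 1)) i"
      using i unfolding sylv_mult_vec[OF i v] h_def[symmetric] by (simp add: v_def)
  qed (simp add: sylv_def)
  ultimately show ?thesis using det_0_iff_vec_prod_zero[OF sylv_carrier] v by blast
qed

text \<open>A kernel vector vanishes from index \<open>n\<close> on, because the rows of the
  multiples of \<open>X^n\<close> are unit vectors. The rows of \<open>g\<close>, read from index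
  \<open>n - 1\<close> downward, then form a triangular system with diagonal entry
  \<open>coeff g 0\<close>.\<close>

lemma det_sylv_monom:
  assumes "coeff g 0 \<noteq> 0"
  shows "Determinant.det (sylv n g (monom 1 n)) \<noteq> 0"
proof
  assume "Determinant.det (sylv n g (monom 1 n)) = 0"
  then obtain v where v: "v \<in> carrier_vec (2 * n + 1)" "v \<noteq> 0\<^sub>v (2 * n + 1)"
    "sylv n g (monom 1 n) *\<^sub>v v = 0\<^sub>v (2 * n + 1)"
    using det_0_iff_vec_prod_zero[OF sylv_carrier] by blast
  have row: "(\<Sum>j<2 * n + 1. coeff (if i < n then monom 1 i * g else monom 1 (i - n) * monom 1 n) j * vec_index v j) = 0"
    if "i < 2 * n + 1" for i
    using sylv_mult_vec[OF that v(1), of g "monom 1 n"] v(3) that by simp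
  have upper: "vec_index v i = 0" if i: "n \<le> i" "i < 2 * n + 1" for i
  proof -
    have "monom 1 (i - n) * monom 1 n = (monom 1 i :: complex poly)" using i by (simp add: mult_monom)
    hence "(\<Sum>j<2 * n + 1. (if j = i then vec_index v j else 0)) = 0"
      using row[OF i(2)] i(1) by (simp add: if_distrib[of "\<lambda>x. x * _"] eq_commute[of i] cong: if_cong)
    hence "(if i \<in> {..<2 * n + 1} then vec_index v i else 0) = 0" by (subst (asm) sum.delta) simp
    thus ?thesis using i by simp
  qed
  have lower: "vec_index v i = 0" if "i < n" for i
    using that
  proof (induction "n - i" arbitrary: i rule: less_induct)
    case less
    have "(\<Sum>j<2 * n + 1. coeff (monom 1 i * g) j * vec_index v j) = (\<Sum>j\<in>{i}. coeff (monom 1 i * g) j * vec_index v j)"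
    proof (rule sum.mono_neutral_right)
      show "\<forall>j\<in>{..<2 * n + 1} - {i}. coeff (monom 1 i * g) j * vec_index v j = 0"
      proof
        fix j assume j: "j \<in> {..<2 * n + 1} - {i}"
        show "coeff (monom 1 i * g) j * vec_index v j = 0"
        proof (cases "j < i")
          case False
          hence "vec_index v j = 0" using j less.hyps[of j] less.prems upper[of j] by (cases "j < n") auto
          thus ?thesis by simp
        qed (simp add: coeff_monom_mult)
      qed
    qed (use less.prems in auto)
    hence "coeff g 0 * vec_index v i = 0" using row[of i] less.prems by (simp add: coeff_monom_mult)
    thus ?case using assms by simp
  qed
  have "v = 0\<^sub>v (2 * n + 1)"
  proof (rule eq_vecI)
    fix i assume "i < dim_vec (0\<^sub>v (2 * n + 1) :: complex vec)"
    thus "vec_index v i = vec_index (0\<^sub>v (2 * n + 1)) i" using upper[of i] lower[of i] by (cases "i < n") auto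
  qed (use v(1) in auto)
  with v(2) show False by simp
qed

text \<open>The Sylvester determinant is a polynomial function of the entries, so a single matrix
  where it does not vanish suffices. For \<open>n > 0\<close> the cyclic shift serves: its leading
  block is nilpotent with characteristic polynomial \<open>X^n\<close>, while the whole matrix is
  invertible.\<close>

lemma AE_coprime_chi:
  "AE x in lebC (sq (Suc n)). \<forall>z. poly (chi n x) z = 0 \<longrightarrow> poly (chi (Suc n) (x((n, n) := 0))) z \<noteq> 0"
proof -
  define f where "f = (\<lambda>x. Determinant.det (sylv n (chi (Suc n) (x((n, n) := 0))) (chi n x)))"
  define x0 :: "nat \<times> nat \<Rightarrow> complex" where "x0 = (\<lambda>(i, j). if j = Suc i mod Suc n then 1 else 0)"
  have "polyfn (sq (Suc n)) f"
    unfolding f_def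
  proof (rule polyfn_det[OF sylv_carrier])
    have g: "polyfn (sq (Suc n)) (\<lambda>x. coeff (chi (Suc n) (x((n, n) := 0))) k)" for k
      by (rule polyfn_compose[OF polyfn_coeff_chi]) (auto intro!: polyfn_if polyfn.const polyfn.proj)
    have d: "polyfn (sq (Suc n)) (\<lambda>x. coeff (chi n x) k)" for k
      by (rule polyfn_compose[OF polyfn_coeff_chi]) (auto intro: polyfn.intros)
    show "polyfn (sq (Suc n)) (\<lambda>x. sylv n (chi (Suc n) (x((n, n) := 0))) (chi n x) $$ (i, j))"
      if "i < 2 * n + 1" "j < 2 * n + 1" for i j
      using that g d by (cases "i < n") (auto simp: sylv_def coeff_monom_mult intro!: polyfn_if polyfn.const)
  qed
  moreover have "f x0 \<noteq> 0"
  proof -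
    have "upper_triangular (Matrix.mat n n x0)" by (auto simp: upper_triangular_def x0_def)
    hence "chi n x0 = (\<Prod>a\<leftarrow>diag_mat (Matrix.mat n n x0). [:- a, 1:])"
      unfolding chi_def by (intro char_poly_upper_triangular[of _ n]) auto
    also have "diag_mat (Matrix.mat n n x0) = map (\<lambda>_. 0) [0..<n]"
      by (auto simp: diag_mat_def x0_def)
    also have "(\<Prod>a\<leftarrow>map (\<lambda>_. 0) [0..<n]. [:- a, 1 :: complex:]) = monom 1 n"
      by (simp add: o_def map_replicate_const prod_list_replicate monom_altdef)
    finally have chi_n: "chi n x0 = monom 1 n" .
    show ?thesis
    proof (cases "n = 0")
      \<comment> \<open>Setting the corner to 0 destroys the shift here, but the second polynomial
        is the constant 1 and the Sylvester matrix is the \<open>1 x 1\<close> matrix 1.\<close>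
      case True
      thus ?thesis using lead_coeff_chi[of 0 x0] by (simp add: f_def sylv_def det_single)
    next
      case False
      hence n: "n > 0" by simp
      define A where "A = Matrix.mat (Suc n) (Suc n) x0"
      have A: "A \<in> carrier_mat (Suc n) (Suc n)" by (simp add: A_def)
      have x0_upd: "x0((n, n) := 0) = x0" using n by (auto simp: x0_def fun_eq_iff)
      have "coeff (chi (Suc n) x0) 0 \<noteq> 0"
      proof
        assume "coeff (chi (Suc n) x0) 0 = 0"
        hence "poly (char_poly A) 0 = 0" by (simp add: poly_0_coeff_0 chi_def A_def)
        hence "eigenvalue A 0" using eigenvalue_root_char_poly[OF A] by blast
        then obtain v where v: "v \<in> carrier_vec (Suc n)" "v \<noteq> 0\<^sub>v (Suc n)" "A *\<^sub>v v = 0 \<cdot>\<^sub>v v"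
          using A by (auto simp: eigenvalue_def eigenvector_def)
        have vz: "vec_index v (Suc i mod Suc n) = 0" if "i < Suc n" for i
        proof -
          have "vec_index (A *\<^sub>v v) i = (\<Sum>j = 0..<Suc n. x0 (i, j) * vec_index v j)"
            using that v(1) A by (simp add: A_def scalar_prod_def)
          also have "\<dots> = (\<Sum>j = 0..<Suc n. if j = Suc i mod Suc n then vec_index v j else 0)"
            by (intro sum.cong) (auto simp: x0_def)
          also have "\<dots> = vec_index v (Suc i mod Suc n)" by (subst sum.delta) auto
          finally show ?thesis using v that by simp
        qed
        have "vec_index v j = 0" if "j < Suc n" for j
          using vz[of "j - 1"] vz[of n] that by (cases j) auto
        hence "v = 0\<^sub>v (Suc n)" using v(1) by (intro eq_vecI) auto
        thus False using v(2) by simp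
      qed
      thus ?thesis unfolding f_def chi_n x0_upd by (rule det_sylv_monom)
    qed
  qed
  ultimately have "AE x in lebC (sq (Suc n)). f x \<noteq> 0" by (intro AE_polyfn_nonzero) auto
  thus ?thesis
    by eventually_elim (use det_sylv_common_root[OF degree_chi degree_chi] in \<open>auto simp: f_def\<close>)
qed

section \<open>Gaussian integrals and bordering\<close>

lemma sets_borel_atMost: "sets (borel :: real measure) = sigma_sets UNIV (range atMost)"
  using arg_cong[OF borel_eq_atMost[where 'a = real], of sets] by (simp only: sets_measure_of Pow_UNIV subset_UNIV)

text \<open>A disc of squared radius \<open>t\<close> has area \<open>pi t\<close>, and half lines
  determine the measure. In terms of the squared modulus the density is constant, so this takes the
  place of polar coordinates.\<close>

lemma distr_cmod_power2:
  "distr lborel borel (\<lambda>z::complex. (cmod z)\<^sup>2) = density lborel (\<lambda>t. ennreal (pi * indicator {0..} t))"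
proof (rule measure_eqI_generator_eq[where E = "range atMost" and A = "\<lambda>i::nat. {..real i}" and \<Omega> = UNIV])
  fix X :: "real set" assume "X \<in> range atMost"
  then obtain t where X: "X = {..t}" by auto
  have "emeasure (distr lborel borel (\<lambda>z::complex. (cmod z)\<^sup>2)) {..t} = emeasure lborel {z::complex. (cmod z)\<^sup>2 \<le> t}"
    by (subst emeasure_distr) (auto intro!: arg_cong[of _ _ "emeasure lborel"])
  also have "\<dots> = ennreal (pi * max 0 t)"
  proof (cases "t \<ge> 0")
    case True
    hence "{z::complex. (cmod z)\<^sup>2 \<le> t} = cball 0 (sqrt t)"
      by (auto simp: real_le_rsqrt) (metis norm_ge_zero power_mono real_sqrt_pow2)
    thus ?thesis using True by (simp add: emeasure_cball unit_ball_vol_2)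
  next
    case False
    hence "{z::complex. (cmod z)\<^sup>2 \<le> t} = {}" by (auto simp: not_le intro: less_le_trans)
    thus ?thesis using False by simp
  qed
  also have "\<dots> = emeasure (density lborel (\<lambda>t. ennreal (pi * indicator {0..} t))) {..t}"
  proof -
    have "emeasure (density lborel (\<lambda>t. ennreal (pi * indicator {0..} t))) {..t} =
       (\<integral>\<^sup>+x. ennreal pi * indicator {0..t} x \<partial>lborel)"
      by (subst emeasure_density) (auto intro!: nn_integral_cong simp: indicator_def)
    thus ?thesis by (simp add: nn_integral_cmult ennreal_mult' max_def)
  qed
  finally show "emeasure (distr lborel borel (\<lambda>z::complex. (cmod z)\<^sup>2)) X =
    emeasure (density lborel (\<lambda>t. ennreal (pi * indicator {0..} t))) X" unfolding X .
next
  show "Int_stable (range atMost :: real set set)"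
  proof (rule Int_stableI)
    fix a b :: "real set" assume "a \<in> range atMost" "b \<in> range atMost"
    then obtain x y where "a = {..x}" "b = {..y}" by auto
    hence "a \<inter> b = {..min x y}" by auto
    thus "a \<inter> b \<in> range atMost" by simp
  qed
  show "range (\<lambda>i. {..real i}) \<subseteq> range atMost" by auto
  show "(\<Union>i. {..real i}) = UNIV" by (auto intro: real_arch_simple)
  show "sets (distr lborel borel (\<lambda>z::complex. (cmod z)\<^sup>2)) = sigma_sets UNIV (range atMost)"
    unfolding sets_distr by (rule sets_borel_atMost)
  show "sets (density lborel (\<lambda>t. ennreal (pi * indicator {0..} t))) = sigma_sets UNIV (range (atMost :: real \<Rightarrow> _))"
    unfolding sets_density sets_lborel by (rule sets_borel_atMost)
  fix i :: nat
  have "emeasure (distr lborel borel (\<lambda>z::complex. (cmod z)\<^sup>2)) {..real i} = emeasure lborel {z::complex. (cmod z)\<^sup>2 \<le> real i}"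
    by (subst emeasure_distr) (auto intro!: arg_cong[of _ _ "emeasure lborel"])
  also have "\<dots> < \<infinity>"
  proof (rule le_less_trans[OF emeasure_mono])
    show "{z::complex. (cmod z)\<^sup>2 \<le> real i} \<subseteq> cball 0 (sqrt i)"
      by (auto simp: real_le_rsqrt)
    show "emeasure lborel (cball (0::complex) (sqrt i)) < \<infinity>" by (simp add: emeasure_cball)
  qed auto
  finally show "emeasure (distr lborel borel (\<lambda>z::complex. (cmod z)\<^sup>2)) {..real i} \<noteq> \<infinity>" by simp
qed auto

lemma nn_integral_radial:
  fixes k :: "real \<Rightarrow> ennreal"
  assumes [measurable]: "k \<in> borel_measurable borel"
  shows "(\<integral>\<^sup>+z. k ((cmod z)\<^sup>2) \<partial>lborel) = ennreal pi * (\<integral>\<^sup>+t. k t * indicator {0..} t \<partial>lborel)"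
proof -
  have "(\<integral>\<^sup>+z. k ((cmod z)\<^sup>2) \<partial>lborel) = (\<integral>\<^sup>+t. k t \<partial>(distr lborel borel (\<lambda>z::complex. (cmod z)\<^sup>2)))"
    by (rule nn_integral_distr[symmetric]) auto
  also have "\<dots> = (\<integral>\<^sup>+t. ennreal pi * (k t * indicator {0..} t) \<partial>lborel)"
    unfolding distr_cmod_power2
    by (subst nn_integral_density) (auto intro!: nn_integral_cong simp: indicator_def)
  also have "\<dots> = ennreal pi * (\<integral>\<^sup>+t. k t * indicator {0..} t \<partial>lborel)"
    by (rule nn_integral_cmult) measurable
  finally show ?thesis .
qed

lemma nn_integral_gauss_moment:
  "(\<integral>\<^sup>+z. ennreal ((cmod z)\<^sup>2 ^ k * exp (- (cmod z)\<^sup>2)) \<partial>lborel) = ennreal (pi * fact k)"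
proof -
  have "(\<integral>\<^sup>+z. ennreal ((cmod z)\<^sup>2 ^ k * exp (- (cmod z)\<^sup>2)) \<partial>lborel)
     = ennreal pi * (\<integral>\<^sup>+t. ennreal (t ^ k * exp (- t)) * indicator {0..} t \<partial>lborel)"
    by (rule nn_integral_radial[of "\<lambda>t. ennreal (t ^ k * exp (- t))"]) auto
  also have "(\<integral>\<^sup>+t. ennreal (t ^ k * exp (- t)) * indicator {0..} t \<partial>lborel) = ennreal (fact k)"
    using nn_intergal_power_times_exp_Ici[of k] by simp
  finally show ?thesis by (simp add: ennreal_mult')
qed

lemma exp_frob: "exp (- frob n x) = (\<Prod>p\<in>sq n. exp (- (cmod (x p))\<^sup>2))"
  unfolding frob_def sum.cartesian_product
  by (simp add: exp_sum[symmetric] sum_negf case_prod_unfold)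

lemma nn_integral_exp_frob:
  "(\<integral>\<^sup>+x. ennreal (exp (- frob n x)) \<partial>lebC (sq n)) = ennreal (pi ^ (n * n))"
proof -
  have "(\<integral>\<^sup>+x. ennreal (exp (- frob n x)) \<partial>lebC (sq n)) = (\<integral>\<^sup>+x. (\<Prod>p\<in>sq n. ennreal (exp (- (cmod (x p))\<^sup>2))) \<partial>lebC (sq n))"
    by (simp add: exp_frob prod_ennreal)
  also have "\<dots> = (\<Prod>p\<in>sq n. \<integral>\<^sup>+z. ennreal (exp (- (cmod z)\<^sup>2)) \<partial>lborel)"
    by (rule lebC.product_nn_integral_prod) auto
  also have "(\<integral>\<^sup>+z. ennreal (exp (- (cmod z)\<^sup>2)) \<partial>lborel) = ennreal pi"
    using nn_integral_gauss_moment[of 0] by simp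
  finally show ?thesis by (simp add: ennreal_power card_cartesian_product)
qed

abbreviation border_measure :: "nat \<Rightarrow> ((nat \<times> nat \<Rightarrow> complex) \<times> (nat \<Rightarrow> complex) \<times> (nat \<Rightarrow> complex) \<times> complex) measure"
  where "border_measure n \<equiv> lebC (sq n) \<Otimes>\<^sub>M (lebC {..<n} \<Otimes>\<^sub>M (lebC {..<n} \<Otimes>\<^sub>M lborel))"

lemma measurable_border_tuple [measurable]:
  "(\<lambda>(D, w, c, a). border n D c w a) \<in> measurable (border_measure n) (lebC (sq (Suc n)))"
  unfolding case_prod_unfold
proof (rule measurable_border)
  show "(\<lambda>x. fst x (i, j)) \<in> borel_measurable (border_measure n)" if "i < n" "j < n" for i j
    by (rule measurable_compose[OF measurable_fst]) (use that in auto)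
  show "(\<lambda>x. fst (snd (snd x)) i) \<in> borel_measurable (border_measure n)" if "i < n" for i
  proof -
    have "(\<lambda>x. fst (snd (snd x))) \<in> measurable (border_measure n) (lebC {..<n})" by measurable
    thus ?thesis by (rule measurable_compose) (use that in auto)
  qed
  show "(\<lambda>x. fst (snd x) j) \<in> borel_measurable (border_measure n)" if "j < n" for j
  proof -
    have "(\<lambda>x. fst (snd x)) \<in> measurable (border_measure n) (lebC {..<n})" by measurable
    thus ?thesis by (rule measurable_compose) (use that in auto)
  qed
qed auto

text \<open>Bordering only relabels coordinates, so preimages of boxes are boxes. The tuple order
  \<open>D, w, c, a\<close> is the later order of integration: the corner is innermost, the column
  next.\<close>

lemma lebC_border:
  "distr (border_measure n) (lebC (sq (Suc n))) (\<lambda>(D, w, c, a). border n D c w a) = lebC (sq (Suc n))"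
proof (rule lebC.PiM_eqI)
  fix E :: "nat \<times> nat \<Rightarrow> complex set"
  assume E: "\<And>i. i \<in> sq (Suc n) \<Longrightarrow> E i \<in> sets lborel"
  define B1 where "B1 = Pi\<^sub>E (sq n) E"
  define B2 where "B2 = Pi\<^sub>E {..<n} (\<lambda>j. E (n, j))"
  define B3 where "B3 = Pi\<^sub>E {..<n} (\<lambda>i. E (i, n))"
  have Eb: "E (i, j) \<in> sets borel" if "i < Suc n" "j < Suc n" for i j using E[of "(i, j)"] that by simp
  have m: "B1 \<in> sets (lebC (sq n))" "B2 \<in> sets (lebC {..<n})" "B3 \<in> sets (lebC {..<n})" "E (n, n) \<in> sets lborel"
    unfolding B1_def B2_def B3_def using E[of "(n, n)"] by (auto intro!: sets_PiM_I_finite E)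
  have pre: "(\<lambda>(D, w, c, a). border n D c w a) -` Pi\<^sub>E (sq (Suc n)) E \<inter> space (border_measure n)
      = B1 \<times> (B2 \<times> (B3 \<times> E (n, n)))"
  proof (rule subset_antisym; rule subsetI)
    fix p assume p: "p \<in> (\<lambda>(D, w, c, a). border n D c w a) -` Pi\<^sub>E (sq (Suc n)) E \<inter> space (border_measure n)"
    obtain D w c a where p_eq: "p = (D, w, c, a)" by (metis prod_cases4)
    have h: "border n D c w a \<in> Pi\<^sub>E (sq (Suc n)) E" and sp: "(D, w, c, a) \<in> space (border_measure n)"
      using p by (simp_all only: p_eq vimage_eq Int_iff prod.case)
    have b: "border n D c w a (i, j) \<in> E (i, j)" if "i < Suc n" "j < Suc n" for i j
      using h that by (auto simp: PiE_def)
    have ext: "D \<in> extensional (sq n)" "w \<in> extensional {..<n}" "c \<in> extensional {..<n}"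
      using sp by (auto simp: space_pair_measure space_PiM PiE_def)
    have "D (i, j) \<in> E (i, j)" if "i < n" "j < n" for i j
      using b[of i j] that by (simp add: border_def)
    hence B1: "D \<in> B1" using ext by (auto simp: B1_def PiE_def)
    have "w j \<in> E (n, j)" if "j < n" for j using b[of n j] that by (simp add: border_def)
    hence B2: "w \<in> B2" using ext by (auto simp: B2_def PiE_def)
    have "c i \<in> E (i, n)" if "i < n" for i using b[of i n] that by (simp add: border_def)
    hence B3: "c \<in> B3" using ext by (auto simp: B3_def PiE_def)
    have "a \<in> E (n, n)" using b[of n n] by (simp add: border_def)
    thus "p \<in> B1 \<times> (B2 \<times> (B3 \<times> E (n, n)))" using B1 B2 B3 by (simp add: p_eq)
  next
    fix p assume p: "p \<in> B1 \<times> (B2 \<times> (B3 \<times> E (n, n)))"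
    obtain D w c a where p_eq: "p = (D, w, c, a)" by (metis prod_cases4)
    have h: "D \<in> B1" "w \<in> B2" "c \<in> B3" "a \<in> E (n, n)" using p by (simp_all add: p_eq)
    have "border n D c w a \<in> Pi\<^sub>E (sq (Suc n)) E"
      using h by (auto simp: B1_def B2_def B3_def border_def PiE_def Pi_def extensional_def less_Suc_eq)
    moreover have "(D, w, c, a) \<in> space (border_measure n)"
      using h by (auto simp: B1_def B2_def B3_def space_pair_measure space_PiM PiE_def)
    ultimately show "p \<in> (\<lambda>(D, w, c, a). border n D c w a) -` Pi\<^sub>E (sq (Suc n)) E \<inter> space (border_measure n)"
      by (simp only: p_eq vimage_eq Int_iff prod.case)
  qed
  interpret P1: sigma_finite_measure "lebC {..<n} :: (nat \<Rightarrow> complex) measure" by (rule sigma_finite_lebC) simp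
  interpret P0: pair_sigma_finite "lebC {..<n} :: (nat \<Rightarrow> complex) measure" "lborel :: complex measure" ..
  interpret P2: pair_sigma_finite "lebC {..<n} :: (nat \<Rightarrow> complex) measure" "lebC {..<n} \<Otimes>\<^sub>M (lborel :: complex measure)" ..
  have "emeasure (distr (border_measure n) (lebC (sq (Suc n))) (\<lambda>(D, w, c, a). border n D c w a)) (Pi\<^sub>E (sq (Suc n)) E)
     = emeasure (border_measure n) (B1 \<times> (B2 \<times> (B3 \<times> E (n, n))))"
  proof -
    have "Pi\<^sub>E (sq (Suc n)) E \<in> sets (lebC (sq (Suc n)))" by (rule sets_PiM_I_finite) (use E in auto)
    thus ?thesis by (simp only: emeasure_distr[OF measurable_border_tuple] pre)
  qed
  also have "\<dots> = emeasure (lebC (sq n)) B1 * (emeasure (lebC {..<n}) B2 * (emeasure (lebC {..<n}) B3 * emeasure lborel (E (n, n))))"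
    using m by (simp add: P2.P.emeasure_pair_measure_Times P0.P.emeasure_pair_measure_Times lborel.emeasure_pair_measure_Times pair_measureI
      P2.emeasure_pair_measure_Times)
  also have "\<dots> = (\<Prod>p\<in>sq n. emeasure lborel (E p)) * ((\<Prod>j<n. emeasure lborel (E (n, j))) * ((\<Prod>i<n. emeasure lborel (E (i, n))) * emeasure lborel (E (n, n))))"
    unfolding B1_def B2_def B3_def by (subst (1 2 3) lebC.emeasure_PiM) (auto intro!: Eb)
  also have "\<dots> = (\<Prod>p\<in>sq (Suc n). emeasure lborel (E p))"
    unfolding prod.cartesian_product'
    by (simp add: prod.distrib mult_ac flip: prod.cartesian_product)
  finally show "emeasure (distr (border_measure n) (lebC (sq (Suc n))) (\<lambda>(D, w, c, a). border n D c w a)) (Pi\<^sub>E (sq (Suc n)) E)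
    = (\<Prod>i\<in>sq (Suc n). emeasure lborel (E i))" .
qed auto

section \<open>The recursion for eigenvalue functionals\<close>

text \<open>The modulus attains its minimum on the compact closed ball, and the open ball is dense
  in it; so a root exists exactly when the values on a dense set come arbitrarily close to 0. For
  countable \<open>D\<close> this is a countable condition on evaluations.\<close>

lemma poly_root_in_cball_iff:
  fixes p :: "complex poly"
  assumes r: "r > 0" and D: "\<And>X. open X \<Longrightarrow> X \<noteq> {} \<Longrightarrow> \<exists>d\<in>D. d \<in> X"
  shows "(\<exists>z\<in>cball c r. poly p z = 0) \<longleftrightarrow> (\<forall>k::nat. \<exists>d\<in>D. d \<in> ball c r \<and> cmod (poly p d) < 1 / real (Suc k))"
proof
  assume "\<exists>z\<in>cball c r. poly p z = 0"
  then obtain z where z: "z \<in> cball c r" "poly p z = 0" by auto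
  show "\<forall>k::nat. \<exists>d\<in>D. d \<in> ball c r \<and> cmod (poly p d) < 1 / real (Suc k)"
  proof
    fix k :: nat
    define W where "W = {w. cmod (poly p w) < 1 / real (Suc k)}"
    have "open W" unfolding W_def by (intro open_Collect_less continuous_intros)
    moreover have "z \<in> W" using z by (simp add: W_def)
    moreover have "z \<in> closure (ball c r)" using z r by simp
    ultimately have "W \<inter> ball c r \<noteq> {}" by (meson closure_iff_nhds_not_empty open_Int_closure_eq_empty disjoint_iff)
    moreover have "open (W \<inter> ball c r)" using \<open>open W\<close> by auto
    ultimately obtain d where "d \<in> D" "d \<in> W \<inter> ball c r" using D by blast
    thus "\<exists>d\<in>D. d \<in> ball c r \<and> cmod (poly p d) < 1 / real (Suc k)" by (auto simp: W_def)
  qed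
next
  assume h: "\<forall>k::nat. \<exists>d\<in>D. d \<in> ball c r \<and> cmod (poly p d) < 1 / real (Suc k)"
  have "compact (cball c r)" "cball c r \<noteq> {}" using r by auto
  moreover have "continuous_on (cball c r) (\<lambda>z. cmod (poly p z))" by (intro continuous_intros)
  ultimately obtain z where z: "z \<in> cball c r" "\<And>y. y \<in> cball c r \<Longrightarrow> cmod (poly p z) \<le> cmod (poly p y)"
    using continuous_attains_inf by metis
  have "cmod (poly p z) < 1 / real (Suc k)" for k
  proof -
    obtain d where "d \<in> ball c r" "cmod (poly p d) < 1 / real (Suc k)" using h by blast
    thus ?thesis using z(2)[of d] by auto
  qed
  hence "\<not> cmod (poly p z) > 0" by (metis nat_approx_posE less_asym)
  thus "\<exists>z\<in>cball c r. poly p z = 0" using z(1) by auto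
qed

text \<open>The open complement of \<open>U\<close> is a countable union of closed balls with
  centres in a dense set and radii \<open>1 / Suc m\<close>; having a root in such a ball is
  measurable by \<open>poly_root_in_cball_iff\<close>.\<close>

lemma measurable_spectrum_subset:
  fixes U :: "complex set"
  assumes U: "closed U" and v: "\<And>i j. i < n \<Longrightarrow> j < n \<Longrightarrow> (\<lambda>x. v x (i, j)) \<in> borel_measurable M"
  shows "Measurable.pred M (\<lambda>x. \<forall>z. poly (chi n (v x)) z = 0 \<longrightarrow> z \<in> U)"
proof -
  obtain D :: "complex set" where D: "countable D" "\<And>X. open X \<Longrightarrow> X \<noteq> {} \<Longrightarrow> \<exists>d\<in>D. d \<in> X"
    using countable_dense_setE by metis
  define P where "P = (\<lambda>q (m::nat). cball q (1 / real (Suc m)) \<subseteq> - U)"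
  have cover: "(\<exists>z. Q z \<and> z \<notin> U) \<longleftrightarrow> (\<exists>q\<in>D. \<exists>m. P q m \<and> (\<exists>z\<in>cball q (1 / real (Suc m)). Q z))" for Q
  proof
    assume "\<exists>z. Q z \<and> z \<notin> U"
    then obtain z where z: "Q z" "z \<in> - U" by auto
    then obtain e where e: "e > 0" "ball z e \<subseteq> - U" using U open_contains_ball[of "- U"] by auto
    obtain m where m: "1 / real (Suc m) < e / 2" using e(1) nat_approx_posE[of "e / 2"] by auto
    obtain q where q: "q \<in> D" "q \<in> ball z (1 / real (Suc m))" using D(2)[of "ball z (1 / real (Suc m))"] by auto
    have "cball q (1 / real (Suc m)) \<subseteq> ball z e"
    proof
      fix y assume "y \<in> cball q (1 / real (Suc m))"
      hence "dist z y < 1 / real (Suc m) + 1 / real (Suc m)"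
        using q(2) dist_triangle[of z y q] by (simp add: mem_ball mem_cball del: of_nat_Suc)
      thus "y \<in> ball z e" using m by simp
    qed
    hence "P q m" using e(2) by (auto simp: P_def)
    moreover have "z \<in> cball q (1 / real (Suc m))" using q(2) by (simp add: dist_commute del: of_nat_Suc)
    ultimately show "\<exists>q\<in>D. \<exists>m. P q m \<and> (\<exists>z\<in>cball q (1 / real (Suc m)). Q z)" using q(1) z(1) by blast
  qed (auto simp: P_def)
  have eq: "(\<forall>z. poly (chi n (v x)) z = 0 \<longrightarrow> z \<in> U) \<longleftrightarrow>
     \<not> (\<exists>q\<in>D. \<exists>m. P q m \<and> (\<forall>k::nat. \<exists>d\<in>D. d \<in> ball q (1 / real (Suc m)) \<and> cmod (poly (chi n (v x)) d) < 1 / real (Suc k)))" for x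
  proof -
    have "(\<forall>z. poly (chi n (v x)) z = 0 \<longrightarrow> z \<in> U) \<longleftrightarrow>
      \<not> (\<exists>q\<in>D. \<exists>m. P q m \<and> (\<exists>z\<in>cball q (1 / real (Suc m)). poly (chi n (v x)) z = 0))"
      using cover[of "\<lambda>z. poly (chi n (v x)) z = 0"] by blast
    also have "\<dots> \<longleftrightarrow> \<not> (\<exists>q\<in>D. \<exists>m. P q m \<and> (\<forall>k::nat. \<exists>d\<in>D. d \<in> ball q (1 / real (Suc m)) \<and> cmod (poly (chi n (v x)) d) < 1 / real (Suc k)))"
    proof -
      have "(\<exists>z\<in>cball q (1 / real (Suc m)). poly (chi n (v x)) z = 0) \<longleftrightarrow>
        (\<forall>k::nat. \<exists>d\<in>D. d \<in> ball q (1 / real (Suc m)) \<and> cmod (poly (chi n (v x)) d) < 1 / real (Suc k))" for q m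
        by (rule poly_root_in_cball_iff[OF _ D(2)]) simp_all
      thus ?thesis by (simp only:)
    qed
    finally show ?thesis .
  qed
  have m[measurable]: "Measurable.pred M (\<lambda>x. cmod (poly (chi n (v x)) d) < 1 / real (Suc k))" for d and k :: nat
  proof -
    have "(\<lambda>x. poly (chi n (v x)) d) \<in> borel_measurable M" by (rule measurable_poly_chi(1)) (use v in auto)
    thus ?thesis by measurable
  qed
  have "D \<noteq> {}" using D(2)[of UNIV] by auto
  then obtain e :: "nat \<Rightarrow> complex" where e: "D = range e" using D(1) by (metis range_from_nat_into)
  show ?thesis unfolding eq unfolding e bex_simps by measurable
qed

section \<open>Weighted spectral integrals and their recursion\<close>

text \<open>The list \<open>ws\<close> holds the eigenvalues already split off. Each factor is
  \<open>|det (w - x)|^2\<close>, the product of the squared distances from \<open>w\<close> to the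
  remaining eigenvalues.\<close>

definition spec_weight :: "complex set \<Rightarrow> nat \<Rightarrow> complex list \<Rightarrow> (nat \<times> nat \<Rightarrow> complex) \<Rightarrow> real"
  where "spec_weight U n ws x =
    (\<Prod>w\<leftarrow>ws. (cmod (poly (chi n x) w))\<^sup>2) * (if \<forall>z. poly (chi n x) z = 0 \<longrightarrow> z \<in> U then 1 else 0)"

definition spec_integral :: "complex set \<Rightarrow> nat \<Rightarrow> complex list \<Rightarrow> ennreal"
  where "spec_integral U n ws = (\<integral>\<^sup>+x. ennreal (spec_weight U n ws x) * ennreal (exp (- frob n x)) \<partial>lebC (sq n))"

lemma spec_weight_nonneg: "spec_weight U n ws x \<ge> 0"
  by (auto simp: spec_weight_def intro!: prod_list_nonneg)

lemma spec_weight_Cons: "spec_weight U n (z # ws) x = (cmod (poly (chi n x) z))\<^sup>2 * spec_weight U n ws x"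
  by (simp add: spec_weight_def)

lemma spec_weight_cong: "chi n x = chi n y \<Longrightarrow> spec_weight U n ws x = spec_weight U n ws y"
  by (simp add: spec_weight_def)

lemma measurable_spec_weight:
  assumes U: "closed U" and v: "\<And>i j. i < n \<Longrightarrow> j < n \<Longrightarrow> (\<lambda>x. v x (i, j)) \<in> borel_measurable M"
  shows "(\<lambda>x. spec_weight U n ws (v x)) \<in> borel_measurable M"
proof (induction ws)
  case Nil
  have [measurable]: "Measurable.pred M (\<lambda>x. \<forall>z. poly (chi n (v x)) z = 0 \<longrightarrow> z \<in> U)"
    by (rule measurable_spectrum_subset[OF U]) (rule v)
  show ?case unfolding spec_weight_def by simp
next
  case (Cons w ws)
  have "(\<lambda>x. poly (chi n (v x)) w) \<in> borel_measurable M" by (rule measurable_poly_chi(1)) (use v in auto)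
  with Cons show ?case unfolding spec_weight_Cons by measurable
qed

text \<open>Deflation splits \<open>|w - z|^2\<close> off every factor. The Jacobian factor at
  \<open>z\<close> becomes the head of the new list, so the weight keeps its form.\<close>

lemma spec_weight_border:
  assumes "chi (Suc n) x = [:- z, 1:] * chi n y"
  shows "(cmod (poly (chi n y) z))\<^sup>2 * spec_weight U (Suc n) ws x =
    (if z \<in> U then 1 else 0) * (\<Prod>w\<leftarrow>ws. (cmod (w - z))\<^sup>2) * spec_weight U n (z # ws) y"
proof -
  have p: "poly (chi (Suc n) x) w = (w - z) * poly (chi n y) w" for w
    unfolding assms by (simp add: algebra_simps)
  have "(\<Prod>w\<leftarrow>ws. (cmod (poly (chi (Suc n) x) w))\<^sup>2) = (\<Prod>w\<leftarrow>ws. (cmod (w - z))\<^sup>2) * (\<Prod>w\<leftarrow>ws. (cmod (poly (chi n y) w))\<^sup>2)"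
    unfolding p by (induction ws) (simp_all add: norm_mult power_mult_distrib)
  moreover have "(\<forall>w. poly (chi (Suc n) x) w = 0 \<longrightarrow> w \<in> U) \<longleftrightarrow> z \<in> U \<and> (\<forall>w. poly (chi n y) w = 0 \<longrightarrow> w \<in> U)"
    unfolding p by auto
  moreover define P Q where "P \<longleftrightarrow> (\<forall>w. poly (chi (Suc n) x) w = 0 \<longrightarrow> w \<in> U)"
    and "Q \<longleftrightarrow> (\<forall>w. poly (chi n y) w = 0 \<longrightarrow> w \<in> U)"
  ultimately show ?thesis
    unfolding spec_weight_def P_def[symmetric] Q_def[symmetric] by simp
qed

text \<open>The substitutions leave \<open>z\<close> and \<open>u\<close> innermost, whereas
  \<open>deflated_integral\<close> needs them fixed and integrates over the matrix first, then over
  the row. This is why the pair \<open>a\<close>, \<open>b\<close> comes out reversed.\<close>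

lemma nn_integral_swap4:
  fixes f :: "'a \<Rightarrow> 'b \<Rightarrow> 'c \<Rightarrow> 'd \<Rightarrow> ennreal"
  assumes A: "sigma_finite_measure A" and B: "sigma_finite_measure B"
    and C: "sigma_finite_measure C" and E: "sigma_finite_measure E"
    and f: "(\<lambda>((a, b), (c, e)). f a b c e) \<in> borel_measurable ((A \<Otimes>\<^sub>M B) \<Otimes>\<^sub>M (C \<Otimes>\<^sub>M E))"
  shows "(\<integral>\<^sup>+a. \<integral>\<^sup>+b. \<integral>\<^sup>+c. \<integral>\<^sup>+e. f a b c e \<partial>E \<partial>C \<partial>B \<partial>A) = (\<integral>\<^sup>+c. \<integral>\<^sup>+e. \<integral>\<^sup>+b. \<integral>\<^sup>+a. f a b c e \<partial>A \<partial>B \<partial>E \<partial>C)"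
proof -
  interpret A: sigma_finite_measure A by fact
  interpret B: sigma_finite_measure B by fact
  interpret C: sigma_finite_measure C by fact
  interpret E: sigma_finite_measure E by fact
  interpret AB: pair_sigma_finite A B ..
  interpret CE: pair_sigma_finite C E ..
  interpret P: pair_sigma_finite "A \<Otimes>\<^sub>M B" "C \<Otimes>\<^sub>M E" ..
  define F where "F = (\<lambda>p q. f (fst p) (snd p) (fst q) (snd q))"
  have F: "(\<lambda>(p, q). F p q) \<in> borel_measurable ((A \<Otimes>\<^sub>M B) \<Otimes>\<^sub>M (C \<Otimes>\<^sub>M E))"
    using f by (simp add: F_def case_prod_unfold)
  have F1: "(\<lambda>q. F p q) \<in> borel_measurable (C \<Otimes>\<^sub>M E)" if "p \<in> space (A \<Otimes>\<^sub>M B)" for p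
    using measurable_compose[OF measurable_Pair1'[OF that] F] by simp
  have F2: "(\<lambda>p. F p q) \<in> borel_measurable (A \<Otimes>\<^sub>M B)" if "q \<in> space (C \<Otimes>\<^sub>M E)" for q
    using measurable_compose[OF measurable_Pair2'[OF that] F] by simp
  have "(\<integral>\<^sup>+a. \<integral>\<^sup>+b. \<integral>\<^sup>+c. \<integral>\<^sup>+e. f a b c e \<partial>E \<partial>C \<partial>B \<partial>A) = (\<integral>\<^sup>+a. \<integral>\<^sup>+b. (\<integral>\<^sup>+q. F (a, b) q \<partial>(C \<Otimes>\<^sub>M E)) \<partial>B \<partial>A)"
  proof (intro nn_integral_cong)
    fix a b assume "a \<in> space A" "b \<in> space B"
    hence "(a, b) \<in> space (A \<Otimes>\<^sub>M B)" by (simp add: space_pair_measure)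
    from E.nn_integral_fst[OF F1[OF this]]
    show "(\<integral>\<^sup>+c. \<integral>\<^sup>+e. f a b c e \<partial>E \<partial>C) = (\<integral>\<^sup>+q. F (a, b) q \<partial>(C \<Otimes>\<^sub>M E))" by (simp add: F_def)
  qed
  also have "\<dots> = (\<integral>\<^sup>+p. (\<integral>\<^sup>+q. F p q \<partial>(C \<Otimes>\<^sub>M E)) \<partial>(A \<Otimes>\<^sub>M B))"
    by (rule B.nn_integral_fst) (rule sigma_finite_measure.borel_measurable_nn_integral[OF CE.sigma_finite_measure_axioms F])
  also have "\<dots> = (\<integral>\<^sup>+q. (\<integral>\<^sup>+p. F p q \<partial>(A \<Otimes>\<^sub>M B)) \<partial>(C \<Otimes>\<^sub>M E))"
    by (rule P.Fubini'[OF F, symmetric])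
  also have "\<dots> = (\<integral>\<^sup>+c. \<integral>\<^sup>+e. (\<integral>\<^sup>+p. F p (c, e) \<partial>(A \<Otimes>\<^sub>M B)) \<partial>E \<partial>C)"
  proof (rule E.nn_integral_fst[symmetric])
    have "(\<lambda>(q, p). F p q) \<in> borel_measurable ((C \<Otimes>\<^sub>M E) \<Otimes>\<^sub>M (A \<Otimes>\<^sub>M B))"
      using measurable_pair_swap[OF F] by (simp add: case_prod_unfold)
    thus "(\<lambda>q. \<integral>\<^sup>+p. F p q \<partial>(A \<Otimes>\<^sub>M B)) \<in> borel_measurable (C \<Otimes>\<^sub>M E)"
      by (rule sigma_finite_measure.borel_measurable_nn_integral[OF AB.sigma_finite_measure_axioms])
  qed
  also have "\<dots> = (\<integral>\<^sup>+c. \<integral>\<^sup>+e. \<integral>\<^sup>+b. \<integral>\<^sup>+a. f a b c e \<partial>A \<partial>B \<partial>E \<partial>C)"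
  proof (intro nn_integral_cong)
    fix c e assume "c \<in> space C" "e \<in> space E"
    hence "(c, e) \<in> space (C \<Otimes>\<^sub>M E)" by (simp add: space_pair_measure)
    from AB.nn_integral_snd[OF F2[OF this]]
    show "(\<integral>\<^sup>+p. F p (c, e) \<partial>(A \<Otimes>\<^sub>M B)) = (\<integral>\<^sup>+b. \<integral>\<^sup>+a. f a b c e \<partial>A \<partial>B)" by (simp add: F_def)
  qed
  finally show ?thesis .
qed

lemma nn_integral_border:
  assumes F[measurable]: "F \<in> borel_measurable (lebC (sq (Suc n)))"
  shows "(\<integral>\<^sup>+x. F x \<partial>lebC (sq (Suc n))) =
    (\<integral>\<^sup>+D. \<integral>\<^sup>+w. \<integral>\<^sup>+c. \<integral>\<^sup>+a. F (border n D c w a) \<partial>lborel \<partial>lebC {..<n} \<partial>lebC {..<n} \<partial>lebC (sq n))"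
proof -
  interpret V: sigma_finite_measure "lebC {..<n} :: (nat \<Rightarrow> complex) measure" by (rule sigma_finite_lebC) simp
  interpret V1: pair_sigma_finite "lebC {..<n} :: (nat \<Rightarrow> complex) measure" "lborel :: complex measure" ..
  interpret V2: pair_sigma_finite "lebC {..<n} :: (nat \<Rightarrow> complex) measure" "lebC {..<n} \<Otimes>\<^sub>M (lborel :: complex measure)" ..
  note nn3 = sigma_finite_measure.nn_integral_fst[OF V2.sigma_finite_measure_axioms]
  note nn2 = sigma_finite_measure.nn_integral_fst[OF V1.sigma_finite_measure_axioms]
  define F' where "F' = (\<lambda>(D, w, c, a). F (border n D c w a))"
  have F'[measurable]: "F' \<in> borel_measurable (border_measure n)"
    using measurable_compose[OF measurable_border_tuple F] by (simp add: F'_def case_prod_unfold)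
  have "(\<integral>\<^sup>+x. F x \<partial>lebC (sq (Suc n))) = (\<integral>\<^sup>+p. F' p \<partial>border_measure n)"
    using nn_integral_distr[OF measurable_border_tuple[of n], of F] F unfolding lebC_border
    by (simp add: F'_def case_prod_unfold)
  also have "\<dots> = (\<integral>\<^sup>+D. \<integral>\<^sup>+q. F' (D, q) \<partial>(lebC {..<n} \<Otimes>\<^sub>M (lebC {..<n} \<Otimes>\<^sub>M lborel)) \<partial>lebC (sq n))"
    by (rule nn3[symmetric]) measurable
  also have "\<dots> = (\<integral>\<^sup>+D. \<integral>\<^sup>+w. \<integral>\<^sup>+q. F' (D, w, q) \<partial>(lebC {..<n} \<Otimes>\<^sub>M lborel) \<partial>lebC {..<n} \<partial>lebC (sq n))"
  proof (intro nn_integral_cong nn2[symmetric])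
    fix D assume "D \<in> space (lebC (sq n))"
    from measurable_compose[OF measurable_Pair1'[OF this] F']
    show "(\<lambda>q. F' (D, q)) \<in> borel_measurable (lebC {..<n} \<Otimes>\<^sub>M (lebC {..<n} \<Otimes>\<^sub>M lborel))" .
  qed
  also have "\<dots> = (\<integral>\<^sup>+D. \<integral>\<^sup>+w. \<integral>\<^sup>+c. \<integral>\<^sup>+a. F' (D, w, c, a) \<partial>lborel \<partial>lebC {..<n} \<partial>lebC {..<n} \<partial>lebC (sq n))"
  proof (intro nn_integral_cong lborel.nn_integral_fst[symmetric])
    fix D w assume D: "D \<in> space (lebC (sq n))" and w: "w \<in> space (lebC {..<n})"
    from measurable_compose[OF measurable_Pair1'[OF w] measurable_compose[OF measurable_Pair1'[OF D] F']]
    show "(\<lambda>q. F' (D, w, q)) \<in> borel_measurable (lebC {..<n} \<Otimes>\<^sub>M lborel)" .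
  qed
  finally show ?thesis by (simp add: F'_def)
qed

lemma AE_coprime_border:
  "AE D in lebC (sq n). AE w in lebC {..<n}. AE c in lebC {..<n}.
     \<forall>z. poly (chi n D) z = 0 \<longrightarrow> poly (chi (Suc n) (border n D c w 0)) z \<noteq> 0"
proof -
  interpret V: sigma_finite_measure "lebC {..<n} :: (nat \<Rightarrow> complex) measure" by (rule sigma_finite_lebC) simp
  interpret S: sigma_finite_measure "lebC (sq n) :: (nat \<times> nat \<Rightarrow> complex) measure" by (rule sigma_finite_lebC) simp
  interpret V1: pair_sigma_finite "lebC {..<n} :: (nat \<Rightarrow> complex) measure" "lborel :: complex measure" ..
  interpret V2: pair_sigma_finite "lebC {..<n} :: (nat \<Rightarrow> complex) measure" "lebC {..<n} \<Otimes>\<^sub>M (lborel :: complex measure)" ..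
  interpret V3: pair_sigma_finite "lebC (sq n) :: (nat \<times> nat \<Rightarrow> complex) measure"
    "lebC {..<n} \<Otimes>\<^sub>M (lebC {..<n} \<Otimes>\<^sub>M (lborel :: complex measure))" ..
  define Q where "Q = (\<lambda>x. \<forall>z. poly (chi n x) z = 0 \<longrightarrow> poly (chi (Suc n) (x((n, n) := 0))) z \<noteq> 0)"
  have "AE x in distr (border_measure n) (lebC (sq (Suc n))) (\<lambda>(D, w, c, a). border n D c w a). Q x"
    unfolding lebC_border Q_def by (rule AE_coprime_chi)
  from AE_distrD[OF measurable_border_tuple this]
  have "AE p in border_measure n. Q (case p of (D, w, c, a) \<Rightarrow> border n D c w a)" .
  from V3.AE_pair[OF this]
  have "AE D in lebC (sq n). AE q in (lebC {..<n} \<Otimes>\<^sub>M (lebC {..<n} \<Otimes>\<^sub>M lborel)). Q (case (D, q) of (D, w, c, a) \<Rightarrow> border n D c w a)" .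
  thus ?thesis
  proof eventually_elim
    case (elim D)
    from V2.AE_pair[OF elim] show ?case
    proof eventually_elim
      case (elim w)
      from V1.AE_pair[OF elim] show ?case
      proof eventually_elim
        case (elim c)
        have "chi n (border n D c w a) = chi n D" for a by (rule chi_cong) (simp add: border_def)
        moreover have "chi (Suc n) ((border n D c w a)((n, n) := 0)) = chi (Suc n) (border n D c w 0)" for a
          by (rule chi_cong) (auto simp: border_def)
        moreover have "ae_filter (lborel :: complex measure) \<noteq> bot"
          by (simp add: ae_filter_eq_bot_iff)
        ultimately show ?case using elim by (simp add: Q_def eventually_const_iff)
      qed
    qed
  qed
qed

text \<open>Trading the corner for an eigenvalue counts each matrix once for every one of its
  \<open>n + 1\<close> eigenvalues, whence \<open>Suc n\<close>. Trading the column for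
  \<open>u\<close> then allows \<open>deflated_integral\<close> to remove the border;
  \<open>K\<close> is the integral of its factor over \<open>u\<close>, and so serves all
  \<open>U\<close> and \<open>ws\<close> at once.\<close>

lemma spec_integral_recursion:
  "\<exists>K::ennreal. \<forall>U ws. closed U \<longrightarrow> ennreal (Suc n) * spec_integral U (Suc n) ws =
     K * (\<integral>\<^sup>+z. ennreal ((if z \<in> U then 1 else 0) * (\<Prod>w\<leftarrow>ws. (cmod (w - z))\<^sup>2) * exp (- (cmod z)\<^sup>2))
            * spec_integral U n (z # ws) \<partial>lborel)"
proof -
  interpret V: sigma_finite_measure "lebC {..<n} :: (nat \<Rightarrow> complex) measure" by (rule sigma_finite_lebC) simp
  interpret S: sigma_finite_measure "lebC (sq n) :: (nat \<times> nat \<Rightarrow> complex) measure" by (rule sigma_finite_lebC) simp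
  let ?rk = "\<lambda>u w D. (\<lambda>(i, j)\<in>sq n. D (i, j) - u i * w j) :: nat \<times> nat \<Rightarrow> complex"
  define P where "P = (\<lambda>u (k::ennreal). \<forall>z H. H \<in> borel_measurable (lebC (sq n)) \<longrightarrow>
     (\<forall>x y. chi n x = chi n y \<longrightarrow> H x = H y) \<longrightarrow>
     (\<integral>\<^sup>+w. \<integral>\<^sup>+D. H (?rk u w D) * ennreal (deflation_weight n z u w D) \<partial>lebC (sq n) \<partial>lebC {..<n})
     = ennreal (exp (- (cmod z)\<^sup>2)) * k * (\<integral>\<^sup>+x. H x * ennreal (exp (- frob n x)) \<partial>lebC (sq n)))"
  have P_ex: "\<exists>k. P u k" for u unfolding P_def by (rule deflated_integral)
  define \<kappa> where "\<kappa> = (\<lambda>u. SOME k. P u k)"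
  have "P u (\<kappa> u)" for u unfolding \<kappa>_def by (rule someI_ex[OF P_ex])
  hence \<kappa>: "(\<integral>\<^sup>+w. \<integral>\<^sup>+D. H (?rk u w D) * ennreal (deflation_weight n z u w D) \<partial>lebC (sq n) \<partial>lebC {..<n})
     = ennreal (exp (- (cmod z)\<^sup>2)) * \<kappa> u * (\<integral>\<^sup>+x. H x * ennreal (exp (- frob n x)) \<partial>lebC (sq n))"
    if "H \<in> borel_measurable (lebC (sq n))" "\<forall>x y. chi n x = chi n y \<longrightarrow> H x = H y" for u z H
    using that unfolding P_def by blast
  have dm: "(\<lambda>p. deflation_weight n (z p) (u p) (w p) (D p)) \<in> borel_measurable M"
    if "\<And>i j. i < n \<Longrightarrow> j < n \<Longrightarrow> (\<lambda>p. D p (i, j)) \<in> borel_measurable M"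
      "\<And>i. i < n \<Longrightarrow> (\<lambda>p. u p i) \<in> borel_measurable M" "\<And>i. i < n \<Longrightarrow> (\<lambda>p. w p i) \<in> borel_measurable M"
      "z \<in> borel_measurable M" for z u w D and M :: "'z measure"
  proof -
    have "(\<lambda>p. border n (D p) (\<lambda>i. z p * u p i - (\<Sum>j<n. D p (i, j) * u p j)) (w p) (z p - (\<Sum>j<n. w p j * u p j)))
        \<in> measurable M (lebC (sq (Suc n)))"
      by (rule measurable_border) (use that in \<open>auto intro!: borel_measurable_diff borel_measurable_times borel_measurable_sum\<close>)
    from measurable_compose[OF this measurable_frob]
    show ?thesis unfolding deflation_weight_def by measurable
  qed
  \<comment> \<open>\<open>\<kappa>\<close> comes from a choice, so its measurability is not
    evident. Testing it with \<open>H = 1\<close> and \<open>z = 0\<close> writes it as an explicit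
    integral divided by the total Gaussian mass.\<close>
  define Kap where "Kap = (\<lambda>u. \<integral>\<^sup>+w. \<integral>\<^sup>+D. ennreal (deflation_weight n 0 u w D) \<partial>lebC (sq n) \<partial>lebC {..<n})"
  have Kap: "Kap \<in> borel_measurable (lebC {..<n})"
  proof -
    have "(\<lambda>((u, w), D). ennreal (deflation_weight n 0 u w D)) \<in> borel_measurable ((lebC {..<n} \<Otimes>\<^sub>M lebC {..<n}) \<Otimes>\<^sub>M lebC (sq n))"
      unfolding case_prod_unfold
    proof (intro measurable_compose[OF dm measurable_ennreal])
      show "(\<lambda>p. snd p (i, j)) \<in> borel_measurable ((lebC {..<n} \<Otimes>\<^sub>M lebC {..<n}) \<Otimes>\<^sub>M lebC (sq n))" if "i < n" "j < n" for i j
        by (rule measurable_compose[OF measurable_snd]) (use that in auto)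
      have "(\<lambda>p. fst (fst p)) \<in> measurable ((lebC {..<n} \<Otimes>\<^sub>M lebC {..<n}) \<Otimes>\<^sub>M lebC (sq n)) (lebC {..<n})"
        "(\<lambda>p. snd (fst p)) \<in> measurable ((lebC {..<n} \<Otimes>\<^sub>M lebC {..<n}) \<Otimes>\<^sub>M lebC (sq n)) (lebC {..<n})" by measurable
      note m = this
      show "(\<lambda>p. fst (fst p) i) \<in> borel_measurable ((lebC {..<n} \<Otimes>\<^sub>M lebC {..<n}) \<Otimes>\<^sub>M lebC (sq n))" if "i < n" for i
        by (rule measurable_compose[OF m(1)]) (use that in auto)
      show "(\<lambda>p. snd (fst p) i) \<in> borel_measurable ((lebC {..<n} \<Otimes>\<^sub>M lebC {..<n}) \<Otimes>\<^sub>M lebC (sq n))" if "i < n" for i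
        by (rule measurable_compose[OF m(2)]) (use that in auto)
    qed auto
    hence "(\<lambda>p. \<integral>\<^sup>+D. ennreal (deflation_weight n 0 (fst p) (snd p) D) \<partial>lebC (sq n)) \<in> borel_measurable (lebC {..<n} \<Otimes>\<^sub>M lebC {..<n})"
      using S.borel_measurable_nn_integral[of "\<lambda>p D. ennreal (deflation_weight n 0 (fst p) (snd p) D)" "lebC {..<n} \<Otimes>\<^sub>M lebC {..<n}"]
      by (simp add: case_prod_unfold)
    thus ?thesis unfolding Kap_def
      using V.borel_measurable_nn_integral[of "\<lambda>u w. \<integral>\<^sup>+D. ennreal (deflation_weight n 0 u w D) \<partial>lebC (sq n)" "lebC {..<n}"]
      by (simp add: case_prod_unfold)
  qed
  have Kap_eq: "\<kappa> u = Kap u * ennreal (1 / pi ^ (n * n))" for u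
  proof -
    have "Kap u = \<kappa> u * ennreal (pi ^ (n * n))"
      using \<kappa>[of "\<lambda>_. 1" u 0] by (simp add: Kap_def nn_integral_exp_frob)
    hence "Kap u * ennreal (1 / pi ^ (n * n)) = \<kappa> u * (ennreal (pi ^ (n * n)) * ennreal (1 / pi ^ (n * n)))"
      by (simp only: mult.assoc)
    also have "ennreal (pi ^ (n * n)) * ennreal (1 / pi ^ (n * n)) = 1"
      by (subst ennreal_mult[symmetric]) auto
    finally show ?thesis by simp
  qed
  have \<kappa>m[measurable]: "\<kappa> \<in> borel_measurable (lebC {..<n})"
    unfolding Kap_eq[abs_def] using Kap by measurable
  define K where "K = (\<integral>\<^sup>+u. \<kappa> u \<partial>lebC {..<n})"
  have "ennreal (Suc n) * spec_integral U (Suc n) ws =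
     K * (\<integral>\<^sup>+z. ennreal ((if z \<in> U then 1 else 0) * (\<Prod>w\<leftarrow>ws. (cmod (w - z))\<^sup>2) * exp (- (cmod z)\<^sup>2))
            * spec_integral U n (z # ws) \<partial>lborel)"
    if U: "closed U" for U ws
  proof -
    have Um[measurable]: "U \<in> sets borel" using U by (simp add: borel_closed)
    define F where "F = (\<lambda>x. ennreal (spec_weight U (Suc n) ws x) * ennreal (exp (- frob (Suc n) x)))"
    have F[measurable]: "F \<in> borel_measurable (lebC (sq (Suc n)))"
    proof -
      have "spec_weight U (Suc n) ws \<in> borel_measurable (lebC (sq (Suc n)))"
        by (rule measurable_spec_weight[OF U, where v = "\<lambda>x. x"]) auto
      thus ?thesis unfolding F_def by measurable
    qed
    define g where "g = (\<lambda>D w c. chi (Suc n) (border n D c w 0))"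
    \<comment> \<open>\<open>\<Phi>\<close> is the integrand after \<open>a\<close> has been
      replaced by \<open>z\<close>, and \<open>\<Theta>\<close> the one after \<open>c\<close> has
      been replaced by \<open>u\<close> as well.\<close>
    define \<Phi> where "\<Phi> = (\<lambda>D w c z. ennreal ((cmod (poly (pderiv (g D w c) * chi n D - g D w c * pderiv (chi n D)) z / (poly (chi n D) z)\<^sup>2))\<^sup>2)
        * F (border n D c w (poly (g D w c) z / poly (chi n D) z)))"
    define \<Theta> where "\<Theta> = (\<lambda>D w z u. ennreal ((if z \<in> U then 1 else 0) * (\<Prod>w\<leftarrow>ws. (cmod (w - z))\<^sup>2))
        * (ennreal (spec_weight U n (z # ws) (?rk u w D)) * ennreal (deflation_weight n z u w D)))"
    have bm: "(\<lambda>p. border n D (c p) w (a p)) \<in> measurable M (lebC (sq (Suc n)))"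
      if "\<And>i. i < n \<Longrightarrow> (\<lambda>p. c p i) \<in> borel_measurable M" "a \<in> borel_measurable M" for D w c a and M :: "'z measure"
      by (rule measurable_border) (use that in auto)
    have \<Phi>m: "(\<lambda>(c, z). \<Phi> D w c z) \<in> borel_measurable (lebC {..<n} \<Otimes>\<^sub>M lborel)" for D w
    proof -
      let ?M = "lebC {..<n} \<Otimes>\<^sub>M (lborel :: complex measure)"
      have fi: "(\<lambda>p. fst p i) \<in> borel_measurable ?M" if "i < n" for i
        by (rule measurable_compose[OF measurable_fst]) (use that in auto)
      have comp: "(\<lambda>p. border n D (fst p) w 0 (i, j)) \<in> borel_measurable ?M" if "i < Suc n" "j < Suc n" for i j
        using measurable_compose[OF bm[of fst ?M "\<lambda>_. 0" D w] measurable_component_singleton[of "(i, j)" "sq (Suc n)"]] fi that by simp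
      have [measurable]: "(\<lambda>p. poly (g D w (fst p)) (snd p)) \<in> borel_measurable ?M"
        "(\<lambda>p. poly (pderiv (g D w (fst p))) (snd p)) \<in> borel_measurable ?M"
        unfolding g_def by (intro measurable_poly_chi comp measurable_snd; simp)+
      have [measurable]: "(\<lambda>p. poly (chi n D) (snd p)) \<in> borel_measurable ?M"
        "(\<lambda>p. poly (pderiv (chi n D)) (snd p)) \<in> borel_measurable ?M"
        by (intro measurable_poly_chi measurable_const; simp)+
      have [measurable]: "(\<lambda>p. border n D (fst p) w (poly (g D w (fst p)) (snd p) / poly (chi n D) (snd p))) \<in> measurable ?M (lebC (sq (Suc n)))"
        by (rule bm[OF fi]) measurable
      show ?thesis unfolding \<Phi>_def case_prod_unfold poly_diff poly_mult by measurable
    qed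
    have stepA: "ennreal (Suc n) * spec_integral U (Suc n) ws =
      (\<integral>\<^sup>+D. \<integral>\<^sup>+w. \<integral>\<^sup>+c. \<integral>\<^sup>+z. \<Phi> D w c z \<partial>lborel \<partial>lebC {..<n} \<partial>lebC {..<n} \<partial>lebC (sq n))"
    proof -
      have "ennreal (Suc n) * spec_integral U (Suc n) ws = (\<integral>\<^sup>+x. ennreal (Suc n) * F x \<partial>lebC (sq (Suc n)))"
        unfolding spec_integral_def F_def[symmetric] by (rule nn_integral_cmult[symmetric]) measurable
      also have "\<dots> = (\<integral>\<^sup>+D. \<integral>\<^sup>+w. \<integral>\<^sup>+c. \<integral>\<^sup>+a. ennreal (Suc n) * F (border n D c w a) \<partial>lborel \<partial>lebC {..<n} \<partial>lebC {..<n} \<partial>lebC (sq n))"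
        by (rule nn_integral_border) measurable
      also have "\<dots> = (\<integral>\<^sup>+D. \<integral>\<^sup>+w. \<integral>\<^sup>+c. \<integral>\<^sup>+z. \<Phi> D w c z \<partial>lborel \<partial>lebC {..<n} \<partial>lebC {..<n} \<partial>lebC (sq n))"
      proof (rule nn_integral_cong_AE)
        show "AE D in lebC (sq n). (\<integral>\<^sup>+w. \<integral>\<^sup>+c. \<integral>\<^sup>+a. ennreal (Suc n) * F (border n D c w a) \<partial>lborel \<partial>lebC {..<n} \<partial>lebC {..<n}) =
            (\<integral>\<^sup>+w. \<integral>\<^sup>+c. \<integral>\<^sup>+z. \<Phi> D w c z \<partial>lborel \<partial>lebC {..<n} \<partial>lebC {..<n})"
          using AE_coprime_border
        proof eventually_elim
          case (elim D)
          have "AE w in lebC {..<n}. (\<integral>\<^sup>+c. \<integral>\<^sup>+a. ennreal (Suc n) * F (border n D c w a) \<partial>lborel \<partial>lebC {..<n}) =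
            (\<integral>\<^sup>+c. \<integral>\<^sup>+z. \<Phi> D w c z \<partial>lborel \<partial>lebC {..<n})"
            using elim
          proof eventually_elim
            case (elim w)
            have "AE c in lebC {..<n}. (\<integral>\<^sup>+a. ennreal (Suc n) * F (border n D c w a) \<partial>lborel) = (\<integral>\<^sup>+z. \<Phi> D w c z \<partial>lborel)"
              using elim
            proof eventually_elim
              case (elim c)
              have k: "(\<lambda>a. F (border n D c w a)) \<in> borel_measurable borel"
                by (rule measurable_compose[OF _ F], rule bm) auto
              have "(\<integral>\<^sup>+z. \<Phi> D w c z \<partial>lborel) = ennreal (Suc n) * (\<integral>\<^sup>+a. F (border n D c w a) \<partial>lborel)"
                unfolding \<Phi>_def
                by (rule nn_integral_rational_substitution[OF _ _ _ _ _ k])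
                   (use elim in \<open>auto simp: g_def lead_coeff_chi\<close>)
              also have "\<dots> = (\<integral>\<^sup>+a. ennreal (Suc n) * F (border n D c w a) \<partial>lborel)"
                by (rule nn_integral_cmult[symmetric]) (use k in simp)
              finally show ?case by simp
            qed
            thus ?case by (rule nn_integral_cong_AE)
          qed
          thus ?case by (rule nn_integral_cong_AE)
        qed
      qed
      finally show ?thesis .
    qed
    \<comment> \<open>For \<open>z\<close> outside the spectrum of \<open>D\<close>, the
      substitution \<open>c = (z - D) u\<close> is invertible with Jacobian
      \<open>|det (z - D)|^2\<close>; this cancels the denominator of the derivative and leaves
      \<open>|chi n B|^2\<close> at \<open>z\<close>.\<close>
    have stepD: "(\<integral>\<^sup>+c. \<Phi> D w c z \<partial>lebC {..<n}) = (\<integral>\<^sup>+u. \<Theta> D w z u \<partial>lebC {..<n})"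
      if dz: "poly (chi n D) z \<noteq> 0" for D w z
    proof -
      \<comment> \<open>\<open>char_matrix\<close> stands for \<open>D - z\<close>, hence the
        sign.\<close>
      define A where "A = - (char_matrix (Matrix.mat n n D) z)"
      have Ac: "A \<in> carrier_mat n n" by (simp add: A_def char_matrix_def)
      have detA: "Determinant.det A = poly (chi n D) z"
        unfolding A_def chi_def by (rule char_poly_matrix[symmetric, of _ n]) simp
      have Aij: "A $$ (i, j) = (if i = j then z else 0) - D (i, j)" if "i < n" "j < n" for i j
        using that by (auto simp: A_def char_matrix_def)
      have Au: "(\<Sum>j<n. A $$ (i, j) * u j) = z * u i - (\<Sum>j<n. D (i, j) * u j)" if i: "i < n" for i u
      proof -
        have "(\<Sum>j<n. A $$ (i, j) * u j) = (\<Sum>j<n. (if j = i then z * u j else 0) - D (i, j) * u j)"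
          using i by (intro sum.cong refl) (auto simp: Aij algebra_simps)
        thus ?thesis using i by (simp add: sum_subtractf)
      qed
      have k: "(\<lambda>c. \<Phi> D w c z) \<in> borel_measurable (lebC {..<n})"
        using measurable_compose[OF measurable_Pair2'[of z lborel "lebC {..<n}"] \<Phi>m[of D w]] by simp
      have "(\<integral>\<^sup>+c. \<Phi> D w c z \<partial>lebC {..<n}) = ennreal ((cmod (poly (chi n D) z))\<^sup>2) *
          (\<integral>\<^sup>+u. \<Phi> D w (\<lambda>i\<in>{..<n}. \<Sum>j<n. A $$ (i, j) * u j) z \<partial>lebC {..<n})"
        using nn_integral_matrix_change[OF Ac _ k] dz by (simp add: detA)
      also have "\<dots> = (\<integral>\<^sup>+u. ennreal ((cmod (poly (chi n D) z))\<^sup>2) * \<Phi> D w (\<lambda>i\<in>{..<n}. \<Sum>j<n. A $$ (i, j) * u j) z \<partial>lebC {..<n})"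
      proof (rule nn_integral_cmult[symmetric])
        have "(\<lambda>u. \<lambda>i\<in>{..<n}. \<Sum>j<n. A $$ (i, j) * u j) \<in> measurable (lebC {..<n}) (lebC {..<n})"
          using measurable_affine_map[where I = "{..<n}" and J = "{..<n}" and t = "\<lambda>_. 0" and S = "\<lambda>i j. A $$ (i, j)"] by simp
        from measurable_compose[OF this k]
        show "(\<lambda>u. \<Phi> D w (\<lambda>i\<in>{..<n}. \<Sum>j<n. A $$ (i, j) * u j) z) \<in> borel_measurable (lebC {..<n})" .
      qed
      also have "\<dots> = (\<integral>\<^sup>+u. \<Theta> D w z u \<partial>lebC {..<n})"
      proof (rule nn_integral_cong)
        fix u :: "nat \<Rightarrow> complex"
        define c where "c = (\<lambda>i\<in>{..<n}. \<Sum>j<n. A $$ (i, j) * u j)"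
        define a where "a = z - (\<Sum>j<n. w j * u j)"
        define B where "B = ?rk u w D"
        have c: "c i = z * u i - (\<Sum>j<n. D (i, j) * u j)" if "i < n" for i
          using that Au by (simp add: c_def)
        have B: "B (i, j) = D (i, j) - u i * w j" if "i < n" "j < n" for i j
          using that by (simp add: B_def)
        have der: "poly (g D w c) z / poly (chi n D) z = a"
          "poly (pderiv (g D w c) * chi n D - g D w c * pderiv (chi n D)) z / (poly (chi n D) z)\<^sup>2
            = poly (chi n B) z / poly (chi n D) z"
          unfolding g_def by (rule chi_border_derivative[OF c a_def B dz]; assumption)+
        have defl: "chi (Suc n) (border n D c w a) = [:- z, 1:] * chi n B"
          by (rule chi_border_deflate[OF c a_def B]; assumption)
        note weight = spec_weight_border[OF defl, of U ws]
        have e1: "ennreal ((cmod (poly (chi n D) z))\<^sup>2) * \<Phi> D w c z =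
          ennreal ((cmod (poly (chi n B) z))\<^sup>2) * F (border n D c w a)"
        proof -
          have "(cmod (poly (chi n D) z))\<^sup>2 * (cmod (poly (chi n B) z / poly (chi n D) z))\<^sup>2 = (cmod (poly (chi n B) z))\<^sup>2"
            using dz by (simp add: norm_divide power_divide)
          thus ?thesis
            unfolding \<Phi>_def der mult.assoc[symmetric] by (subst ennreal_mult[symmetric]) auto
        qed
        have e2: "frob (Suc n) (border n D c w a) = frob (Suc n) (border n D (\<lambda>i. z * u i - (\<Sum>j<n. D (i, j) * u j)) w a)"
          by (rule arg_cong[of _ _ "frob (Suc n)"], rule border_cong) (auto simp: c)
        have "ennreal ((cmod (poly (chi n B) z))\<^sup>2) * F (border n D c w a) =
          ennreal ((cmod (poly (chi n B) z))\<^sup>2 * spec_weight U (Suc n) ws (border n D c w a)) * ennreal (deflation_weight n z u w D)"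
          unfolding F_def e2 deflation_weight_def a_def[symmetric]
          by (simp add: ennreal_mult spec_weight_nonneg mult.assoc)
        also have "\<dots> = \<Theta> D w z u"
        proof -
          have "ennreal ((cmod (poly (chi n B) z))\<^sup>2 * spec_weight U (Suc n) ws (border n D c w a))
             = ennreal ((if z \<in> U then 1 else 0) * (\<Prod>w\<leftarrow>ws. (cmod (w - z))\<^sup>2)) * ennreal (spec_weight U n (z # ws) B)"
            unfolding weight
            by (rule ennreal_mult) (auto simp: spec_weight_nonneg intro!: prod_list_nonneg)
          thus ?thesis unfolding \<Theta>_def B_def[symmetric] by (simp only: mult.assoc)
        qed
        finally show "ennreal ((cmod (poly (chi n D) z))\<^sup>2) * \<Phi> D w (\<lambda>i\<in>{..<n}. \<Sum>j<n. A $$ (i, j) * u j) z = \<Theta> D w z u"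
          using e1 by (simp add: c_def)
      qed
      finally show ?thesis .
    qed
    interpret P: pair_sigma_finite "lebC {..<n} :: (nat \<Rightarrow> complex) measure" "lborel :: complex measure" ..
    have stepC: "(\<integral>\<^sup>+c. \<integral>\<^sup>+z. \<Phi> D w c z \<partial>lborel \<partial>lebC {..<n}) = (\<integral>\<^sup>+z. \<integral>\<^sup>+u. \<Theta> D w z u \<partial>lebC {..<n} \<partial>lborel)" for D w
    proof -
      have "(\<integral>\<^sup>+c. \<integral>\<^sup>+z. \<Phi> D w c z \<partial>lborel \<partial>lebC {..<n}) = (\<integral>\<^sup>+z. \<integral>\<^sup>+c. \<Phi> D w c z \<partial>lebC {..<n} \<partial>lborel)"
        by (rule P.Fubini'[OF \<Phi>m, symmetric])
      also have "\<dots> = (\<integral>\<^sup>+z. \<integral>\<^sup>+u. \<Theta> D w z u \<partial>lebC {..<n} \<partial>lborel)"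
      proof (rule nn_integral_cong_AE)
        have "AE z in lborel. z \<notin> {z. poly (chi n D) z = 0}"
          by (rule AE_not_in) (simp add: finite_imp_null_set_lborel poly_roots_finite)
        thus "AE z in lborel. (\<integral>\<^sup>+c. \<Phi> D w c z \<partial>lebC {..<n}) = (\<integral>\<^sup>+u. \<Theta> D w z u \<partial>lebC {..<n})"
          by eventually_elim (simp add: stepD)
      qed
      finally show ?thesis .
    qed
    have wsm[measurable]: "(\<lambda>z. \<Prod>w\<leftarrow>ws. (cmod (w - z))\<^sup>2) \<in> borel_measurable borel"
      by (induction ws) auto
    have \<Theta>m: "(\<lambda>((D, w), (z, u)). \<Theta> D w z u) \<in> borel_measurable ((lebC (sq n) \<Otimes>\<^sub>M lebC {..<n}) \<Otimes>\<^sub>M (lborel \<Otimes>\<^sub>M lebC {..<n}))"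
    proof -
      let ?M = "(lebC (sq n) \<Otimes>\<^sub>M lebC {..<n}) \<Otimes>\<^sub>M ((lborel :: complex measure) \<Otimes>\<^sub>M lebC {..<n})"
      have pm: "(\<lambda>p. fst (fst p)) \<in> measurable ?M (lebC (sq n))" "(\<lambda>p. snd (fst p)) \<in> measurable ?M (lebC {..<n})"
        "(\<lambda>p. snd (snd p)) \<in> measurable ?M (lebC {..<n})" by measurable
      have z[measurable]: "(\<lambda>p. fst (snd p)) \<in> borel_measurable ?M" by measurable
      have Dm: "(\<lambda>p. fst (fst p) (i, j)) \<in> borel_measurable ?M" if "i < n" "j < n" for i j
        by (rule measurable_compose[OF pm(1)]) (use that in auto)
      have wm: "(\<lambda>p. snd (fst p) j) \<in> borel_measurable ?M" if "j < n" for j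
        by (rule measurable_compose[OF pm(2)]) (use that in auto)
      have um: "(\<lambda>p. snd (snd p) j) \<in> borel_measurable ?M" if "j < n" for j
        by (rule measurable_compose[OF pm(3)]) (use that in auto)
      define f1 f2 f3 where "f1 = (\<lambda>p. poly (chi n (?rk (snd (snd p)) (snd (fst p)) (fst (fst p)))) (fst (snd p)))"
        and "f2 = (\<lambda>p :: ((nat \<times> nat \<Rightarrow> complex) \<times> (nat \<Rightarrow> complex)) \<times> complex \<times> (nat \<Rightarrow> complex). spec_weight U n ws (?rk (snd (snd p)) (snd (fst p)) (fst (fst p))))"
        and "f3 = (\<lambda>p. deflation_weight n (fst (snd p)) (snd (snd p)) (snd (fst p)) (fst (fst p)))"
      have [measurable]: "f3 \<in> borel_measurable ?M"
        unfolding f3_def by (rule dm) (fact Dm um wm z)+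
      have rm: "(\<lambda>p. ?rk (snd (snd p)) (snd (fst p)) (fst (fst p)) (i, j)) \<in> borel_measurable ?M" if "i < n" "j < n" for i j
        using Dm[OF that] um[OF that(1)] wm[OF that(2)] that by simp
      have [measurable]: "f2 \<in> borel_measurable ?M"
        unfolding f2_def by (rule measurable_spec_weight[OF U]) (fact rm)
      have [measurable]: "f1 \<in> borel_measurable ?M"
        unfolding f1_def by (rule measurable_poly_chi(1)) (fact rm z)+
      have "(\<lambda>p. ennreal ((if fst (snd p) \<in> U then 1 else 0) * (\<Prod>w\<leftarrow>ws. (cmod (w - fst (snd p)))\<^sup>2))
          * (ennreal ((cmod (f1 p))\<^sup>2 * f2 p) * ennreal (f3 p))) \<in> borel_measurable ?M" by measurable
      thus ?thesis unfolding \<Theta>_def spec_weight_Cons f1_def f2_def f3_def by (simp add: case_prod_unfold)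
    qed
    have Sm[measurable]: "(\<lambda>z. spec_integral U n (z # ws)) \<in> borel_measurable borel"
    proof -
      let ?M = "(lborel :: complex measure) \<Otimes>\<^sub>M lebC (sq n)"
      have xm: "(\<lambda>p. snd p (i, j)) \<in> borel_measurable ?M" if "i < n" "j < n" for i j
        by (rule measurable_compose[OF measurable_snd]) (use that in auto)
      have [measurable]: "(\<lambda>p. spec_weight U n ws (snd p)) \<in> borel_measurable ?M"
        by (rule measurable_spec_weight[OF U]) (fact xm)
      have [measurable]: "(\<lambda>p. poly (chi n (snd p)) (fst p)) \<in> borel_measurable ?M"
        by (rule measurable_poly_chi(1)) (use xm in auto)
      have "(\<lambda>(z, x). ennreal (spec_weight U n (z # ws) x) * ennreal (exp (- frob n x))) \<in> borel_measurable ?M"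
        unfolding spec_weight_Cons case_prod_unfold by measurable
      from S.borel_measurable_nn_integral[OF this] show ?thesis unfolding spec_integral_def by simp
    qed
    have stepF: "(\<integral>\<^sup>+w. \<integral>\<^sup>+D. \<Theta> D w z u \<partial>lebC (sq n) \<partial>lebC {..<n}) =
       ennreal ((if z \<in> U then 1 else 0) * (\<Prod>w\<leftarrow>ws. (cmod (w - z))\<^sup>2) * exp (- (cmod z)\<^sup>2)) * spec_integral U n (z # ws) * \<kappa> u"
      for z u
    proof -
      define H where "H = (\<lambda>x. ennreal (spec_weight U n (z # ws) x))"
      define C where "C = ennreal ((if z \<in> U then 1 else 0) * (\<Prod>w\<leftarrow>ws. (cmod (w - z))\<^sup>2))"
      have Hm[measurable]: "H \<in> borel_measurable (lebC (sq n))"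
        unfolding H_def by (rule measurable_compose[OF measurable_spec_weight[OF U, where v = "\<lambda>x. x"] measurable_ennreal]) auto
      let ?M = "lebC {..<n} \<Otimes>\<^sub>M lebC (sq n)"
      have Dm: "(\<lambda>p. snd p (i, j)) \<in> borel_measurable ?M" if "i < n" "j < n" for i j
        by (rule measurable_compose[OF measurable_snd]) (use that in auto)
      have wm: "(\<lambda>p. fst p i) \<in> borel_measurable ?M" if "i < n" for i
        by (rule measurable_compose[OF measurable_fst]) (use that in auto)
      define h1 h2 where "h1 = (\<lambda>p. ?rk u (fst p) (snd p))" and "h2 = (\<lambda>p. deflation_weight n z u (fst p) (snd p))"
      have [measurable]: "h1 \<in> measurable ?M (lebC (sq n))"
        unfolding h1_def
      proof (rule measurable_restrict)
        fix q assume "q \<in> sq n"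
        thus "(\<lambda>p. case q of (i, j) \<Rightarrow> snd p (i, j) - u i * fst p j) \<in> measurable ?M lborel"
          using Dm wm by (cases q) auto
      qed
      have [measurable]: "h2 \<in> borel_measurable ?M"
        unfolding h2_def by (rule dm) (use Dm wm in auto)
      have jm: "(\<lambda>(w, D). H (?rk u w D) * ennreal (deflation_weight n z u w D)) \<in> borel_measurable ?M"
      proof -
        have "(\<lambda>p. H (h1 p) * ennreal (h2 p)) \<in> borel_measurable ?M" by measurable
        thus ?thesis by (simp add: h1_def h2_def case_prod_unfold)
      qed
      have "(\<integral>\<^sup>+w. \<integral>\<^sup>+D. \<Theta> D w z u \<partial>lebC (sq n) \<partial>lebC {..<n}) =
        (\<integral>\<^sup>+w. C * (\<integral>\<^sup>+D. H (?rk u w D) * ennreal (deflation_weight n z u w D) \<partial>lebC (sq n)) \<partial>lebC {..<n})"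
      proof (rule nn_integral_cong)
        fix w assume w: "w \<in> space (lebC {..<n} :: (nat \<Rightarrow> complex) measure)"
        have "(\<lambda>D. H (?rk u w D) * ennreal (deflation_weight n z u w D)) \<in> borel_measurable (lebC (sq n))"
          using measurable_compose[OF measurable_Pair1'[OF w] jm] by simp
        thus "(\<integral>\<^sup>+D. \<Theta> D w z u \<partial>lebC (sq n)) = C * (\<integral>\<^sup>+D. H (?rk u w D) * ennreal (deflation_weight n z u w D) \<partial>lebC (sq n))"
          unfolding \<Theta>_def C_def[symmetric] H_def[symmetric]
          by (subst nn_integral_cmult[symmetric]) (simp_all add: H_def)
      qed
      also have "\<dots> = C * (\<integral>\<^sup>+w. \<integral>\<^sup>+D. H (?rk u w D) * ennreal (deflation_weight n z u w D) \<partial>lebC (sq n) \<partial>lebC {..<n})"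
        by (rule nn_integral_cmult) (rule S.borel_measurable_nn_integral[OF jm])
      also have "\<dots> = C * (ennreal (exp (- (cmod z)\<^sup>2)) * \<kappa> u * spec_integral U n (z # ws))"
        unfolding spec_integral_def H_def[symmetric]
        by (subst \<kappa>[OF Hm]) (auto simp: H_def intro: arg_cong[OF spec_weight_cong, of _ _ _ ennreal])
      finally show ?thesis
        unfolding C_def by (simp add: ennreal_mult' mult_ac)
    qed
    have "ennreal (Suc n) * spec_integral U (Suc n) ws =
       (\<integral>\<^sup>+D. \<integral>\<^sup>+w. \<integral>\<^sup>+z. \<integral>\<^sup>+u. \<Theta> D w z u \<partial>lebC {..<n} \<partial>lborel \<partial>lebC {..<n} \<partial>lebC (sq n))"
      unfolding stepA stepC ..
    also have "\<dots> = (\<integral>\<^sup>+z. \<integral>\<^sup>+u. \<integral>\<^sup>+w. \<integral>\<^sup>+D. \<Theta> D w z u \<partial>lebC (sq n) \<partial>lebC {..<n} \<partial>lebC {..<n} \<partial>lborel)"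
      by (rule nn_integral_swap4[OF S.sigma_finite_measure_axioms V.sigma_finite_measure_axioms
            lborel.sigma_finite_measure_axioms V.sigma_finite_measure_axioms \<Theta>m])
    also have "\<dots> = (\<integral>\<^sup>+z. ennreal ((if z \<in> U then 1 else 0) * (\<Prod>w\<leftarrow>ws. (cmod (w - z))\<^sup>2) * exp (- (cmod z)\<^sup>2)) * spec_integral U n (z # ws) * K \<partial>lborel)"
      unfolding stepF K_def by (intro nn_integral_cong nn_integral_cmult) measurable
    also have "\<dots> = K * (\<integral>\<^sup>+z. ennreal ((if z \<in> U then 1 else 0) * (\<Prod>w\<leftarrow>ws. (cmod (w - z))\<^sup>2) * exp (- (cmod z)\<^sup>2)) * spec_integral U n (z # ws) \<partial>lborel)"
      by (subst mult.commute, rule nn_integral_multc) measurable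
    finally show ?thesis .
  qed
  thus ?thesis by blast
qed

section \<open>The law of the eigenvalue moduli\<close>

text \<open>As a polynomial in the last node the determinant has degree at most \<open>n\<close>,
  vanishes at the earlier nodes, and has the smaller determinant as its coefficient at degree
  \<open>n\<close>; for distinct nodes this determines it. With a repeated node both sides are
  0.\<close>

lemma vandermonde_det:
  fixes x :: "nat \<Rightarrow> complex"
  shows "Determinant.det (Matrix.mat n n (\<lambda>(i, j). x i ^ j)) = (\<Prod>j<n. \<Prod>i<j. x j - x i)"
proof (induction n)
  case 0
  show ?case by simp
next
  case (Suc n)
  show ?case
  proof (cases "inj_on x {..<Suc n}")
    case False
    then obtain i j where ij: "i < Suc n" "j < Suc n" "i \<noteq> j" "x i = x j" by (auto simp: inj_on_def)
    have "Determinant.det (Matrix.mat (Suc n) (Suc n) (\<lambda>(i, j). x i ^ j)) = 0"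
      by (rule det_identical_rows[OF _ ij(3,1,2)]) (use ij in \<open>auto intro!: eq_vecI\<close>)
    moreover have "(\<Prod>j<Suc n. \<Prod>i<j. x j - x i) = 0"
    proof -
      define a b where "a = max i j" and "b = min i j"
      have ab: "b < a" "a < Suc n" "x a = x b" using ij by (auto simp: a_def b_def max_def min_def)
      have "(\<Prod>i<a. x a - x i) = 0" by (rule prod_zero) (use ab in auto)
      thus ?thesis by (intro prod_zero) (use ab in auto)
    qed
    ultimately show ?thesis by simp
  next
    case True
    define A where "A = (\<lambda>t. Matrix.mat (Suc n) (Suc n) (\<lambda>(i, j). (if i = n then t else x i) ^ j))"
    have A: "A t \<in> carrier_mat (Suc n) (Suc n)" for t by (simp add: A_def)
    have del: "mat_delete (A t) n j = mat_delete (A 0) n j" for t j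
      by (rule eq_matI) (auto simp: mat_delete_def A_def)
    define co where "co = (\<lambda>j. cofactor (A 0) n j)"
    have detA: "Determinant.det (A t) = (\<Sum>j\<le>n. co j * t ^ j)" for t
    proof -
      have "Determinant.det (A t) = (\<Sum>j<Suc n. A t $$ (n, j) * cofactor (A t) n j)"
        by (rule laplace_expansion_row[OF A]) simp
      also have "\<dots> = (\<Sum>j<Suc n. co j * t ^ j)"
      proof (rule sum.cong[OF refl])
        fix j assume "j \<in> {..<Suc n}"
        hence "A t $$ (n, j) = t ^ j" by (simp add: A_def)
        moreover have "cofactor (A t) n j = co j" unfolding co_def cofactor_def del[of t j] ..
        ultimately show "A t $$ (n, j) * cofactor (A t) n j = co j * t ^ j" by (simp add: mult.commute)
      qed
      finally show ?thesis by (simp only: lessThan_Suc_atMost)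
    qed
    have con: "co n = (\<Prod>j<n. \<Prod>i<j. x j - x i)"
    proof -
      have "mat_delete (A 0) n n = Matrix.mat n n (\<lambda>(i, j). x i ^ j)"
        by (rule eq_matI) (auto simp: mat_delete_def A_def)
      thus ?thesis using Suc.IH by (simp add: co_def cofactor_def)
    qed
    define p where "p = (\<Sum>j\<le>n. monom (co j) j)"
    define q where "q = Polynomial.smult (co n) (\<Prod>i<n. [:- x i, 1:])"
    have p: "poly p t = Determinant.det (A t)" for t
      by (simp add: p_def detA poly_sum poly_monom)
    have cp: "coeff p n = co n"
      by (simp add: p_def coeff_sum)
    have dq: "degree (\<Prod>i<n. [:- x i, 1:]) = n" "coeff (\<Prod>i<n. [:- x i, 1:]) n = 1"
    proof -
      show d: "degree (\<Prod>i<n. [:- x i, 1:]) = n"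
        by (subst degree_prod_eq_sum_degree) auto
      have "lead_coeff (\<Prod>i<n. [:- x i, 1:]) = 1" by (simp add: lead_coeff_prod)
      thus "coeff (\<Prod>i<n. [:- x i, 1:]) n = 1" by (simp only: d)
    qed
    have "p - q = 0"
    proof (rule ccontr)
      assume ne: "p - q \<noteq> 0"
      have "degree p \<le> n" unfolding p_def by (intro degree_sum_le) (auto intro: order_trans[OF degree_monom_le])
      moreover have "degree q \<le> n" unfolding q_def using dq by (metis degree_smult_le)
      ultimately have "degree (p - q) \<le> n" by (rule degree_diff_le)
      moreover have "coeff (p - q) n = 0" using cp dq by (simp add: q_def)
      \<comment> \<open>For \<open>n = 0\<close> a vanishing coefficient does not lower the degree
        below \<open>n\<close>; that case is refuted at the end, where the difference is
        constant.\<close>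
      ultimately have "n = 0 \<or> degree (p - q) < n"
        using ne by (metis le_neq_implies_less leading_coeff_0_iff)
      have "poly (p - q) (x i) = 0" if "i < n" for i
      proof -
        have "Determinant.det (A (x i)) = 0"
          by (rule det_identical_rows[OF A, of i n]) (use that in \<open>auto simp: A_def intro!: eq_vecI\<close>)
        moreover have "poly q (x i) = 0" using that by (auto simp: q_def poly_prod)
        ultimately show ?thesis by (simp add: p)
      qed
      hence "x ` {..<n} \<subseteq> {t. poly (p - q) t = 0}" by auto
      hence "card (x ` {..<n}) \<le> card {t. poly (p - q) t = 0}" by (intro card_mono poly_roots_finite ne)
      moreover have "inj_on x {..<n}" by (rule inj_on_subset[OF True]) auto
      hence "card (x ` {..<n}) = n" by (simp add: card_image)
      moreover have "card {t. poly (p - q) t = 0} \<le> degree (p - q)" by (rule poly_roots_degree[OF ne])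
      ultimately have "n \<le> degree (p - q)" by simp
      with \<open>n = 0 \<or> degree (p - q) < n\<close> have "n = 0" by auto
      hence "p - q = [:coeff (p - q) 0:]" using \<open>degree (p - q) \<le> n\<close> by (metis degree_0_id le_zero_eq)
      with \<open>coeff (p - q) n = 0\<close> \<open>n = 0\<close> ne show False by simp
    qed
    hence "poly p (x n) = poly q (x n)" by simp
    hence "Determinant.det (A (x n)) = co n * (\<Prod>i<n. x n - x i)"
      by (simp add: p q_def poly_prod)
    moreover have "A (x n) = Matrix.mat (Suc n) (Suc n) (\<lambda>(i, j). x i ^ j)"
      by (rule eq_matI) (auto simp: A_def)
    ultimately show ?thesis by (simp add: con)
  qed
qed

section \<open>The unnormalised eigenvalue density\<close>

definition gauss_weight :: "complex set \<Rightarrow> complex \<Rightarrow> real"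
  where "gauss_weight U z = (if z \<in> U then 1 else 0) * exp (- (cmod z)\<^sup>2)"

text \<open>For \<open>ws = []\<close> and \<open>U = UNIV\<close> this is the Ginibre eigenvalue
  density up to normalisation. In general the points are confined to \<open>U\<close> and also
  repelled by the fixed points in \<open>ws\<close>.\<close>

definition eigen_density :: "complex set \<Rightarrow> nat \<Rightarrow> complex list \<Rightarrow> (nat \<Rightarrow> complex) \<Rightarrow> real"
  where "eigen_density U n ws x = (\<Prod>i<n. gauss_weight U (x i) * (\<Prod>w\<leftarrow>ws. (cmod (w - x i))\<^sup>2))
     * (\<Prod>j<n. \<Prod>i<j. (cmod (x j - x i))\<^sup>2)"

lemma gauss_weight_nonneg [simp]: "gauss_weight U z \<ge> 0"
  by (simp add: gauss_weight_def)

lemma measurable_gauss_weight [measurable]: "closed U \<Longrightarrow> gauss_weight U \<in> borel_measurable borel"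
proof -
  assume "closed U"
  hence [measurable]: "U \<in> sets borel" by (rule borel_closed)
  show ?thesis unfolding gauss_weight_def by measurable
qed

text \<open>The last point moves from the coordinates into the list, exactly as \<open>z\<close>
  does in \<open>spec_integral_recursion\<close>.\<close>

lemma eigen_density_Suc:
  "eigen_density U (Suc n) ws (x(n := z)) =
     gauss_weight U z * (\<Prod>w\<leftarrow>ws. (cmod (w - z))\<^sup>2) * eigen_density U n (z # ws) x"
proof -
  have "(\<Prod>i<n. gauss_weight U ((x(n := z)) i) * (\<Prod>w\<leftarrow>ws. (cmod (w - (x(n := z)) i))\<^sup>2)) =
     (\<Prod>i<n. gauss_weight U (x i) * (\<Prod>w\<leftarrow>ws. (cmod (w - x i))\<^sup>2))"
    by (intro prod.cong) auto
  moreover have "(\<Prod>j<n. \<Prod>i<j. (cmod ((x(n := z)) j - (x(n := z)) i))\<^sup>2) = (\<Prod>j<n. \<Prod>i<j. (cmod (x j - x i))\<^sup>2)"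
    by (intro prod.cong) auto
  moreover have "(\<Prod>i<n. (cmod ((x(n := z)) n - (x(n := z)) i))\<^sup>2) = (\<Prod>i<n. (cmod (z - x i))\<^sup>2)"
    by (intro prod.cong) auto
  ultimately show ?thesis
    unfolding eigen_density_def by (simp add: prod.distrib mult_ac del: fun_upd_apply) (simp add: mult_ac)
qed

lemma eigen_density_nonneg: "eigen_density U n ws x \<ge> 0"
  unfolding eigen_density_def by (intro mult_nonneg_nonneg prod_nonneg) (auto intro!: prod_list_nonneg)

lemma measurable_eigen_density:
  assumes U: "closed U" and x: "\<And>i. i < n \<Longrightarrow> (\<lambda>p. x p i) \<in> borel_measurable M"
    and z: "z \<in> borel_measurable M"
  shows "(\<lambda>p. eigen_density U n (z p # ws) (x p)) \<in> borel_measurable M"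
    and "(\<lambda>p. eigen_density U n ws (x p)) \<in> borel_measurable M"
proof -
  have w: "(\<lambda>p. \<Prod>w\<leftarrow>ws. (cmod (w - x p i))\<^sup>2) \<in> borel_measurable M" if "i < n" for i
    using x[OF that] by (induction ws) auto
  have g: "(\<lambda>p. gauss_weight U (x p i)) \<in> borel_measurable M" if "i < n" for i
    using measurable_compose[OF x[OF that] measurable_gauss_weight[OF U]] .
  have d: "(\<lambda>p. \<Prod>j<n. \<Prod>i<j. (cmod (x p j - x p i))\<^sup>2) \<in> borel_measurable M"
  proof (intro borel_measurable_prod)
    fix j i assume "j \<in> {..<n}" "i \<in> {..<j}"
    hence "i < n" "j < n" by auto
    thus "(\<lambda>p. (cmod (x p j - x p i))\<^sup>2) \<in> borel_measurable M" using x[of i] x[of j] by measurable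
  qed
  have zx: "(\<lambda>p. (cmod (z p - x p i))\<^sup>2) \<in> borel_measurable M" if "i < n" for i
    using x[OF that] z by measurable
  show "(\<lambda>p. eigen_density U n ws (x p)) \<in> borel_measurable M"
    unfolding eigen_density_def
    by (intro borel_measurable_times d borel_measurable_prod g w) auto
  show "(\<lambda>p. eigen_density U n (z p # ws) (x p)) \<in> borel_measurable M"
    unfolding eigen_density_def list.map prod_list.Cons
    by (intro borel_measurable_times d borel_measurable_prod g w zx) auto
qed

text \<open>Both sides obey the same recursion in \<open>n\<close>. The constant is quantified
  before \<open>ws\<close> so that the induction can pass to \<open>z # ws\<close>, and before
  \<open>U\<close> so that it can be evaluated at \<open>UNIV\<close> afterwards.\<close>

lemma spec_integral_eq_eigen_density:
  "\<exists>C::ennreal. \<forall>U ws. closed U \<longrightarrow>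
     spec_integral U n ws = C * (\<integral>\<^sup>+x. ennreal (eigen_density U n ws x) \<partial>lebC {..<n})"
proof (induction n)
  case 0
  have "spec_integral U 0 ws = (\<integral>\<^sup>+x. ennreal (eigen_density U 0 ws x) \<partial>lebC {..<0})" for U ws
  proof -
    have "chi 0 x = 1" for x
    proof -
      obtain a where a: "chi 0 x = [:a:]" using degree_chi[of 0 x] by (metis degree_eq_zeroE)
      thus ?thesis using lead_coeff_chi[of 0 x] by simp
    qed
    thus ?thesis
      by (simp add: spec_integral_def spec_weight_def eigen_density_def frob_def PiM_empty nn_integral_count_space_finite map_replicate_const)
  qed
  thus ?case by (intro exI[of _ 1]) simp
next
  case (Suc n)
  then obtain C :: ennreal where C: "\<And>U ws. closed U \<Longrightarrow>
     spec_integral U n ws = C * (\<integral>\<^sup>+x. ennreal (eigen_density U n ws x) \<partial>lebC {..<n})" by blast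
  obtain K :: ennreal where K: "\<And>U ws. closed U \<Longrightarrow> ennreal (Suc n) * spec_integral U (Suc n) ws =
     K * (\<integral>\<^sup>+z. ennreal ((if z \<in> U then 1 else 0) * (\<Prod>w\<leftarrow>ws. (cmod (w - z))\<^sup>2) * exp (- (cmod z)\<^sup>2))
            * spec_integral U n (z # ws) \<partial>lborel)"
    using spec_integral_recursion[of n] by blast
  have "spec_integral U (Suc n) ws = (ennreal (1 / Suc n) * (K * C)) * (\<integral>\<^sup>+x. ennreal (eigen_density U (Suc n) ws x) \<partial>lebC {..<Suc n})"
    if U: "closed U" for U ws
  proof -
    let ?M = "(lborel :: complex measure) \<Otimes>\<^sub>M lebC {..<n}"
    interpret V: sigma_finite_measure "lebC {..<n} :: (nat \<Rightarrow> complex) measure" by (rule sigma_finite_lebC) simp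
    have [simp]: "{..<Suc n} = insert n {..<n}" by auto
    define c where "c = (\<lambda>z. gauss_weight U z * (\<Prod>w\<leftarrow>ws. (cmod (w - z))\<^sup>2))"
    have c0: "c z \<ge> 0" for z unfolding c_def by (intro mult_nonneg_nonneg) (auto intro!: prod_list_nonneg)
    have cm[measurable]: "c \<in> borel_measurable borel"
    proof -
      have [measurable]: "(\<lambda>z. \<Prod>w\<leftarrow>ws. (cmod (w - z))\<^sup>2) \<in> borel_measurable borel" by (induction ws) auto
      have [measurable]: "gauss_weight U \<in> borel_measurable borel" by (rule measurable_gauss_weight[OF U])
      show ?thesis unfolding c_def by measurable
    qed
    define G where "G = (\<lambda>z. \<integral>\<^sup>+x. ennreal (eigen_density U n (z # ws) x) \<partial>lebC {..<n})"
    have xm: "(\<lambda>p. snd p i) \<in> borel_measurable ?M" if "i < n" for i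
      by (rule measurable_compose[OF measurable_snd]) (use that in auto)
    have "(\<lambda>p. eigen_density U n (fst p # ws) (snd p)) \<in> borel_measurable ?M"
      by (rule measurable_eigen_density(1)[OF U]) (use xm in auto)
    hence jm: "(\<lambda>(z, x). ennreal (eigen_density U n (z # ws) x)) \<in> borel_measurable ?M"
      unfolding case_prod_unfold by measurable
    have Gm[measurable]: "G \<in> borel_measurable borel"
      using V.borel_measurable_nn_integral[OF jm] by (simp add: G_def)
    have "(\<integral>\<^sup>+x. ennreal (eigen_density U (Suc n) ws x) \<partial>lebC {..<Suc n}) =
      (\<integral>\<^sup>+z. \<integral>\<^sup>+x. ennreal (eigen_density U (Suc n) ws (x(n := z))) \<partial>lebC {..<n} \<partial>lborel)"
    proof -
      have "(\<lambda>x. ennreal (eigen_density U (Suc n) ws x)) \<in> borel_measurable (lebC (insert n {..<n}))"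
        by (rule measurable_compose[OF measurable_eigen_density(2)[OF U, where x = "\<lambda>x. x" and z = "\<lambda>_. 0"] measurable_ennreal]) (auto simp: less_Suc_eq)
      thus ?thesis using lebC.product_nn_integral_insert_rev[of "{..<n}" n] by simp
    qed
    also have "\<dots> = (\<integral>\<^sup>+z. ennreal (c z) * G z \<partial>lborel)"
    proof (rule nn_integral_cong)
      fix z :: complex
      have m: "(\<lambda>x. ennreal (eigen_density U n (z # ws) x)) \<in> borel_measurable (lebC {..<n})"
        by (rule measurable_compose[OF measurable_eigen_density(2)[OF U, where x = "\<lambda>x. x" and z = "\<lambda>_. 0"] measurable_ennreal]) auto
      show "(\<integral>\<^sup>+x. ennreal (eigen_density U (Suc n) ws (x(n := z))) \<partial>lebC {..<n}) = ennreal (c z) * G z"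
      proof -
        have cz: "gauss_weight U z * (\<Prod>w\<leftarrow>ws. (cmod (w - z))\<^sup>2) = c z" by (simp add: c_def)
        show ?thesis
          unfolding eigen_density_Suc G_def cz nn_integral_cmult[OF m, symmetric]
          by (simp add: ennreal_mult c0 eigen_density_nonneg)
      qed
    qed
    finally have e: "(\<integral>\<^sup>+x. ennreal (eigen_density U (Suc n) ws x) \<partial>lebC {..<Suc n}) = (\<integral>\<^sup>+z. ennreal (c z) * G z \<partial>lborel)" .
    have "ennreal (Suc n) * spec_integral U (Suc n) ws = K * (\<integral>\<^sup>+z. C * (ennreal (c z) * G z) \<partial>lborel)"
    proof -
      have "spec_integral U n (z # ws) = C * G z" for z by (simp add: C[OF U] G_def)
      thus ?thesis unfolding K[OF U]
        by (intro arg_cong[of _ _ "times K"] nn_integral_cong) (simp add: c_def gauss_weight_def mult_ac)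
    qed
    also have "(\<integral>\<^sup>+z. C * (ennreal (c z) * G z) \<partial>lborel) = C * (\<integral>\<^sup>+z. ennreal (c z) * G z \<partial>lborel)"
      by (rule nn_integral_cmult) measurable
    finally have f: "ennreal (Suc n) * spec_integral U (Suc n) ws = K * (C * (\<integral>\<^sup>+z. ennreal (c z) * G z \<partial>lborel))" .
    have "ennreal (1 / Suc n) * ennreal (Suc n) = 1"
      by (subst ennreal_mult[symmetric]) auto
    hence "spec_integral U (Suc n) ws = ennreal (1 / Suc n) * (ennreal (Suc n) * spec_integral U (Suc n) ws)"
      by (simp only: mult.assoc[symmetric] mult_1)
    thus ?thesis unfolding f e by (simp only: mult.assoc)
  qed
  thus ?case by blast
qed

section \<open>Rotational averages of the squared Vandermonde determinant\<close>

definition radial_mass :: "complex set \<Rightarrow> nat \<Rightarrow> real"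
  where "radial_mass U k = (\<integral>z. gauss_weight U z * (cmod z)\<^sup>2 ^ k \<partial>lborel)"

lemma distr_lborel_rotation:
  assumes s: "cmod s = 1"
  shows "distr lborel borel (\<lambda>z. s * z) = lborel"
proof (rule measure_eqI)
  fix E assume "E \<in> sets (distr lborel borel (\<lambda>z. s * z))"
  hence E[measurable]: "E \<in> sets borel" by simp
  have "s \<noteq> 0" using s by auto
  have "emeasure (distr lborel borel (\<lambda>z. s * z)) E = (\<integral>\<^sup>+z. indicator E z \<partial>(distr lborel borel (\<lambda>z. s * z)))"
    by simp
  also have "\<dots> = (\<integral>\<^sup>+z. indicator E (0 + s * z) \<partial>lborel)"
    by (subst nn_integral_distr) auto
  also have "\<dots> = emeasure lborel E"
    using nn_integral_complex_affine[OF \<open>s \<noteq> 0\<close>, of "indicator E" 0] s by simp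
  finally show "emeasure (distr lborel borel (\<lambda>z. s * z)) E = emeasure lborel E" .
qed simp

lemma integrable_gauss_monomial:
  assumes U: "closed U"
  shows "integrable lborel (\<lambda>z. of_real (gauss_weight U z) * z ^ a * cnj z ^ b)"
proof (rule integrableI_bounded)
  have [measurable]: "gauss_weight U \<in> borel_measurable borel" by (rule measurable_gauss_weight[OF U])
  have [measurable]: "cnj \<in> borel_measurable borel"
    by (intro borel_measurable_continuous_onI continuous_intros)
  show "(\<lambda>z. of_real (gauss_weight U z) * z ^ a * cnj z ^ b) \<in> borel_measurable lborel" by measurable
  have bd: "ennreal (cmod (of_real (gauss_weight U z) * z ^ a * cnj z ^ b)) \<le>
     ennreal ((cmod z)\<^sup>2 ^ a * exp (- (cmod z)\<^sup>2)) + ennreal ((cmod z)\<^sup>2 ^ b * exp (- (cmod z)\<^sup>2))" for z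
  proof -
    have "gauss_weight U z \<le> exp (- (cmod z)\<^sup>2)" by (simp add: gauss_weight_def)
    \<comment> \<open>The arithmetic-geometric inequality reduces the mixed power to the even
      moments of \<open>nn_integral_gauss_moment\<close>.\<close>
    moreover have "cmod z ^ a * cmod z ^ b \<le> (cmod z)\<^sup>2 ^ a + (cmod z)\<^sup>2 ^ b"
    proof -
      have "0 \<le> (cmod z ^ a - cmod z ^ b)\<^sup>2 + (cmod z ^ a)\<^sup>2 + (cmod z ^ b)\<^sup>2" by simp
      hence "2 * (cmod z ^ a * cmod z ^ b) \<le> 2 * ((cmod z ^ a)\<^sup>2 + (cmod z ^ b)\<^sup>2)"
        by (simp add: power2_eq_square algebra_simps)
      thus ?thesis by (simp add: power_mult[symmetric] mult.commute)
    qed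
    ultimately have "gauss_weight U z * (cmod z ^ a * cmod z ^ b) \<le> exp (- (cmod z)\<^sup>2) * ((cmod z)\<^sup>2 ^ a + (cmod z)\<^sup>2 ^ b)"
      by (intro mult_mono) auto
    hence "cmod (of_real (gauss_weight U z) * z ^ a * cnj z ^ b) \<le> (cmod z)\<^sup>2 ^ a * exp (- (cmod z)\<^sup>2) + (cmod z)\<^sup>2 ^ b * exp (- (cmod z)\<^sup>2)"
      by (simp add: norm_mult norm_power algebra_simps)
    hence "ennreal (cmod (of_real (gauss_weight U z) * z ^ a * cnj z ^ b)) \<le>
        ennreal ((cmod z)\<^sup>2 ^ a * exp (- (cmod z)\<^sup>2) + (cmod z)\<^sup>2 ^ b * exp (- (cmod z)\<^sup>2))"
      by (rule ennreal_leI)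
    also have "\<dots> = ennreal ((cmod z)\<^sup>2 ^ a * exp (- (cmod z)\<^sup>2)) + ennreal ((cmod z)\<^sup>2 ^ b * exp (- (cmod z)\<^sup>2))"
      by (rule ennreal_plus) auto
    finally show ?thesis .
  qed
  have "(\<integral>\<^sup>+z. ennreal (cmod (of_real (gauss_weight U z) * z ^ a * cnj z ^ b)) \<partial>lborel) \<le>
     (\<integral>\<^sup>+z. ennreal ((cmod z)\<^sup>2 ^ a * exp (- (cmod z)\<^sup>2)) + ennreal ((cmod z)\<^sup>2 ^ b * exp (- (cmod z)\<^sup>2)) \<partial>lborel)"
    by (intro nn_integral_mono bd)
  also have "\<dots> = ennreal (pi * fact a) + ennreal (pi * fact b)"
    by (subst nn_integral_add) (simp_all add: nn_integral_gauss_moment)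
  also have "\<dots> < \<infinity>" by simp
  finally show "(\<integral>\<^sup>+z. ennreal (cmod (of_real (gauss_weight U z) * z ^ a * cnj z ^ b)) \<partial>lborel) < \<infinity>" .
qed

text \<open>A rotation by \<open>s\<close> preserves the weight and Lebesgue measure but multiplies
  the monomial by \<open>s ^ a * cnj s ^ b\<close>. For distinct exponents some \<open>s\<close>
  makes this factor -1, so the integral equals its own negative.\<close>

lemma integral_gauss_monomial:
  assumes U: "closed U" and rad: "\<And>s z. cmod s = 1 \<Longrightarrow> z \<in> U \<Longrightarrow> s * z \<in> U"
  shows "(\<integral>z. of_real (gauss_weight U z) * z ^ a * cnj z ^ b \<partial>lborel) = (if a = b then of_real (radial_mass U a) else 0)"
proof (cases "a = b")
  case True
  have "of_real (gauss_weight U z) * z ^ a * cnj z ^ a = of_real (gauss_weight U z * (cmod z)\<^sup>2 ^ a)" for z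
    by (simp add: mult.assoc power_mult_distrib[symmetric] complex_norm_square[symmetric] del: of_real_power)
       (simp add: of_real_power)
  hence "(\<integral>z. of_real (gauss_weight U z) * z ^ a * cnj z ^ b \<partial>lborel) = of_real (radial_mass U a)"
    unfolding radial_mass_def True[symmetric] by (simp only: integral_complex_of_real)
  thus ?thesis using True by simp
next
  case False
  define f where "f = (\<lambda>z. of_real (gauss_weight U z) * z ^ a * cnj z ^ b)"
  \<comment> \<open>The angle is chosen so that the factor becomes \<open>cis pi\<close>; the
    difference is real, so either exponent may be the larger one.\<close>
  define s where "s = cis (pi / (real a - real b))"
  have s: "cmod s = 1" by (simp add: s_def)
  have "s ^ a * cnj s ^ b = cis (real a * (pi / (real a - real b)) + real b * (- (pi / (real a - real b))))"
    unfolding s_def cis_cnj Complex.DeMoivre cis_mult ..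
  also have "real a * (pi / (real a - real b)) + real b * (- (pi / (real a - real b))) = pi"
  proof -
    have e: "real a * t + real b * (- t) = (real a - real b) * t" for t by (simp add: left_diff_distrib)
    show ?thesis unfolding e using False by simp
  qed
  finally have sab: "s ^ a * cnj s ^ b = - 1" by simp
  have memU: "s * z \<in> U \<longleftrightarrow> z \<in> U" for z
  proof
    assume "s * z \<in> U"
    hence "inverse s * (s * z) \<in> U" by (rule rad[rotated]) (simp add: norm_inverse s)
    moreover have "s \<noteq> 0" using s by auto
    hence "inverse s * (s * z) = z" by (simp add: mult.assoc[symmetric])
    ultimately show "z \<in> U" by (simp only:)
  qed (rule rad[OF s])
  have fs: "f (s * z) = - f z" for z
  proof -
    have "gauss_weight U (s * z) = gauss_weight U z"
      by (simp add: gauss_weight_def memU norm_mult s)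
    hence "f (s * z) = (s ^ a * cnj s ^ b) * f z" by (simp add: f_def power_mult_distrib mult_ac)
    thus ?thesis by (simp add: sab)
  qed
  have fm: "f \<in> borel_measurable borel"
    using integrable_gauss_monomial[OF U, of a b] by (simp add: f_def integrable_iff_bounded)
  have "(\<integral>z. f z \<partial>lborel) = (\<integral>z. f z \<partial>(distr lborel borel (\<lambda>z. s * z)))"
    by (simp add: distr_lborel_rotation[OF s])
  also have "\<dots> = (\<integral>z. f (s * z) \<partial>lborel)"
    by (rule integral_distr[OF _ fm]) measurable
  also have "\<dots> = - (\<integral>z. f z \<partial>lborel)" by (simp add: fs)
  finally show ?thesis using False by (simp add: f_def)
qed

text \<open>Expanding the Vandermonde determinant and its conjugate over permutations gives products
  of monomials in one variable each. By \<open>integral_gauss_monomial\<close> only pairs of equal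
  permutations survive, and each of the \<open>fact n\<close> of them contributes the same
  product.\<close>

lemma nn_integral_eigen_density:
  assumes U: "closed U" and rad: "\<And>s z. cmod s = 1 \<Longrightarrow> z \<in> U \<Longrightarrow> s * z \<in> U"
  shows "(\<integral>\<^sup>+x. ennreal (eigen_density U n [] x) \<partial>lebC {..<n}) = ennreal (fact n * (\<Prod>k<n. radial_mass U k))"
proof -
  let ?S = "{p. p permutes {0..<n}}"
  have finS: "finite ?S" by (simp add: finite_permutations)
  define cross where "cross = (\<lambda>p q (x :: nat \<Rightarrow> complex). \<Prod>i<n. of_real (gauss_weight U (x i)) * x i ^ p i * cnj (x i) ^ q i)"
  have expand: "complex_of_real (eigen_density U n [] x) = (\<Sum>p\<in>?S. \<Sum>q\<in>?S. signof p * signof q * cross p q x)" for x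
  proof -
    define V where "V = Determinant.det (Matrix.mat n n (\<lambda>(i, j). x i ^ j))"
    have V: "V = (\<Sum>p\<in>?S. signof p * (\<Prod>i<n. x i ^ p i))"
      unfolding V_def by (subst det_def'[of _ n]) (auto simp: atLeast0LessThan permutes_def intro!: sum.cong prod.cong dest: permutes_in_image)
    have sg: "cnj (signof p) = signof p" for p :: "nat \<Rightarrow> nat" by (simp add: sign_def)
    have cV: "cnj V = (\<Sum>p\<in>?S. signof p * (\<Prod>i<n. cnj (x i) ^ p i))"
      unfolding V by (simp add: cnj_sum cnj_prod sg)
    have "(\<Prod>j<n. \<Prod>i<j. (cmod (x j - x i))\<^sup>2) = (cmod V)\<^sup>2"
      unfolding V_def vandermonde_det by (simp add: prod_norm[symmetric] prod_power_distrib)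
    hence "complex_of_real (eigen_density U n [] x) = of_real (\<Prod>i<n. gauss_weight U (x i)) * (V * cnj V)"
      by (simp add: eigen_density_def complex_norm_square[symmetric])
    also have "\<dots> = (\<Sum>p\<in>?S. \<Sum>q\<in>?S. signof p * signof q * cross p q x)"
      unfolding cV unfolding V unfolding sum_product unfolding cross_def sum_distrib_left
      by (intro sum.cong refl) (simp add: prod.distrib mult_ac)
    finally show ?thesis .
  qed
  have tint: "integrable (lebC {..<n}) (cross p q)" for p q
    unfolding cross_def
    by (rule lebC.product_integrable_prod[of "{..<n}" "\<lambda>i z. of_real (gauss_weight U z) * z ^ p i * cnj z ^ q i"])
       (auto intro: integrable_gauss_monomial[OF U])
  have tval: "(\<integral>x. cross p q x \<partial>lebC {..<n}) = (if p = q then of_real (\<Prod>k<n. radial_mass U k) else 0)"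
    if pq: "p \<in> ?S" "q \<in> ?S" for p q
  proof -
    have "(\<integral>x. cross p q x \<partial>lebC {..<n}) = (\<Prod>i<n. \<integral>z. of_real (gauss_weight U z) * z ^ p i * cnj z ^ q i \<partial>lborel)"
      unfolding cross_def
      by (rule lebC.product_integral_prod[of "{..<n}" "\<lambda>i z. of_real (gauss_weight U z) * z ^ p i * cnj z ^ q i"])
         (auto intro: integrable_gauss_monomial[OF U])
    also have "\<dots> = (\<Prod>i<n. if p i = q i then of_real (radial_mass U (p i)) else 0)"
      by (intro prod.cong refl integral_gauss_monomial[OF U rad])
    also have "\<dots> = (if p = q then of_real (\<Prod>k<n. radial_mass U k) else 0)"
    proof (cases "p = q")
      case True
      have "(\<Prod>i<n. radial_mass U (p i)) = (\<Prod>k<n. radial_mass U k)"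
        using prod.permute[of p "{..<n}" "radial_mass U"] pq(1) by (simp add: o_def atLeast0LessThan)
      thus ?thesis using True by (simp flip: of_real_prod)
    next
      case False
      then obtain i where i: "p i \<noteq> q i" by auto
      have "i < n"
      proof (rule ccontr)
        assume "\<not> i < n"
        hence "p i = i" "q i = i" using pq by (auto intro!: permutes_not_in)
        thus False using i by simp
      qed
      hence "(\<Prod>i<n. if p i = q i then complex_of_real (radial_mass U (p i)) else 0) = 0"
        using i by (intro prod_zero) auto
      thus ?thesis using False by simp
    qed
    finally show ?thesis .
  qed
  have int: "integrable (lebC {..<n}) (\<lambda>x. complex_of_real (eigen_density U n [] x))"
    unfolding expand by (intro Bochner_Integration.integrable_sum integrable_mult_right tint)
  have "(\<integral>x. complex_of_real (eigen_density U n [] x) \<partial>lebC {..<n}) =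
     (\<Sum>p\<in>?S. \<Sum>q\<in>?S. signof p * signof q * (if p = q then of_real (\<Prod>k<n. radial_mass U k) else 0))"
    unfolding expand
    by (subst Bochner_Integration.integral_sum, intro Bochner_Integration.integrable_sum integrable_mult_right tint,
        intro sum.cong refl, subst Bochner_Integration.integral_sum, intro integrable_mult_right tint,
        intro sum.cong refl) (simp add: tval)
  also have "\<dots> = (\<Sum>p\<in>?S. of_real (\<Prod>k<n. radial_mass U k))"
  proof (intro sum.cong refl)
    fix p assume "p \<in> ?S"
    hence "(\<Sum>q\<in>?S. signof p * signof q * (if p = q then complex_of_real (\<Prod>k<n. radial_mass U k) else 0))
       = signof p * signof p * of_real (\<Prod>k<n. radial_mass U k)"
      using finS by (subst sum.remove[of _ p]) (auto intro!: sum.neutral split: if_splits)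
    moreover have "signof p * signof p = (1 :: complex)" by (simp add: sign_def)
    ultimately show "(\<Sum>q\<in>?S. signof p * signof q * (if p = q then complex_of_real (\<Prod>k<n. radial_mass U k) else 0))
       = of_real (\<Prod>k<n. radial_mass U k)" by simp
  qed
  also have "\<dots> = of_real (fact n * (\<Prod>k<n. radial_mass U k))"
    by (simp add: card_permutations[of "{0..<n}" n])
  finally have "(\<integral>x. complex_of_real (eigen_density U n [] x) \<partial>lebC {..<n}) = of_real (fact n * (\<Prod>k<n. radial_mass U k))" .
  hence val: "(\<integral>x. eigen_density U n [] x \<partial>lebC {..<n}) = fact n * (\<Prod>k<n. radial_mass U k)"
    by (simp only: integral_complex_of_real of_real_eq_iff)
  have "integrable (lebC {..<n}) (eigen_density U n [])"
    using int by (simp add: complex_of_real_integrable_eq)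
  from nn_integral_eq_integral[OF this] show ?thesis using val eigen_density_nonneg by simp
qed


lemma ennreal_radial_mass:
  assumes U: "closed U"
  shows "ennreal (radial_mass U k) = (\<integral>\<^sup>+z. ennreal (gauss_weight U z * (cmod z)\<^sup>2 ^ k) \<partial>lborel)"
proof -
  have "of_real (gauss_weight U z) * z ^ k * cnj z ^ k = complex_of_real (gauss_weight U z * (cmod z)\<^sup>2 ^ k)" for z
    by (simp add: mult.assoc power_mult_distrib[symmetric] complex_norm_square[symmetric] del: of_real_power)
       (simp add: of_real_power)
  with integrable_gauss_monomial[OF U, of k k]
  have "integrable lborel (\<lambda>z. complex_of_real (gauss_weight U z * (cmod z)\<^sup>2 ^ k))"
    by (simp only:)
  hence "integrable lborel (\<lambda>z. gauss_weight U z * (cmod z)\<^sup>2 ^ k)"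
    by (simp only: complex_of_real_integrable_eq)
  from nn_integral_eq_integral[OF this] show ?thesis unfolding radial_mass_def by simp
qed

lemma radial_mass_nonneg [simp]: "radial_mass U k \<ge> 0"
  unfolding radial_mass_def by (rule Bochner_Integration.integral_nonneg) simp

lemma radial_mass_UNIV: "radial_mass UNIV k = pi * fact k"
proof -
  have "ennreal (radial_mass UNIV k) = ennreal (pi * fact k)"
    using ennreal_radial_mass[of UNIV k] nn_integral_gauss_moment[of k]
    by (simp add: gauss_weight_def mult.commute)
  thus ?thesis by (subst (asm) ennreal_inj) auto
qed

lemma radial_mass_le: "closed U \<Longrightarrow> radial_mass U k \<le> pi * fact k"
proof -
  assume U: "closed U"
  have "ennreal (radial_mass U k) \<le> ennreal (radial_mass UNIV k)"
    unfolding ennreal_radial_mass[OF U] ennreal_radial_mass[OF closed_UNIV]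
    by (intro nn_integral_mono ennreal_leI mult_right_mono) (auto simp: gauss_weight_def)
  thus ?thesis by (simp add: radial_mass_UNIV)
qed

text \<open>The unknown constant is found from \<open>U = UNIV\<close>, where the left side is the
  total Gaussian mass \<open>pi ^ (n * n)\<close> and the radial masses are
  \<open>pi * fact k\<close>.\<close>

lemma spec_integral_product:
  assumes U: "closed U" and rad: "\<And>s z. cmod s = 1 \<Longrightarrow> z \<in> U \<Longrightarrow> s * z \<in> U"
  shows "spec_integral U n [] = ennreal (pi ^ (n * n) * (\<Prod>k<n. radial_mass U k / (pi * fact k)))"
proof -
  obtain C :: ennreal where C: "\<And>U ws. closed U \<Longrightarrow>
     spec_integral U n ws = C * (\<integral>\<^sup>+x. ennreal (eigen_density U n ws x) \<partial>lebC {..<n})"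
    using spec_integral_eq_eigen_density[of n] by blast
  define A where "A = fact n * (\<Prod>k<n. pi * fact k :: real)"
  have A: "A > 0" unfolding A_def by (intro mult_pos_pos prod_pos) auto
  have "ennreal (pi ^ (n * n)) = spec_integral UNIV n []"
    by (simp add: spec_integral_def spec_weight_def nn_integral_exp_frob)
  also have "\<dots> = C * ennreal A"
    unfolding C[OF closed_UNIV] by (subst nn_integral_eigen_density) (auto simp: radial_mass_UNIV A_def)
  finally have CA: "C * ennreal A = ennreal (pi ^ (n * n))" by simp
  have "C = C * (ennreal A * ennreal (1 / A))"
    using A by (subst ennreal_mult[symmetric]) auto
  also have "\<dots> = ennreal (pi ^ (n * n) / A)"
    unfolding mult.assoc[symmetric] CA using A by (subst ennreal_mult[symmetric]) auto
  finally have C_eq: "C = ennreal (pi ^ (n * n) / A)" .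
  have "spec_integral U n [] = C * ennreal (fact n * (\<Prod>k<n. radial_mass U k))"
    unfolding C[OF U] by (subst nn_integral_eigen_density[OF U rad]) auto
  also have "\<dots> = ennreal (pi ^ (n * n) / A * (fact n * (\<Prod>k<n. radial_mass U k)))"
    unfolding C_eq using A by (subst ennreal_mult) (auto intro!: prod_nonneg mult_nonneg_nonneg)
  also have "pi ^ (n * n) / A * (fact n * (\<Prod>k<n. radial_mass U k)) = pi ^ (n * n) * (\<Prod>k<n. radial_mass U k / (pi * fact k))"
    by (simp add: A_def prod_dividef)
  finally show ?thesis .
qed

text \<open>Under the normalised weight \<open>|z|^2k exp (-|z|^2)\<close> the squared modulus has
  the Erlang law with rate 1 and shape \<open>k + 1\<close>; the index of \<open>erlang_CDF\<close>
  is the shape minus one.\<close>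

lemma radial_mass_cball:
  assumes "R \<ge> 0"
  shows "radial_mass {z. cmod z \<le> R} k / (pi * fact k) = erlang_CDF k 1 (R\<^sup>2)"
proof -
  have U: "closed {z::complex. cmod z \<le> R}" by (intro closed_Collect_le continuous_intros)
  have "ennreal (radial_mass {z. cmod z \<le> R} k) =
     (\<integral>\<^sup>+z. ennreal ((if (cmod z)\<^sup>2 \<le> R\<^sup>2 then 1 else 0) * exp (- (cmod z)\<^sup>2) * (cmod z)\<^sup>2 ^ k) \<partial>lborel)"
    unfolding ennreal_radial_mass[OF U] using assms
    by (intro nn_integral_cong) (auto simp: gauss_weight_def abs_le_square_iff[symmetric])
  also have "\<dots> = ennreal pi * (\<integral>\<^sup>+t. ennreal ((if t \<le> R\<^sup>2 then 1 else 0) * exp (- t) * t ^ k) * indicator {0..} t \<partial>lborel)"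
    by (rule nn_integral_radial[of "\<lambda>t. ennreal ((if t \<le> R\<^sup>2 then 1 else 0) * exp (- t) * t ^ k)"]) measurable
  also have "\<dots> = ennreal pi * (\<integral>\<^sup>+t. ennreal (fact k) * (ennreal (erlang_density k 1 t) * indicator {..R\<^sup>2} t) \<partial>lborel)"
    by (intro arg_cong[of _ _ "times (ennreal pi)"] nn_integral_cong)
       (auto simp: erlang_density_def indicator_def ennreal_mult'[symmetric])
  also have "\<dots> = ennreal pi * (ennreal (fact k) * ennreal (erlang_CDF k 1 (R\<^sup>2)))"
    by (subst nn_integral_cmult) (auto simp: nn_integral_erlang_density)
  also have "\<dots> = ennreal (pi * fact k * erlang_CDF k 1 (R\<^sup>2))"
    by (simp add: ennreal_mult' mult.assoc)
  finally have "radial_mass {z. cmod z \<le> R} k = pi * fact k * erlang_CDF k 1 (R\<^sup>2)"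
    by (subst (asm) ennreal_inj) auto
  thus ?thesis by simp
qed

text \<open>Markov's inequality: on the set \<open>|z|^2 / r^2\<close> is at least 1, and the
  Gaussian integral of \<open>|z|^2\<close> over the plane is \<open>pi\<close>.\<close>

lemma radial_mass_outside:
  assumes "r > 0"
  shows "radial_mass {z. r \<le> cmod z} 0 / pi \<le> 1 / r\<^sup>2"
proof -
  have U: "closed {z::complex. r \<le> cmod z}" by (intro closed_Collect_le continuous_intros)
  have "ennreal (radial_mass {z. r \<le> cmod z} 0) \<le> (\<integral>\<^sup>+z. ennreal (1 / r\<^sup>2) * ennreal ((cmod z)\<^sup>2 ^ 1 * exp (- (cmod z)\<^sup>2)) \<partial>lborel)"
    unfolding ennreal_radial_mass[OF U]
  proof (rule nn_integral_mono)
    fix z :: complex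
    have "gauss_weight {z. r \<le> cmod z} z * (cmod z)\<^sup>2 ^ 0 \<le> 1 / r\<^sup>2 * ((cmod z)\<^sup>2 ^ 1 * exp (- (cmod z)\<^sup>2))"
    proof (cases "r \<le> cmod z")
      case True
      hence "1 \<le> (cmod z)\<^sup>2 / r\<^sup>2" using assms by (simp add: power_mono)
      from mult_right_mono[OF this, of "exp (- (cmod z)\<^sup>2)"] show ?thesis
        using True by (simp add: gauss_weight_def)
    qed (simp add: gauss_weight_def)
    thus "ennreal (gauss_weight {z. r \<le> cmod z} z * (cmod z)\<^sup>2 ^ 0) \<le> ennreal (1 / r\<^sup>2) * ennreal ((cmod z)\<^sup>2 ^ 1 * exp (- (cmod z)\<^sup>2))"
      by (subst ennreal_mult[symmetric]) (auto intro: ennreal_leI)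
  qed
  also have "\<dots> = ennreal (1 / r\<^sup>2 * pi)"
    using nn_integral_gauss_moment[of 1] by (subst nn_integral_cmult) (auto simp: ennreal_mult'[symmetric])
  finally have "radial_mass {z. r \<le> cmod z} 0 \<le> 1 / r\<^sup>2 * pi" by (subst (asm) ennreal_le_iff) auto
  thus ?thesis by (simp add: field_simps)
qed

section \<open>Asymptotics of the Erlang products\<close>

text \<open>From \<open>n\<close> to \<open>n + 1\<close> the right side grows by the factor
  \<open>(n + 1) (1 + 1/n)^(n + 1/2) / e\<close>, so the induction step is the bound
  \<open>e <= (1 + 1/n)^(n + 1/2)\<close>. Equality at \<open>n = 1\<close> explains the constant
  \<open>exp 1\<close>.\<close>

lemma fact_le_stirling:
  assumes "n \<ge> 1"
  shows "fact n \<le> exp 1 * sqrt (real n) * real n ^ n * exp (- real n)"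
  using assms
proof (induction n rule: dec_induct)
  case base
  show ?case by (simp add: exp_minus)
next
  case (step n)
  have n: "n > 0" using step.hyps by simp
  define x where "x = (real n + 1) / real n"
  have x: "x > 1" using n by (simp add: x_def)
  \<comment> \<open>For \<open>x = 1 + 1/n\<close> this bound reads
    \<open>1 / (n + 1/2) <= ln x\<close>, which is exactly what the exponent \<open>n + 1/2\<close>
    requires.\<close>
  have "2 * ((x - 1) / (x + 1)) \<le> ln x"
    using ln_approx_bounds[of x 1] x by simp
  also have "(x - 1) / (x + 1) = 1 / (2 * real n + 1)"
  proof -
    have "x = 1 + 1 / real n" using n by (simp add: x_def add_divide_distrib)
    hence "x - 1 = 1 / real n" "x + 1 = (2 * real n + 1) / real n"
      using n by (simp_all add: add_divide_distrib)
    hence "(x - 1) / (x + 1) = (1 / real n) / ((2 * real n + 1) / real n)" by (simp only:)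
    moreover have "(1 / m) / (c / m) = 1 / c" if "m \<noteq> 0" for m c :: real using that by simp
    from this[of "real n" "2 * real n + 1"] have "(1 / real n) / ((2 * real n + 1) / real n) = 1 / (2 * real n + 1)"
      using n by (simp only: of_nat_eq_0_iff neq0_conv)
    ultimately show ?thesis by (rule trans)
  qed
  finally have "(real n + 1 / 2) * (2 * (1 / (2 * real n + 1))) \<le> (real n + 1 / 2) * ln x"
    by (intro mult_left_mono) auto
  moreover have "(real n + 1 / 2) * (2 * (1 / (2 * real n + 1))) = 1"
  proof -
    define c where "c = 2 * real n + 1"
    have "real n + 1 / 2 = c / 2" "c > 0" by (simp_all add: c_def)
    thus ?thesis unfolding c_def[symmetric] by simp
  qed
  ultimately have lx: "1 \<le> (real n + 1 / 2) * ln x" by (simp only:)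
  have "exp 1 \<le> exp ((real n + 1 / 2) * ln x)" using lx by simp
  also have "\<dots> = x ^ n * sqrt x"
    using x by (simp add: distrib_right exp_add ln_sqrt[symmetric] exp_of_nat_mult)
  also have "\<dots> = (real n + 1) ^ n / real n ^ n * (sqrt (real n + 1) / sqrt (real n))"
    by (simp add: x_def power_divide real_sqrt_divide)
  finally have key: "exp 1 * real n ^ n * sqrt (real n) \<le> (real n + 1) ^ n * sqrt (real n + 1)"
    using n by (simp add: field_simps)
  have "fact (Suc n) = (real n + 1) * fact n" by (simp add: add.commute)
  also have "\<dots> \<le> (real n + 1) * (exp 1 * sqrt (real n) * real n ^ n * exp (- real n))"
    by (intro mult_left_mono step.IH) auto
  also have "\<dots> = (real n + 1) * exp (- real n) * (exp 1 * real n ^ n * sqrt (real n))" by simp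
  also have "\<dots> \<le> (real n + 1) * exp (- real n) * ((real n + 1) ^ n * sqrt (real n + 1))"
    by (intro mult_left_mono key) auto
  also have "\<dots> = exp 1 * sqrt (real (Suc n)) * real (Suc n) ^ Suc n * exp (- real (Suc n))"
  proof -
    have "exp (- real n) = exp 1 * exp (- real (Suc n))" by (simp add: exp_add[symmetric])
    thus ?thesis by (simp only: of_nat_Suc power_Suc add.commute[of 1] mult_ac)
  qed
  finally show ?case .
qed

text \<open>This is the Poisson probability of \<open>N - i\<close> for mean \<open>N\<close>. The
  one of \<open>N\<close> is at least \<open>1 / (e sqrt N)\<close> by
  \<open>fact_le_stirling\<close>; passing to \<open>N - i\<close> costs at most the factor
  \<open>(1 - i/N)^i\<close>, which by Bernoulli's inequality is at least
  \<open>1 - i^2/N >= 3/4\<close>.\<close>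

lemma poisson_term_ge:
  assumes N: "N \<ge> 1" and i: "2 * real i \<le> sqrt (real N)"
  shows "real N ^ (N - i) * exp (- real N) / fact (N - i) \<ge> 3 / (4 * exp 1 * sqrt (real N))"
proof -
  have i2: "4 * (real i)\<^sup>2 \<le> real N"
  proof -
    have "(2 * real i)\<^sup>2 \<le> (sqrt (real N))\<^sup>2" using i by (intro power_mono) auto
    thus ?thesis by (simp add: power_mult_distrib)
  qed
  have "real i \<le> (real i)\<^sup>2" by (cases i) (auto simp: power2_eq_square)
  hence "real i \<le> real N" using i2 zero_le_power2[of "real i"] by linarith
  hence iN: "i \<le> N" by simp
  have ratio: "fact N / fact (N - i) \<ge> (real N - real i) ^ i"
    using iN
  proof (induction i)
    case (Suc i)
    have "(real N - real (Suc i)) ^ Suc i \<le> (real N - real i) * (real N - real i) ^ i"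
      using Suc.prems by (simp del: of_nat_Suc) (intro mult_mono power_mono, auto)
    also have "\<dots> \<le> (real N - real i) * (fact N / fact (N - i))"
      using Suc by (intro mult_left_mono) auto
    also have "fact (N - i) = (real N - real i) * fact (N - Suc i)"
      using Suc.prems by (simp add: fact_reduce[of "N - i"] of_nat_diff)
    also have "(real N - real i) * (fact N / ((real N - real i) * fact (N - Suc i))) = fact N / fact (N - Suc i)"
      using Suc.prems by simp
    finally show ?case .
  qed simp
  have "1 + real i * (- (real i / real N)) \<le> (1 + (- (real i / real N))) ^ i"
    using iN N by (intro Bernoulli_inequality) (simp add: field_simps)
  hence b: "1 - (real i)\<^sup>2 / real N \<le> (1 - real i / real N) ^ i" by (simp add: power2_eq_square)
  have "3 / 4 \<le> 1 - (real i)\<^sup>2 / real N" using i2 N by (simp add: field_simps)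
  with b have c: "3 / 4 \<le> (1 - real i / real N) ^ i" by simp
  have "real N ^ N = real N ^ (N - i) * real N ^ i" using iN by (simp add: power_add[symmetric])
  hence "real N ^ (N - i) / fact (N - i) = (real N ^ N / fact N) * (fact N / fact (N - i) / real N ^ i)"
    using N by simp
  also have "\<dots> \<ge> (real N ^ N / fact N) * ((real N - real i) ^ i / real N ^ i)"
    by (intro mult_left_mono divide_right_mono ratio) auto
  also have "(real N - real i) ^ i / real N ^ i = (1 - real i / real N) ^ i"
    using N by (simp add: power_divide[symmetric] diff_divide_distrib)
  finally have d: "real N ^ (N - i) / fact (N - i) \<ge> (real N ^ N / fact N) * (3 / 4)"
    using mult_left_mono[OF c, of "real N ^ N / fact N"] by simp
  have "real N ^ N * exp (- real N) / fact N \<ge> 1 / (exp 1 * sqrt (real N))"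
    using fact_le_stirling[OF N] N by (simp add: field_simps)
  hence "3 / 4 * (1 / (exp 1 * sqrt (real N))) \<le> 3 / 4 * (real N ^ N * exp (- real N) / fact N)"
    by (intro mult_left_mono) auto
  also have "\<dots> = (real N ^ N / fact N) * (3 / 4) * exp (- real N)" by simp
  also have "\<dots> \<le> real N ^ (N - i) / fact (N - i) * exp (- real N)" by (intro mult_right_mono d) auto
  finally show ?thesis by (simp add: field_simps)
qed

text \<open>The defect is the probability that a Poisson variable of mean \<open>N\<close> is at
  most \<open>k\<close>. The values \<open>N - i\<close> with \<open>i\<close> from \<open>m\<close>
  to about \<open>sqrt N / 2\<close> number at least \<open>sqrt N / 4\<close>, and each has
  probability at least \<open>3 / (4 e sqrt N)\<close>.\<close>

lemma erlang_CDF_le_near_mean: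
  assumes N: "N \<ge> 1" and m: "4 * real m \<le> sqrt (real N)" and k: "N - m \<le> k"
  shows "erlang_CDF k 1 (real N) \<le> 1 - 3 / (16 * exp 1)"
proof -
  define L where "L = nat \<lfloor>sqrt (real N) / 2\<rfloor>"
  have "real L = of_int \<lfloor>sqrt (real N) / 2\<rfloor>" by (simp add: L_def)
  hence L: "2 * real L \<le> sqrt (real N)" "sqrt (real N) / 2 < real L + 1"
    using floor_correct[of "sqrt (real N) / 2"] by simp_all
  have LN: "L \<le> N"
  proof -
    have "sqrt (real N) * 1 \<le> sqrt (real N) * sqrt (real N)" using N by (intro mult_left_mono) auto
    hence "2 * real L \<le> real N" using L by simp
    thus ?thesis by simp
  qed
  let ?f = "\<lambda>j. real N ^ j * exp (- real N) / fact j"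
  have "3 / (16 * exp 1) = (sqrt (real N) / 4) * (3 / (4 * exp 1 * sqrt (real N)))"
    using N by simp
  also have "\<dots> \<le> (real (Suc L) - real m) * (3 / (4 * exp 1 * sqrt (real N)))"
    using L m by (intro mult_right_mono) auto
  also have "\<dots> \<le> real (card {m..L}) * (3 / (4 * exp 1 * sqrt (real N)))"
    by (intro mult_right_mono) auto
  also have "\<dots> = (\<Sum>i\<in>{m..L}. 3 / (4 * exp 1 * sqrt (real N)))" by simp
  also have "\<dots> \<le> (\<Sum>i\<in>{m..L}. ?f (N - i))"
  proof (rule sum_mono)
    fix i assume "i \<in> {m..L}"
    hence "2 * real i \<le> sqrt (real N)" using L(1) by auto
    from poisson_term_ge[OF N this] show "3 / (4 * exp 1 * sqrt (real N)) \<le> ?f (N - i)" .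
  qed
  also have "\<dots> = (\<Sum>j\<in>(\<lambda>i. N - i) ` {m..L}. ?f j)"
    using LN by (subst sum.reindex) (auto simp: inj_on_def)
  also have "\<dots> \<le> (\<Sum>j\<le>k. ?f j)"
    using k by (intro sum_mono2) auto
  finally have "3 / (16 * exp 1) \<le> (\<Sum>j\<le>k. ?f j)" .
  moreover have "erlang_CDF k 1 (real N) = 1 - (\<Sum>j\<le>k. ?f j)"
    by (simp add: erlang_CDF_def)
  ultimately show ?thesis by simp
qed

lemma erlang_CDF_le_1: "x \<ge> 0 \<Longrightarrow> erlang_CDF k 1 x \<le> 1"
  by (simp add: erlang_CDF_def sum_nonneg)

text \<open>Once \<open>4 m <= sqrt N\<close>, the last \<open>m\<close> factors are at most a fixed
  \<open>q < 1\<close> and the others at most 1; so the product is eventually at most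
  \<open>q ^ m\<close>, for every \<open>m\<close>.\<close>

lemma erlang_product_tendsto_0:
  "(\<lambda>N. \<Prod>k<N. erlang_CDF k 1 (real N)) \<longlonglongrightarrow> 0"
proof -
  define q :: real where "q = 1 - 3 / (16 * exp 1)"
  have "3 / (16 * exp 1) < (1 :: real)" using exp_ge_add_one_self[of 1] by (simp add: field_simps)
  hence q: "0 < q" "q < 1" by (simp_all add: q_def)
  have bound: "(\<Prod>k<N. erlang_CDF k 1 (real N)) \<le> q ^ m" if N: "N \<ge> 1" "16 * m\<^sup>2 \<le> N" for N m
  proof -
    have "sqrt (real (16 * m\<^sup>2)) \<le> sqrt (real N)" using N(2) by (simp only: real_sqrt_le_iff of_nat_le_iff)
    hence m: "4 * real m \<le> sqrt (real N)" by (simp add: real_sqrt_mult)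
    have mN: "m \<le> N" using N(2) by (cases m) (auto simp: power2_eq_square)
    have "(\<Prod>k<N. erlang_CDF k 1 (real N)) = (\<Prod>k\<in>{..<N - m}. erlang_CDF k 1 (real N)) * (\<Prod>k\<in>{N - m..<N}. erlang_CDF k 1 (real N))"
      by (subst prod.union_disjoint[symmetric]) (auto intro!: prod.cong)
    also have "\<dots> \<le> 1 * (\<Prod>k\<in>{N - m..<N}. q)"
    proof (intro mult_mono)
      show "(\<Prod>k\<in>{..<N - m}. erlang_CDF k 1 (real N)) \<le> 1"
        by (intro prod_le_1) (auto simp: erlang_CDF_le_1)
      show "(\<Prod>k\<in>{N - m..<N}. erlang_CDF k 1 (real N)) \<le> (\<Prod>k\<in>{N - m..<N}. q)"
        using erlang_CDF_le_near_mean[OF N(1) m] by (intro prod_mono) (auto simp: q_def)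
    qed (auto intro!: prod_nonneg)
    finally show ?thesis using mN by simp
  qed
  show ?thesis
  proof (rule LIMSEQ_I)
    fix e :: real assume "e > 0"
    have "(\<lambda>m. q ^ m) \<longlonglongrightarrow> 0" using q by (intro LIMSEQ_realpow_zero) auto
    then obtain m where m: "q ^ m < e" using \<open>e > 0\<close> by (metis LIMSEQ_D diff_0_right norm_ge_zero order_refl real_norm_def abs_less_iff)
    show "\<exists>no. \<forall>N\<ge>no. norm ((\<Prod>k<N. erlang_CDF k 1 (real N)) - 0) < e"
    proof (intro exI allI impI)
      fix N assume "max 1 (16 * m\<^sup>2) \<le> N"
      hence "(\<Prod>k<N. erlang_CDF k 1 (real N)) \<le> q ^ m" by (intro bound) auto
      moreover have "(\<Prod>k<N. erlang_CDF k 1 (real N)) \<ge> 0" by (intro prod_nonneg) auto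
      ultimately show "norm ((\<Prod>k<N. erlang_CDF k 1 (real N)) - 0) < e" using m by simp
    qed
  qed
qed

text \<open>The Weierstrass product inequality, which turns a bound on the sum of the defects into a
  lower bound for the product.\<close>

lemma one_minus_sum_le_prod:
  fixes q :: "nat \<Rightarrow> real"
  assumes "\<And>k. k < n \<Longrightarrow> 0 \<le> q k \<and> q k \<le> 1"
  shows "1 - (\<Sum>k<n. q k) \<le> (\<Prod>k<n. 1 - q k)"
  using assms
proof (induction n)
  case (Suc n)
  have IH: "1 - (\<Sum>k<n. q k) \<le> (\<Prod>k<n. 1 - q k)" by (rule Suc.IH) (use Suc.prems in auto)
  have "(\<Prod>k<n. 1 - q k) \<le> 1" using Suc.prems by (intro prod_le_1) auto
  hence "q n * (\<Prod>k<n. 1 - q k) \<le> q n" using Suc.prems[of n] by (intro mult_left_le) auto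
  thus ?case using IH by (simp add: algebra_simps)
qed simp

text \<open>For \<open>k < N\<close> the defect is the probability that a Poisson variable of mean
  \<open>y N\<close> is at most \<open>k\<close>. Replacing \<open>y^j\<close> by \<open>y^N\<close>
  is a Chernoff bound by \<open>(y exp (1 - y)) ^ N\<close>, whose base is below 1; \<open>N\<close>
  such defects together still tend to 0.\<close>

lemma erlang_product_tendsto_1:
  assumes y: "y > 1"
  shows "(\<lambda>N. \<Prod>k<N. erlang_CDF k 1 (y * real N)) \<longlonglongrightarrow> 1"
proof (rule tendsto_sandwich)
  define \<rho> where "\<rho> = y * exp (1 - y)"
  have \<rho>: "0 < \<rho>" "\<rho> < 1"
  proof -
    show "0 < \<rho>" using y by (simp add: \<rho>_def)
    have "ln y < y - 1" using ln_le_minus_one[of y] ln_eq_minus_one[of y] y by fastforce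
    hence "exp (ln y) < exp (y - 1)" by simp
    hence "y < exp (y - 1)" using y by simp
    hence "y * exp (1 - y) < exp (y - 1) * exp (1 - y)" by simp
    thus "\<rho> < 1" by (simp add: \<rho>_def exp_add[symmetric])
  qed
  have tail: "(\<Sum>j\<le>k. (y * real N) ^ j * exp (- (y * real N)) / fact j) \<le> \<rho> ^ N" if k: "k < N" for k N
  proof -
    have "(\<Sum>j\<le>k. (y * real N) ^ j * exp (- (y * real N)) / fact j) \<le> (\<Sum>j\<le>k. y ^ N * exp (- (y * real N)) * (real N ^ j / fact j))"
    proof (rule sum_mono)
      fix j assume "j \<in> {..k}"
      hence "y ^ j \<le> y ^ N" using k y by (intro power_increasing) auto
      hence "y ^ j * (exp (- (y * real N)) * (real N ^ j / fact j)) \<le> y ^ N * (exp (- (y * real N)) * (real N ^ j / fact j))"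
        by (intro mult_right_mono) auto
      thus "(y * real N) ^ j * exp (- (y * real N)) / fact j \<le> y ^ N * exp (- (y * real N)) * (real N ^ j / fact j)"
        by (simp add: power_mult_distrib mult_ac)
    qed
    also have "\<dots> = y ^ N * exp (- (y * real N)) * (\<Sum>j\<le>k. real N ^ j / fact j)"
      by (simp add: sum_distrib_left)
    also have "(\<Sum>j\<le>k. real N ^ j / fact j) \<le> exp (real N)"
    proof -
      have s: "(\<lambda>j. real N ^ j / fact j) sums exp (real N)"
        using exp_converges[of "real N"] by (simp add: scaleR_conv_of_real field_simps)
      hence "(\<Sum>j\<in>{..k}. real N ^ j / fact j) \<le> (\<Sum>j. real N ^ j / fact j)"
        by (intro sum_le_suminf) (auto simp: sums_iff)
      thus ?thesis using s by (simp add: sums_iff)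
    qed
    hence "y ^ N * exp (- (y * real N)) * (\<Sum>j\<le>k. real N ^ j / fact j) \<le> y ^ N * exp (- (y * real N)) * exp (real N)"
      using y by (intro mult_left_mono) auto
    also have "\<dots> = \<rho> ^ N"
      by (simp add: \<rho>_def power_mult_distrib mult.assoc exp_add[symmetric] exp_of_nat_mult[symmetric] algebra_simps)
    finally show ?thesis by simp
  qed
  show "\<forall>\<^sub>F N in sequentially. 1 - real N * \<rho> ^ N \<le> (\<Prod>k<N. erlang_CDF k 1 (y * real N))"
  proof (rule always_eventually, rule allI)
    fix N
    define q where "q = (\<lambda>k. \<Sum>j\<le>k. (y * real N) ^ j * exp (- (y * real N)) / fact j)"
    have e: "erlang_CDF k 1 (y * real N) = 1 - q k" for k
      using y by (simp add: erlang_CDF_def q_def mult_less_0_iff)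
    have "(\<Sum>k<N. q k) \<le> (\<Sum>k<N. \<rho> ^ N)" by (intro sum_mono) (use tail in \<open>simp add: q_def\<close>)
    moreover have "1 - (\<Sum>k<N. q k) \<le> (\<Prod>k<N. 1 - q k)"
    proof (rule one_minus_sum_le_prod)
      fix k assume "k < N"
      have "q k \<ge> 0" unfolding q_def using y by (intro sum_nonneg) auto
      moreover have "1 - q k \<ge> 0" unfolding e[symmetric] by simp
      ultimately show "0 \<le> q k \<and> q k \<le> 1" by simp
    qed
    ultimately show "1 - real N * \<rho> ^ N \<le> (\<Prod>k<N. erlang_CDF k 1 (y * real N))"
      by (simp add: e)
  qed
  show "\<forall>\<^sub>F N in sequentially. (\<Prod>k<N. erlang_CDF k 1 (y * real N)) \<le> 1"
    using y by (intro always_eventually allI prod_le_1) (auto simp: erlang_CDF_le_1)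
  have "(\<lambda>N. real N * \<rho> ^ N) \<longlonglongrightarrow> 0" using powser_times_n_limit_0[of \<rho>] \<rho> by simp
  thus "(\<lambda>N. 1 - real N * \<rho> ^ N) \<longlonglongrightarrow> 1"
    using tendsto_diff[OF tendsto_const[of 1]] by fastforce
qed simp

section \<open>The Ginibre ensemble\<close>

lemma (in complex_ginibre) char_poly_eq_chi:
  assumes \<omega>: "\<omega> \<in> space M"
  shows "char_poly (A \<omega>) = chi N (\<lambda>p\<in>sq N. A \<omega> $$ p)"
proof -
  have "A \<omega> = Matrix.mat N N (\<lambda>p\<in>sq N. A \<omega> $$ p)"
    using dim[OF \<omega>] by (intro eq_matI) auto
  thus ?thesis unfolding chi_def by simp
qed

definition gauss_density :: "complex \<Rightarrow> ennreal"
  where "gauss_density w = ennreal (1 / pi * exp (- (cmod w)\<^sup>2))"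

lemma measurable_gauss_density [measurable]: "gauss_density \<in> borel_measurable borel"
  unfolding gauss_density_def by measurable

lemma emeasure_PiM_gauss:
  assumes S: "S \<in> sets (lebC (sq n))"
  shows "emeasure (PiM (sq n) (\<lambda>_. density lborel gauss_density)) S =
    ennreal (1 / pi ^ (n * n)) * (\<integral>\<^sup>+x. indicator S x * ennreal (exp (- frob n x)) \<partial>lebC (sq n))"
proof -
  have prob: "prob_space (density lborel gauss_density)"
  proof (rule prob_spaceI)
    have "emeasure (density lborel gauss_density) (space (density lborel gauss_density)) = (\<integral>\<^sup>+w. ennreal (1 / pi) * ennreal (exp (- (cmod w)\<^sup>2)) \<partial>lborel)"
      by (simp add: emeasure_density gauss_density_def ennreal_mult'[symmetric])
    also have "\<dots> = ennreal (1 / pi) * ennreal pi"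
      using nn_integral_gauss_moment[of 0] by (simp add: nn_integral_cmult)
    also have "\<dots> = 1" by (subst ennreal_mult[symmetric]) auto
    finally show "emeasure (density lborel gauss_density) (space (density lborel gauss_density)) = 1" .
  qed
  interpret G: prob_space "density lborel gauss_density" by (rule prob)
  interpret PG: product_sigma_finite "\<lambda>_ :: nat \<times> nat. density lborel gauss_density" ..
  have sets_eq: "sets (PiM (sq n) (\<lambda>_. density lborel gauss_density)) = sets (lebC (sq n))"
    by (rule sets_PiM_cong) auto
  have [measurable]: "(\<lambda>x. \<Prod>p\<in>sq n. gauss_density (x p)) \<in> borel_measurable (lebC (sq n))"
    by (intro borel_measurable_prod_ennreal measurable_compose[OF measurable_component_singleton]) auto
  have "density (lebC (sq n)) (\<lambda>x. \<Prod>p\<in>sq n. gauss_density (x p)) = PiM (sq n) (\<lambda>_. density lborel gauss_density)"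
  proof (rule PG.PiM_eqI)
    fix E :: "nat \<times> nat \<Rightarrow> complex set"
    assume E: "\<And>p. p \<in> sq n \<Longrightarrow> E p \<in> sets (density lborel gauss_density)"
    have box: "Pi\<^sub>E (sq n) E \<in> sets (lebC (sq n))" by (rule sets_PiM_I_finite) (use E in auto)
    have "emeasure (density (lebC (sq n)) (\<lambda>x. \<Prod>p\<in>sq n. gauss_density (x p))) (Pi\<^sub>E (sq n) E) =
      (\<integral>\<^sup>+x. (\<Prod>p\<in>sq n. gauss_density (x p)) * indicator (Pi\<^sub>E (sq n) E) x \<partial>lebC (sq n))"
      by (rule emeasure_density[OF _ box]) measurable
    also have "\<dots> = (\<integral>\<^sup>+x. (\<Prod>p\<in>sq n. gauss_density (x p) * indicator (E p) (x p)) \<partial>lebC (sq n))"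
    proof (rule nn_integral_cong)
      fix x assume "x \<in> space (lebC (sq n))"
      hence "x \<in> extensional (sq n)" by (auto simp: space_PiM PiE_def)
      hence "indicator (Pi\<^sub>E (sq n) E) x = (\<Prod>p\<in>sq n. indicator (E p) (x p) :: ennreal)"
      proof (cases "\<forall>p\<in>sq n. x p \<in> E p")
        case True
        hence "x \<in> Pi\<^sub>E (sq n) E" using \<open>x \<in> extensional (sq n)\<close> by (simp only: PiE_iff simp_thms)
        moreover have "(\<Prod>p\<in>sq n. indicator (E p) (x p) :: ennreal) = 1"
          by (rule prod.neutral) (use True in auto)
        ultimately show ?thesis by simp
      next
        case False
        then obtain p where p: "p \<in> sq n" "x p \<notin> E p" by blast
        hence "x \<notin> Pi\<^sub>E (sq n) E" by (auto simp only: PiE_iff)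
        moreover have "(\<Prod>p\<in>sq n. indicator (E p) (x p) :: ennreal) = 0"
          by (rule prod_zero, simp, rule bexI[OF _ p(1)]) (use p(2) in simp)
        ultimately show ?thesis by simp
      qed
      thus "(\<Prod>p\<in>sq n. gauss_density (x p)) * indicator (Pi\<^sub>E (sq n) E) x = (\<Prod>p\<in>sq n. gauss_density (x p) * indicator (E p) (x p))"
        by (simp add: prod.distrib)
    qed
    also have "\<dots> = (\<Prod>p\<in>sq n. \<integral>\<^sup>+w. gauss_density w * indicator (E p) w \<partial>lborel)"
      by (rule lebC.product_nn_integral_prod) (use E in \<open>auto intro!: borel_measurable_times_ennreal borel_measurable_indicator\<close>)
    also have "\<dots> = (\<Prod>p\<in>sq n. emeasure (density lborel gauss_density) (E p))"
      using E by (intro prod.cong refl emeasure_density[symmetric]) auto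
    finally show "emeasure (density (lebC (sq n)) (\<lambda>x. \<Prod>p\<in>sq n. gauss_density (x p))) (Pi\<^sub>E (sq n) E) =
      (\<Prod>p\<in>sq n. emeasure (density lborel gauss_density) (E p))" .
  qed (simp_all add: sets_eq)
  hence "emeasure (PiM (sq n) (\<lambda>_. density lborel gauss_density)) S = emeasure (density (lebC (sq n)) (\<lambda>x. \<Prod>p\<in>sq n. gauss_density (x p))) S"
    by simp
  also have "\<dots> = (\<integral>\<^sup>+x. (\<Prod>p\<in>sq n. gauss_density (x p)) * indicator S x \<partial>lebC (sq n))"
    by (rule emeasure_density[OF _ S]) measurable
  also have "\<dots> = (\<integral>\<^sup>+x. ennreal (1 / pi ^ (n * n)) * (indicator S x * ennreal (exp (- frob n x))) \<partial>lebC (sq n))"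
  proof (rule nn_integral_cong)
    fix x :: "nat \<times> nat \<Rightarrow> complex"
    have "(\<Prod>p\<in>sq n. gauss_density (x p)) = ennreal (\<Prod>p\<in>sq n. 1 / pi * exp (- (cmod (x p))\<^sup>2))"
      unfolding gauss_density_def by (rule prod_ennreal) auto
    also have "(\<Prod>p\<in>sq n. 1 / pi * exp (- (cmod (x p))\<^sup>2)) = 1 / pi ^ (n * n) * exp (- frob n x)"
      unfolding exp_frob prod.distrib by (simp add: card_cartesian_product power_divide)
    also have "ennreal (1 / pi ^ (n * n) * exp (- frob n x)) = ennreal (1 / pi ^ (n * n)) * ennreal (exp (- frob n x))"
      by (rule ennreal_mult) auto
    finally show "(\<Prod>p\<in>sq n. gauss_density (x p)) * indicator S x = ennreal (1 / pi ^ (n * n)) * (indicator S x * ennreal (exp (- frob n x)))"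
      by (simp only: mult_ac)
  qed
  also have "\<dots> = ennreal (1 / pi ^ (n * n)) * (\<integral>\<^sup>+x. indicator S x * ennreal (exp (- frob n x)) \<partial>lebC (sq n))"
    by (rule nn_integral_cmult) (use S in measurable)
  finally show ?thesis .
qed

text \<open>Independence makes the law of the entries a product of Gaussians, and the event depends
  on the characteristic polynomial only; so its probability is \<open>spec_integral U N []\<close>
  divided by the total mass \<open>pi ^ (N * N)\<close>.\<close>

lemma (in complex_ginibre) prob_spectrum_subset:
  assumes N: "N \<ge> 1" and U: "closed U" and rad: "\<And>s z. cmod s = 1 \<Longrightarrow> z \<in> U \<Longrightarrow> s * z \<in> U"
  shows "{\<omega> \<in> space M. spectrum (A \<omega>) \<subseteq> U} \<in> events"
    and "prob {\<omega> \<in> space M. spectrum (A \<omega>) \<subseteq> U} = (\<Prod>k<N. radial_mass U k / (pi * fact k))"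
proof -
  \<comment> \<open>Reading independence as a product law requires a nonempty index set.\<close>
  have ne: "sq N \<noteq> {}" using N by (auto simp: lessThan_empty_iff)
  have rv: "random_variable borel (\<lambda>\<omega>. A \<omega> $$ p)" if "p \<in> sq N" for p
  proof -
    from that obtain i j where p: "p = (i, j)" "i < N" "j < N" by auto
    from distributed_measurable[OF entry_distributed[OF p(2,3)]] show ?thesis unfolding p by simp
  qed
  define X where "X = (\<lambda>\<omega>. \<lambda>p\<in>sq N. A \<omega> $$ p)"
  define Q where "Q = PiM (sq N) (\<lambda>_. density lborel gauss_density)"
  have Xm[measurable]: "X \<in> measurable M (lebC (sq N))"
    unfolding X_def by (rule measurable_restrict) (use rv in simp)
  have setsQ: "sets Q = sets (lebC (sq N))"
    unfolding Q_def by (rule sets_PiM_cong) auto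
  have setsB: "sets (PiM (sq N) (\<lambda>_. borel :: complex measure)) = sets (lebC (sq N))"
    by (rule sets_PiM_cong) auto
  have "distr M (PiM (sq N) (\<lambda>_. borel)) X = PiM (sq N) (\<lambda>p. distr M borel (\<lambda>\<omega>. A \<omega> $$ p))"
    unfolding X_def
    by (rule indep_vars_iff_distr_eq_PiM'[THEN iffD1, OF ne rv entries_indep])
  also have "\<dots> = Q"
    unfolding Q_def
  proof (rule PiM_cong[OF refl])
    fix p assume "p \<in> sq N"
    then obtain i j where p: "p = (i, j)" "i < N" "j < N" by auto
    have "distr M borel (\<lambda>\<omega>. A \<omega> $$ p) = distr M lborel (\<lambda>\<omega>. A \<omega> $$ p)" by (rule distr_cong) auto
    also have "\<dots> = density lborel gauss_density"
      using distributed_distr_eq_density[OF entry_distributed[OF p(2,3)]]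
      by (simp add: p(1) gauss_density_def[abs_def])
    finally show "distr M borel (\<lambda>\<omega>. A \<omega> $$ p) = density lborel gauss_density" .
  qed
  finally have dX: "distr M (PiM (sq N) (\<lambda>_. borel)) X = Q" .
  define S where "S = {x \<in> space (lebC (sq N)). \<forall>z. poly (chi N x) z = 0 \<longrightarrow> z \<in> U}"
  have "Measurable.pred (lebC (sq N)) (\<lambda>x. \<forall>z. poly (chi N x) z = 0 \<longrightarrow> z \<in> U)"
    by (rule measurable_spectrum_subset[OF U]) auto
  hence S: "S \<in> sets (lebC (sq N))" unfolding S_def by measurable
  have eq: "{\<omega> \<in> space M. spectrum (A \<omega>) \<subseteq> U} = X -` S \<inter> space M"
  proof -
    have "spectrum (A \<omega>) \<subseteq> U \<longleftrightarrow> X \<omega> \<in> S" if \<omega>: "\<omega> \<in> space M" for \<omega>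
    proof -
      have "X \<omega> \<in> space (lebC (sq N))" using measurable_space[OF Xm \<omega>] .
      thus ?thesis
        unfolding spectrum_root_char_poly[OF dim[OF \<omega>]] char_poly_eq_chi[OF \<omega>] S_def X_def by auto
    qed
    thus ?thesis by auto
  qed
  show "{\<omega> \<in> space M. spectrum (A \<omega>) \<subseteq> U} \<in> events"
    unfolding eq by (rule measurable_sets[OF Xm S])
  have "emeasure M (X -` S \<inter> space M) = emeasure (distr M (PiM (sq N) (\<lambda>_. borel)) X) S"
    using S Xm by (intro emeasure_distr[symmetric]) (simp_all add: setsB cong: measurable_cong_sets)
  also have "\<dots> = ennreal (1 / pi ^ (N * N)) * (\<integral>\<^sup>+x. indicator S x * ennreal (exp (- frob N x)) \<partial>lebC (sq N))"
    unfolding dX Q_def by (rule emeasure_PiM_gauss[OF S])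
  also have "(\<integral>\<^sup>+x. indicator S x * ennreal (exp (- frob N x)) \<partial>lebC (sq N)) = spec_integral U N []"
    unfolding spec_integral_def by (intro nn_integral_cong) (auto simp: spec_weight_def S_def indicator_def)
  also have "\<dots> = ennreal (pi ^ (N * N) * (\<Prod>k<N. radial_mass U k / (pi * fact k)))"
    by (rule spec_integral_product[OF U rad])
  also have "ennreal (1 / pi ^ (N * N)) * \<dots> = ennreal (\<Prod>k<N. radial_mass U k / (pi * fact k))"
    by (subst ennreal_mult[symmetric]) (auto intro!: mult_nonneg_nonneg prod_nonneg)
  finally have "emeasure M {\<omega> \<in> space M. spectrum (A \<omega>) \<subseteq> U} = ennreal (\<Prod>k<N. radial_mass U k / (pi * fact k))"
    unfolding eq .
  thus "prob {\<omega> \<in> space M. spectrum (A \<omega>) \<subseteq> U} = (\<Prod>k<N. radial_mass U k / (pi * fact k))"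
    by (intro measure_eq_emeasure_eq_ennreal prod_nonneg) auto
qed

lemma scaled_spectral_radius_le_iff:
  assumes B: "B \<in> carrier_mat N N" and N: "N \<ge> 1"
  shows "scaled_spectral_radius B \<le> R \<longleftrightarrow> spectrum B \<subseteq> {z. cmod z \<le> R * sqrt (real N)}"
proof -
  have "finite (norm ` spectrum B)" "norm ` spectrum B \<noteq> {}"
    using card_finite_spectrum(1)[OF B] spectrum_non_empty[OF B] N by auto
  moreover have "scaled_spectral_radius B \<le> R \<longleftrightarrow> spectral_radius B \<le> R * sqrt (real N)"
    using N B by (simp add: scaled_spectral_radius_def divide_le_eq)
  ultimately show ?thesis unfolding spectral_radius_def by (auto simp: Max_le_iff)
qed

lemma scaled_minimum_modulus_ge_iff:
  assumes B: "B \<in> carrier_mat N N" and N: "N \<ge> 1"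
  shows "r \<le> scaled_minimum_modulus B \<longleftrightarrow> spectrum B \<subseteq> {z. r * sqrt (real N) \<le> cmod z}"
proof -
  have "finite (norm ` spectrum B)" "norm ` spectrum B \<noteq> {}"
    using card_finite_spectrum(1)[OF B] spectrum_non_empty[OF B] N by auto
  moreover have "r \<le> scaled_minimum_modulus B \<longleftrightarrow> r * sqrt (real N) \<le> minimum_modulus B"
    using N B by (simp add: scaled_minimum_modulus_def le_divide_eq)
  ultimately show ?thesis unfolding minimum_modulus_def by (auto simp: Min_ge_iff)
qed

lemma (in complex_ginibre) prob_spectral_radius:
  assumes N: "N \<ge> 1" and R: "R > 0"
  shows "{\<omega> \<in> space M. scaled_spectral_radius (A \<omega>) \<le> R} \<in> events"
    and "prob {\<omega> \<in> space M. scaled_spectral_radius (A \<omega>) \<le> R} = (\<Prod>k<N. erlang_CDF k 1 (R\<^sup>2 * real N))"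
proof -
  let ?U = "{z :: complex. cmod z \<le> R * sqrt (real N)}"
  have U: "closed ?U" by (intro closed_Collect_le continuous_intros)
  have rad: "s * z \<in> ?U" if "cmod s = 1" "z \<in> ?U" for s z using that by (simp add: norm_mult)
  have eq: "{\<omega> \<in> space M. scaled_spectral_radius (A \<omega>) \<le> R} = {\<omega> \<in> space M. spectrum (A \<omega>) \<subseteq> ?U}"
    using scaled_spectral_radius_le_iff[OF dim N] by auto
  show "{\<omega> \<in> space M. scaled_spectral_radius (A \<omega>) \<le> R} \<in> events"
    unfolding eq by (rule prob_spectrum_subset(1)[OF N U rad])
  show "prob {\<omega> \<in> space M. scaled_spectral_radius (A \<omega>) \<le> R} = (\<Prod>k<N. erlang_CDF k 1 (R\<^sup>2 * real N))"
  proof -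
    have "prob {\<omega> \<in> space M. spectrum (A \<omega>) \<subseteq> ?U} = (\<Prod>k<N. radial_mass ?U k / (pi * fact k))"
      by (rule prob_spectrum_subset(2)[OF N U rad])
    also have "\<dots> = (\<Prod>k<N. erlang_CDF k 1 (R\<^sup>2 * real N))"
      using R by (intro prod.cong refl) (simp add: radial_mass_cball power_mult_distrib)
    finally show ?thesis unfolding eq .
  qed
qed

lemma (in complex_ginibre) prob_minimum_modulus:
  assumes N: "N \<ge> 1" and r: "r > 0"
  shows "{\<omega> \<in> space M. r \<le> scaled_minimum_modulus (A \<omega>)} \<in> events"
    and "prob {\<omega> \<in> space M. r \<le> scaled_minimum_modulus (A \<omega>)} \<le> 1 / (r\<^sup>2 * real N)"
proof -
  let ?U = "{z :: complex. r * sqrt (real N) \<le> cmod z}"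
  have U: "closed ?U" by (intro closed_Collect_le continuous_intros)
  have rad: "s * z \<in> ?U" if "cmod s = 1" "z \<in> ?U" for s z using that by (simp add: norm_mult)
  have eq: "{\<omega> \<in> space M. r \<le> scaled_minimum_modulus (A \<omega>)} = {\<omega> \<in> space M. spectrum (A \<omega>) \<subseteq> ?U}"
    using scaled_minimum_modulus_ge_iff[OF dim N] by auto
  show "{\<omega> \<in> space M. r \<le> scaled_minimum_modulus (A \<omega>)} \<in> events"
    unfolding eq by (rule prob_spectrum_subset(1)[OF N U rad])
  obtain m where m: "N = Suc m" using N by (cases N) auto
  have "prob {\<omega> \<in> space M. r \<le> scaled_minimum_modulus (A \<omega>)} = (\<Prod>k<N. radial_mass ?U k / (pi * fact k))"
    unfolding eq by (rule prob_spectrum_subset(2)[OF N U rad])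
  also have "\<dots> = (\<Prod>k<Suc m. radial_mass ?U k / (pi * fact k))"
    by (intro prod.cong) (simp_all add: m)
  also have "\<dots> = radial_mass ?U 0 / pi * (\<Prod>k<m. radial_mass ?U (Suc k) / (pi * fact (Suc k)))"
    by (subst prod.lessThan_Suc_shift) simp
  also have "\<dots> \<le> 1 / (r * sqrt (real N))\<^sup>2 * 1"
  proof (intro mult_mono)
    show "radial_mass ?U 0 / pi \<le> 1 / (r * sqrt (real N))\<^sup>2"
      by (rule radial_mass_outside) (use r N in auto)
    show "(\<Prod>k<m. radial_mass ?U (Suc k) / (pi * fact (Suc k))) \<le> 1"
      by (intro prod_le_1) (use radial_mass_le[OF U] in \<open>auto simp del: fact_Suc simp: divide_le_eq\<close>)
  qed (auto intro!: prod_nonneg)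
  finally show "prob {\<omega> \<in> space M. r \<le> scaled_minimum_modulus (A \<omega>)} \<le> 1 / (r\<^sup>2 * real N)"
    by (simp add: power_mult_distrib)
qed

text \<open>The value of \<open>lim\<close> is unspecified for a divergent sequence, so convergence
  of all three probabilities is part of the conclusion.\<close>

theorem theorem5:
  fixes M :: "nat \<Rightarrow> 'a measure" and A :: "nat \<Rightarrow> 'a \<Rightarrow> complex mat"
    and r R :: real
  assumes "\<And>N. N \<ge> 1 \<Longrightarrow> complex_ginibre (M N) N (A N)"
    and "r > 0" and "R > 0"
  shows "convergent (\<lambda>N. \<P>(\<omega> in M N. scaled_minimum_modulus (A N \<omega>) \<ge> r \<and>
                                        scaled_spectral_radius (A N \<omega>) \<le> R)) \<and>
         convergent (\<lambda>N. \<P>(\<omega> in M N. scaled_minimum_modulus (A N \<omega>) \<ge> r)) \<and>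
         convergent (\<lambda>N. \<P>(\<omega> in M N. scaled_spectral_radius (A N \<omega>) \<le> R)) \<and>
         lim (\<lambda>N. \<P>(\<omega> in M N. scaled_minimum_modulus (A N \<omega>) \<ge> r \<and>
                                 scaled_spectral_radius (A N \<omega>) \<le> R)) =
           lim (\<lambda>N. \<P>(\<omega> in M N. scaled_minimum_modulus (A N \<omega>) \<ge> r)) *
           lim (\<lambda>N. \<P>(\<omega> in M N. scaled_spectral_radius (A N \<omega>) \<le> R))"
proof -
  define pj where "pj = (\<lambda>N. \<P>(\<omega> in M N. scaled_minimum_modulus (A N \<omega>) \<ge> r \<and> scaled_spectral_radius (A N \<omega>) \<le> R))"
  define pm where "pm = (\<lambda>N. \<P>(\<omega> in M N. scaled_minimum_modulus (A N \<omega>) \<ge> r))"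
  define ps where "ps = (\<lambda>N. \<P>(\<omega> in M N. scaled_spectral_radius (A N \<omega>) \<le> R))"
  \<comment> \<open>Nothing is assumed about dimension 0, so all comparisons are made eventually in
    \<open>N\<close>.\<close>
  have ev: "\<forall>\<^sub>F N in sequentially. N \<ge> (1::nat)" by (rule eventually_ge_at_top)
  have lim0: "(\<lambda>N. 1 / (r\<^sup>2 * real N)) \<longlonglongrightarrow> 0"
    using tendsto_mult[OF tendsto_const[of "1 / r\<^sup>2"] lim_1_over_n] by simp
  have pm_le: "pm N \<le> 1 / (r\<^sup>2 * real N)" if "N \<ge> 1" for N
    using complex_ginibre.prob_minimum_modulus(2)[OF assms(1)[OF that] that assms(2)] by (simp add: pm_def)
  have pj_le: "pj N \<le> pm N" if N: "N \<ge> 1" for N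
  proof -
    interpret G: complex_ginibre "M N" N "A N" by (rule assms(1)[OF N])
    show ?thesis unfolding pj_def pm_def
      by (rule G.finite_measure_mono[OF _ G.prob_minimum_modulus(1)[OF N assms(2)]]) auto
  qed
  have pm_lim: "pm \<longlonglongrightarrow> 0"
  proof (rule tendsto_sandwich[OF _ _ tendsto_const lim0])
    show "\<forall>\<^sub>F N in sequentially. pm N \<le> 1 / (r\<^sup>2 * real N)"
      using ev by eventually_elim (rule pm_le)
  qed (simp add: pm_def)
  have pj_lim: "pj \<longlonglongrightarrow> 0"
  proof (rule tendsto_sandwich[OF _ _ tendsto_const pm_lim])
    show "\<forall>\<^sub>F N in sequentially. pj N \<le> pm N"
      using ev by eventually_elim (rule pj_le)
  qed (simp add: pj_def)
  have ps_eq: "ps N = (\<Prod>k<N. erlang_CDF k 1 (R\<^sup>2 * real N))" if "N \<ge> 1" for N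
    using complex_ginibre.prob_spectral_radius(2)[OF assms(1)[OF that] that assms(3)] by (simp add: ps_def)
  have "\<exists>l. ps \<longlonglongrightarrow> l"
  proof (cases "R > 1")
    case True
    hence "R\<^sup>2 > 1" by (simp add: one_less_power)
    moreover have "\<forall>\<^sub>F N in sequentially. (\<Prod>k<N. erlang_CDF k 1 (R\<^sup>2 * real N)) = ps N"
      using ev by eventually_elim (simp add: ps_eq)
    ultimately have "ps \<longlonglongrightarrow> 1"
      using erlang_product_tendsto_1 by (blast intro: Lim_transform_eventually)
    thus ?thesis ..
  next
    \<comment> \<open>For \<open>R \<le> 1\<close> the event is contained in the one for radius 1,
      whose probability is the product at the critical point and tends to 0.\<close>
    case False
    have "ps \<longlonglongrightarrow> 0"
    proof (rule tendsto_sandwich[OF _ _ tendsto_const erlang_product_tendsto_0])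
      show "\<forall>\<^sub>F N in sequentially. ps N \<le> (\<Prod>k<N. erlang_CDF k 1 (real N))"
        using ev
      proof eventually_elim
        case (elim N)
        interpret G: complex_ginibre "M N" N "A N" by (rule assms(1)[OF elim])
        have "ps N \<le> G.prob {\<omega> \<in> space (M N). scaled_spectral_radius (A N \<omega>) \<le> 1}"
          unfolding ps_def
          by (rule G.finite_measure_mono[OF _ G.prob_spectral_radius(1)[OF elim]]) (use False in auto)
        also have "\<dots> = (\<Prod>k<N. erlang_CDF k 1 (real N))"
          using G.prob_spectral_radius(2)[OF elim, of 1] by simp
        finally show ?case .
      qed
    qed (auto simp: ps_def)
    thus ?thesis ..
  qed
  then obtain l where "ps \<longlonglongrightarrow> l" by blast
  hence "convergent pj \<and> convergent pm \<and> convergent ps \<and> lim pj = lim pm * lim ps"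
    using pm_lim pj_lim by (auto simp: convergent_def limI)
  thus ?thesis unfolding pj_def pm_def ps_def .
qed

end
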